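(* For integers $k$ with $4\leq k\leq 37$ and prime powers $q$, the following is the complete list of all pairs $(k,q)$ for which $\gamma(k,q)$ exists and $\gamma(k,q)\geq 7$, together with the values: $\gamma(8,17)=8$; $\gamma(9,19)=9$; $\gamma(10,11)=10$; $\gamma(11,23)=11$; $\gamma(12,13)=12$; $\gamma(14,29)=14$; $\gamma(15,31)=15$; $\gamma(16,17)=16$; $\gamma(18,73)=7$, $\gamma(18,19)=18$, $\gamma(18,37)=18$; $\gamma(20,121)=7$, $\gamma(20,61)=8$, $\gamma(20,11)=10$, $\gamma(20,41)=20$; $\gamma(21,43)=21$; $\gamma(22,89)=7$, $\gamma(22,67)=8$, $\gamma(22,23)=22$; $\gamma(23,139)=7$, $\gamma(23,47)=23$; $\gamma(24,17)=8$, $\gamma(24,73)=8$, $\gamma(24,97)=8$, $\gamma(24,13)=12$; $\gamma(25,151)=7$, $\gamma(25,101)=9$; $\gamma(26,157)=8$, $\gamma(26,79)=9$, $\gamma(26,53)=26$; $\gamma(27,163)=8$, $\gamma(27,19)=9$, $\gamma(27,109)=9$; $\gamma(28,113)=7$, $\gamma(28,29)=28$; $\gamma(29,59)=29$; $\gamma(30,181)=8$, $\gamma(30,11)=10$, $\gamma(30,121)=10$, $\gamma(30,31)=30$, $\gamma(30,61)=30$; $\gamma(32,193)=8$, $\gamma(32,97)=10$, $\gamma(32,17)=16$; $\gamma(33,199)=9$, $\gamma(33,23)=11$, $\gamma(33,67)=33$; $\gamma(34,103)=10$, $\gamma(34,137)=10$; $\gamma(35,211)=9$, $\gamma(35,71)=35$;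 $\gamma(36,181)=7$, $\gamma(36,109)=11$, $\gamma(36,13)=12$, $\gamma(36,19)=18$, $\gamma(36,37)=36$, $\gamma(36,73)=36$; $\gamma(37,149)=9$, $\gamma(37,223)=9$.
   Context: For a positive integer $k$ and a prime power $q$, $\gamma(k,q)$ denotes the smallest positive integer $m$ such that every element of the finite field $\mathbb{F}_q$ with $q$ elements can be written as a sum of $m$ many $k$-th powers of elements of $\mathbb{F}_q$ ($0$ being a $k$-th power); it does not exist if some element of $\mathbb{F}_q$ is not a sum of $k$-th powers. *)

theory Defs
  imports "HOL-Algebra.Algebra" "HOL-Number_Theory.Prime_Powers"
begin

text \<open>
  A field with \<open>q\<close> elements exists for every prime power \<open>q\<close> and is unique up to
  isomorphism, so the choice made here affects none of the notions below. Every finite field has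
  an isomorphic copy with carrier in \<^typ>\<open>nat\<close>, so restricting the carrier type loses nothing.
  For \<open>q\<close> not a prime power, \<open>GF q\<close> is an arbitrary record.
\<close>

definition GF :: "nat \<Rightarrow> nat ring" where
  "GF q = (SOME R. field R \<and> finite (carrier R) \<and> order R = q)"

definition sums_of_powers :: "('a, 'b) ring_scheme \<Rightarrow> nat \<Rightarrow> nat \<Rightarrow> 'a set" where
  "sums_of_powers R k m =
     {\<Oplus>\<^bsub>R\<^esub>i\<in>{..<m}. x i [^]\<^bsub>R\<^esub> k | x :: nat \<Rightarrow> 'a. x \<in> {..<m} \<rightarrow> carrier R}"

definition waring_bound :: "nat \<Rightarrow> nat \<Rightarrow> nat \<Rightarrow> bool" where
  "waring_bound k q m \<longleftrightarrow> 0 < m \<and> (\<forall>a\<in>carrier (GF q). a \<in> sums_of_powers (GF q) k m)"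

definition gamma_exists :: "nat \<Rightarrow> nat \<Rightarrow> bool" where
  "gamma_exists k q \<longleftrightarrow> (\<exists>m. waring_bound k q m)"

text \<open>The value of \<open>gamma k q\<close> is meaningful only under \<open>gamma_exists k q\<close>.\<close>

definition gamma :: "nat \<Rightarrow> nat \<Rightarrow> nat" where
  "gamma k q = (LEAST m. waring_bound k q m)"

end

theory Submission
  imports Defs "HOL-Number_Theory.Residues"
begin

text \<open>
  Over a field with \<open>q\<close> elements the \<open>k\<close>-th powers are the \<open>d\<close>-th powers for \<open>d = gcd k (q - 1)\<close>, so
  everything depends on \<open>d \<le> 37\<close> and on \<open>t = (q - 1) / d\<close>, the order of the group \<open>H\<close> of nonzero \<open>d\<close>-th
  powers.

  Let \<open>A\<close> be stable under \<open>H\<close>, with \<open>a\<close> elements. Convolution with the indicator of \<open>A\<close> acts on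
  \<open>H\<close>-invariant functions of mean zero with squared norm at most \<open>a (q - a) / t\<close>: average over all
  dilations of the field. Hence \<open>m\<close> summands from \<open>A\<close> reach every nonzero element if
  \<open>(a t) ^ m > q (q - a) ^ m\<close>. With \<open>A = H \<union> {0}\<close> and \<open>m = 6\<close> this gives \<open>\<gamma> \<le> 6\<close> once
  \<open>(t + 1) ^ 5 \<ge> d (d - 1) ^ 6\<close>, which leaves finitely many fields. For most of these the sums of two
  \<open>d\<close>-th powers already meet so many cosets of \<open>H\<close> that three summands from that set suffice. In the
  others, either \<open>H\<close> lies in a proper subfield and \<open>\<gamma>\<close> does not exist, or the iterated sumsets are
  computed inside \<open>\<int>\<^sub>p[\<theta>]\<close> for a root of unity \<open>\<theta>\<close> generating \<open>H\<close> and the field.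
\<close>

section \<open>Averaging over dilations\<close>

text \<open>The field is an abstract choice, so a certificate cannot name its elements. It speaks
  only of residues modulo \<open>p\<close> and of a polynomial X^e - r(X); a root in the given field
  is obtained by counting zeros. Irreducibility is not tested: that X^N differs from 1 modulo the
  polynomial, for a common multiple N of the numbers p^f - 1 with 0 < f < e, yields a root lying in
  no proper subfield. An upper bound needs only some of the sums. Hence a lower estimate of a sumset
  by cosets will do, at the price of one power x^t for each sum. A lower bound needs all sums of m -
  1 powers; there the whole sumset is computed and its leaves are counted. The counting bound leaves
  t \<le> 150 for d = 37, so no number to be tested exceeds 37 * 150 + 1 = 5551 < 75^2.\<close>

locale finite_field = field R for R (structure) +
  assumes finite_carrier: "finite (carrier R)"
begin

abbreviation (input) nonzero :: "'a set" where "nonzero \<equiv> carrier R - {\<zero>}"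

lemma sum_translate:
  fixes f :: "'a \<Rightarrow> real"
  assumes "a \<in> carrier R"
  shows "(\<Sum>x\<in>carrier R. f (x \<oplus> a)) = (\<Sum>x\<in>carrier R. f x)"
proof (rule sum.reindex_bij_witness[where i = "\<lambda>x. x \<ominus> a" and j = "\<lambda>x. x \<oplus> a"])
qed (use assms in \<open>auto simp: minus_eq a_assoc l_neg r_neg\<close>)

lemma sum_dilate:
  fixes f :: "'a \<Rightarrow> real"
  assumes "c \<in> nonzero"
  shows "(\<Sum>x\<in>carrier R. f (c \<otimes> x)) = (\<Sum>x\<in>carrier R. f x)"
proof (rule sum.reindex_bij_witness[where i = "\<lambda>x. inv c \<otimes> x" and j = "\<lambda>x. c \<otimes> x"])
  have u: "c \<in> Units R" "inv c \<in> carrier R" using assms by (auto simp: field_Units)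
  fix x assume x: "x \<in> carrier R"
  then show "inv c \<otimes> (c \<otimes> x) = x" "c \<otimes> (inv c \<otimes> x) = x" "inv c \<otimes> x \<in> carrier R" "c \<otimes> x \<in> carrier R"
    using u assms by (auto simp flip: m_assoc)
qed auto

lemma sum_dilate_nonzero:
  fixes f :: "'a \<Rightarrow> real"
  assumes "w \<in> nonzero"
  shows "(\<Sum>c\<in>nonzero. f (c \<otimes> w)) = (\<Sum>x\<in>nonzero. f x)"
proof (rule sum.reindex_bij_witness[where i = "\<lambda>x. x \<otimes> inv w" and j = "\<lambda>x. x \<otimes> w"])
  have u: "w \<in> Units R" "inv w \<in> nonzero" using assms Units_inv_Units by (auto simp: field_Units)
  fix x assume x: "x \<in> nonzero"
  then show "x \<otimes> inv w \<otimes> w = x" "x \<otimes> w \<otimes> inv w = x" "x \<otimes> inv w \<in> nonzero" "x \<otimes> w \<in> nonzero"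
    using u assms by (auto simp: m_assoc integral_iff)
qed auto

definition smear :: "'a set \<Rightarrow> ('a \<Rightarrow> real) \<Rightarrow> 'a \<Rightarrow> real" where
  "smear A f x = (\<Sum>y\<in>A. f (x \<ominus> y))"

text \<open>Substituting x + y for x, and then x for c x, shows that the correlation of the two
  translates depends on c, y and y' through c (y - y') alone.\<close>

lemma correlation_at_zero:
  fixes f :: "'a \<Rightarrow> real"
  assumes "y \<in> carrier R" "y' \<in> carrier R" "c \<in> nonzero"
  shows "(\<Sum>x\<in>carrier R. f (c \<otimes> (x \<ominus> y)) * f (c \<otimes> (x \<ominus> y'))) =
         (\<Sum>x\<in>carrier R. f x * f (x \<oplus> c \<otimes> (y \<ominus> y')))"
proof -
  have "(\<Sum>x\<in>carrier R. f (c \<otimes> (x \<ominus> y)) * f (c \<otimes> (x \<ominus> y'))) =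
        (\<Sum>x\<in>carrier R. f (c \<otimes> (x \<oplus> y \<ominus> y)) * f (c \<otimes> (x \<oplus> y \<ominus> y')))"
    by (rule sum_translate[OF assms(1), symmetric])
  also have "\<dots> = (\<Sum>x\<in>carrier R. f (c \<otimes> x) * f (c \<otimes> x \<oplus> c \<otimes> (y \<ominus> y')))"
    using assms by (intro sum.cong) (auto simp: minus_eq a_assoc r_neg r_distr)
  also have "\<dots> = (\<Sum>x\<in>carrier R. f x * f (x \<oplus> c \<otimes> (y \<ominus> y')))"
    by (rule sum_dilate[OF assms(3)])
  finally show ?thesis .
qed

text \<open>For y \<noteq> y' the element c (y - y') runs through all nonzero elements; as f has sum
  zero, its values at x + u with u \<noteq> 0 add up to - f x. For y = y' each of the q - 1 terms is
  the squared norm of f.\<close>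

lemma correlation_sum:
  fixes f :: "'a \<Rightarrow> real"
  assumes "y \<in> carrier R" "y' \<in> carrier R" and f0: "(\<Sum>x\<in>carrier R. f x) = 0"
  shows "(\<Sum>c\<in>nonzero. \<Sum>x\<in>carrier R. f (c \<otimes> (x \<ominus> y)) * f (c \<otimes> (x \<ominus> y'))) =
         (if y = y' then real (card (carrier R)) else 0) * (\<Sum>x\<in>carrier R. (f x)\<^sup>2) - (\<Sum>x\<in>carrier R. (f x)\<^sup>2)"
proof -
  have "(\<Sum>c\<in>nonzero. \<Sum>x\<in>carrier R. f (c \<otimes> (x \<ominus> y)) * f (c \<otimes> (x \<ominus> y'))) =
        (\<Sum>c\<in>nonzero. \<Sum>x\<in>carrier R. f x * f (x \<oplus> c \<otimes> (y \<ominus> y')))"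
    using assms by (intro sum.cong correlation_at_zero) auto
  also have "\<dots> = (\<Sum>x\<in>carrier R. f x * (\<Sum>c\<in>nonzero. f (x \<oplus> c \<otimes> (y \<ominus> y'))))"
    by (subst sum.swap) (simp add: sum_distrib_left)
  also have "\<dots> = (if y = y' then real (card (carrier R)) else 0) * (\<Sum>x\<in>carrier R. (f x)\<^sup>2) - (\<Sum>x\<in>carrier R.
    (f x)\<^sup>2)"
  proof (cases "y = y'")
    case True
    have "(\<Sum>x\<in>carrier R. f x * (\<Sum>c\<in>nonzero. f (x \<oplus> c \<otimes> (y \<ominus> y')))) = (\<Sum>x\<in>carrier R. real (card nonzero) *
      (f x)\<^sup>2)"
      using True assms by (intro sum.cong) (auto simp: minus_eq r_neg power2_eq_square)
    moreover have "real (card nonzero) = real (card (carrier R)) - 1"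
    proof -
      have "card nonzero = card (carrier R) - 1" "card (carrier R) > 0"
        using finite_carrier by (auto simp: card_gt_0_iff)
      then show ?thesis by simp
    qed
    ultimately have "(\<Sum>x\<in>carrier R. f x * (\<Sum>c\<in>nonzero. f (x \<oplus> c \<otimes> (y \<ominus> y')))) =
        (real (card (carrier R)) - 1) * (\<Sum>x\<in>carrier R. (f x)\<^sup>2)"
      by (simp only: sum_distrib_left)
    then show ?thesis using True by (simp add: left_diff_distrib)
  next
    case False
    then have w: "y \<ominus> y' \<in> nonzero" using assms by auto
    have "(\<Sum>c\<in>nonzero. f (x \<oplus> c \<otimes> (y \<ominus> y'))) = - f x" if x: "x \<in> carrier R" for x
    proof -
      have "(\<Sum>c\<in>nonzero. f (x \<oplus> c \<otimes> (y \<ominus> y'))) = (\<Sum>u\<in>nonzero. f (x \<oplus> u))"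
        by (rule sum_dilate_nonzero[OF w, of "\<lambda>u. f (x \<oplus> u)"])
      also have "\<dots> = (\<Sum>u\<in>carrier R. f (x \<oplus> u)) - f x"
        using finite_carrier x by (simp add: sum_diff1)
      also have "(\<Sum>u\<in>carrier R. f (x \<oplus> u)) = (\<Sum>u\<in>carrier R. f (u \<oplus> x))"
        using x by (intro sum.cong) (auto simp: a_comm)
      finally show ?thesis using sum_translate[OF x, of f] f0 by simp
    qed
    then have "(\<Sum>x\<in>carrier R. f x * (\<Sum>c\<in>nonzero. f (x \<oplus> c \<otimes> (y \<ominus> y')))) = (\<Sum>x\<in>carrier R. - (f x)\<^sup>2)"
      by (intro sum.cong) (auto simp: power2_eq_square)
    then show ?thesis using False by (simp add: sum_negf)
  qed
  finally show ?thesis .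
qed

text \<open>Averaging over all dilates \<open>x \<mapsto> f (c x)\<close> replaces the character-sum bound.\<close>
lemma smear_dilates:
  fixes f :: "'a \<Rightarrow> real"
  assumes A: "A \<subseteq> carrier R" and f0: "(\<Sum>x\<in>carrier R. f x) = 0"
  shows "(\<Sum>c\<in>nonzero. \<Sum>x\<in>carrier R. (smear A (\<lambda>x. f (c \<otimes> x)) x)\<^sup>2) =
         real (card A) * (real (card (carrier R)) - real (card A)) * (\<Sum>x\<in>carrier R. (f x)\<^sup>2)"
proof -
  let ?N = "\<Sum>x\<in>carrier R. (f x)\<^sup>2" and ?q = "real (card (carrier R))"
  have fA: "finite A" using A finite_carrier finite_subset by blast
  have "(\<Sum>c\<in>nonzero. \<Sum>x\<in>carrier R. (smear A (\<lambda>x. f (c \<otimes> x)) x)\<^sup>2) =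
     (\<Sum>c\<in>nonzero. \<Sum>x\<in>carrier R. \<Sum>y\<in>A. \<Sum>y'\<in>A. f (c \<otimes> (x \<ominus> y)) * f (c \<otimes> (x \<ominus> y')))"
    by (simp add: smear_def power2_eq_square sum_product)
  \<comment> \<open>The swaps carry the sums over y and y' outside, so that
    \<open>correlation_sum\<close> applies to each pair.\<close>
  also have "\<dots> = (\<Sum>y\<in>A. \<Sum>y'\<in>A. \<Sum>c\<in>nonzero. \<Sum>x\<in>carrier R. f (c \<otimes> (x \<ominus> y)) * f (c \<otimes> (x \<ominus> y')))"
    by (subst (5) sum.swap, subst (3) sum.swap, subst (4) sum.swap, subst (2) sum.swap) simp
  also have "\<dots> = (\<Sum>y\<in>A. \<Sum>y'\<in>A. (if y = y' then ?q else 0) * ?N - ?N)"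
    using A by (intro sum.cong correlation_sum f0) auto
  \<comment> \<open>With a = card A, the a diagonal pairs contribute q N each and all a^2 pairs
    contribute - N.\<close>
  also have "\<dots> = real (card A) * (?q - real (card A)) * ?N"
    using fA by (simp add: sum_subtractf flip: sum_distrib_right) (simp add: algebra_simps)
  finally show ?thesis .
qed

text \<open>For c in H the dilate of f is f itself, so the sum over all c contains card H equal
  terms, and the remaining ones are nonnegative. This is where invariance gains the factor card
  H.\<close>

lemma smear_bound:
  fixes f :: "'a \<Rightarrow> real"
  assumes A: "A \<subseteq> carrier R" and f0: "(\<Sum>x\<in>carrier R. f x) = 0"
    and H: "H \<subseteq> nonzero" and inv: "\<And>h x. h \<in> H \<Longrightarrow> x \<in> carrier R \<Longrightarrow> f (h \<otimes> x) = f x"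
  shows "real (card H) * (\<Sum>x\<in>carrier R. (smear A f x)\<^sup>2) \<le>
         real (card A) * (real (card (carrier R)) - real (card A)) * (\<Sum>x\<in>carrier R. (f x)\<^sup>2)"
proof -
  have "real (card H) * (\<Sum>x\<in>carrier R. (smear A f x)\<^sup>2) =
        (\<Sum>c\<in>H. \<Sum>x\<in>carrier R. (smear A (\<lambda>x. f (c \<otimes> x)) x)\<^sup>2)"
    unfolding smear_def using A inv by (simp add: subset_iff)
  also have "\<dots> \<le> (\<Sum>c\<in>nonzero. \<Sum>x\<in>carrier R. (smear A (\<lambda>x. f (c \<otimes> x)) x)\<^sup>2)"
    using H finite_carrier by (intro sum_mono2) (auto intro: sum_nonneg)
  finally show ?thesis using smear_dilates[OF A f0] by simp
qed

section \<open>Iterated sumsets and numbers of representations\<close>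

primrec nsum :: "nat \<Rightarrow> 'a set \<Rightarrow> 'a set" where
  "nsum 0 A = {\<zero>}"
| "nsum (Suc m) A = {x \<oplus> y | x y. x \<in> nsum m A \<and> y \<in> A}"

lemma nsum_closed: "A \<subseteq> carrier R \<Longrightarrow> nsum m A \<subseteq> carrier R"
  by (induction m) auto

lemma nsum_mono: "A \<subseteq> B \<Longrightarrow> nsum m A \<subseteq> nsum m B"
  by (induction m) (simp, fastforce)

lemma nsum_add:
  assumes "A \<subseteq> carrier R" "x \<in> nsum m A" "y \<in> nsum n A"
  shows "x \<oplus> y \<in> nsum (m + n) A"
  using assms(3)
proof (induction n arbitrary: y)
  case 0
  then show ?case using assms nsum_closed[OF assms(1), of m] by auto
next
  case (Suc n)
  then obtain u v where uv: "y = u \<oplus> v" "u \<in> nsum n A" "v \<in> A" by auto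
  then have "x \<oplus> y = (x \<oplus> u) \<oplus> v"
    using assms nsum_closed[OF assms(1)] by (metis a_assoc subsetD)
  then show ?case using Suc.IH[OF uv(2)] uv(3) by auto
qed

lemma nsum_mult:
  assumes "A \<subseteq> carrier R"
  shows "nsum m (nsum n A) \<subseteq> nsum (m * n) A"
proof (induction m)
  case (Suc m)
  show ?case
  proof
    fix z assume "z \<in> nsum (Suc m) (nsum n A)"
    then obtain x y where "z = x \<oplus> y" "x \<in> nsum m (nsum n A)" "y \<in> nsum n A" by auto
    then have "z \<in> nsum (m * n + n) A" using Suc.IH nsum_add[OF assms] by auto
    then show "z \<in> nsum (Suc m * n) A" by (simp add: add.commute)
  qed
qed simp

lemma nsum_step_mono:
  assumes "A \<subseteq> carrier R" "\<zero> \<in> A" "m \<le> n"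
  shows "nsum m A \<subseteq> nsum n A"
  using assms(3)
proof (induction n rule: dec_induct)
  case (step n)
  have "x \<in> nsum (Suc n) A" if "x \<in> nsum n A" for x
  proof -
    have "x = x \<oplus> \<zero>" using that nsum_closed[OF assms(1), of n] by auto
    then show ?thesis using that assms(2) by auto
  qed
  then show ?case using step by auto
qed simp

lemma nsum_dilate:
  assumes "A \<subseteq> carrier R" "h \<in> carrier R" "\<And>y. y \<in> A \<Longrightarrow> h \<otimes> y \<in> A" "x \<in> nsum m A"
  shows "h \<otimes> x \<in> nsum m A"
  using assms(4)
proof (induction m arbitrary: x)
  case (Suc m)
  then obtain u v where uv: "x = u \<oplus> v" "u \<in> nsum m A" "v \<in> A" by auto
  then have "h \<otimes> x = h \<otimes> u \<oplus> h \<otimes> v"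
    using assms nsum_closed[OF assms(1), of m] by (auto intro!: r_distr)
  then show ?case using Suc.IH[OF uv(2)] assms(3)[OF uv(3)] by auto
qed (use assms in auto)

text \<open>\<open>rep A m x\<close> counts the representations of \<open>x\<close> as an ordered sum of \<open>m + 1\<close> elements of \<open>A\<close>.\<close>
primrec rep :: "'a set \<Rightarrow> nat \<Rightarrow> 'a \<Rightarrow> real" where
  "rep A 0 = (\<lambda>x. of_bool (x \<in> A))"
| "rep A (Suc m) = smear A (rep A m)"

lemma rep_nonzero_imp_nsum:
  assumes A: "A \<subseteq> carrier R" and "x \<in> carrier R" "rep A m x \<noteq> 0"
  shows "x \<in> nsum (Suc m) A"
  using assms(2,3)
proof (induction m arbitrary: x)
  case 0
  then show ?case using A by (auto simp: of_bool_def split: if_splits intro!: exI[of _ x])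
next
  case (Suc m)
  have "(\<Sum>y\<in>A. rep A m (x \<ominus> y)) \<noteq> 0" using Suc.prems by (simp add: smear_def)
  then obtain y where y: "y \<in> A" "rep A m (x \<ominus> y) \<noteq> 0"
    by (meson sum.neutral)
  moreover have yc: "y \<in> carrier R" using y A by auto
  ultimately have "x \<ominus> y \<in> nsum (Suc m) A" using Suc.IH Suc.prems by simp
  moreover have "x = (x \<ominus> y) \<oplus> y" using yc Suc.prems by (simp add: minus_eq a_assoc l_neg)
  ultimately show ?case using y(1) by auto
qed

text \<open>The deviation of the representation counts from their average a^(m+1) / q has a squared
  norm that grows by at most a (q - a) / t with each convolution. If b had no representation,
  neither would h b for h in H, and these t elements alone would contribute t (a^(m+1) / q)^2, which
  contradicts \<open>big\<close>.\<close>

lemma covers_by_counting: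
  assumes A: "A \<subseteq> carrier R" and H: "H \<subseteq> nonzero" "H \<noteq> {}"
    and Hinv: "\<And>h. h \<in> H \<Longrightarrow> inv h \<in> H"
    and HA: "\<And>h y. h \<in> H \<Longrightarrow> y \<in> A \<Longrightarrow> h \<otimes> y \<in> A"
    and big: "(card A * card H) ^ Suc m > card (carrier R) * (card (carrier R) - card A) ^ Suc m"
    and b: "b \<in> nonzero"
  shows "b \<in> nsum (Suc m) A"
proof (rule ccontr)
  assume nb: "b \<notin> nsum (Suc m) A"
  define q where "q = real (card (carrier R))"
  define a where "a = real (card A)"
  define t where "t = real (card H)"
  have fA: "finite A" and fH: "finite H" using A H finite_carrier finite_subset by blast+
  have q0: "q > 0" unfolding q_def using finite_carrier by (auto simp: card_gt_0_iff)
  have t0: "t > 0" unfolding t_def using H fH by (auto simp: card_gt_0_iff)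
  have aq: "a \<le> q" unfolding a_def q_def using card_mono[OF finite_carrier A] by simp
  \<comment> \<open>Subtracting the average commutes with convolution and makes the sum vanish, as
    \<open>smear_bound\<close> requires.\<close>
  define \<rho> where "\<rho> k x = rep A k x - a ^ Suc k / q" for k x
  have \<rho>_Suc: "\<rho> (Suc k) x = smear A (\<rho> k) x" for k x
    unfolding \<rho>_def smear_def by (simp add: sum_subtractf a_def smear_def)
  have HU: "h \<in> Units R" "h \<in> carrier R" if "h \<in> H" for h
    using that H by (auto simp: field_Units)
  have rep_inv: "rep A k (h \<otimes> x) = rep A k x" if h: "h \<in> H" and x: "x \<in> carrier R" for k h x
    using x
  proof (induction k arbitrary: x)
    case 0
    have "x \<in> A" if "h \<otimes> x \<in> A"
      using HA[OF Hinv[OF h] that] HU[OF h] 0 by (auto simp flip: m_assoc)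
    then show ?case using HA[OF h] by (auto simp: of_bool_def)
  next
    case (Suc k)
    have "rep A (Suc k) (h \<otimes> x) = (\<Sum>y\<in>A. rep A k (h \<otimes> x \<ominus> y))" by (simp add: smear_def)
    \<comment> \<open>Multiplication by h permutes A; here closure of H under inverses
      enters.\<close>
    also have "\<dots> = (\<Sum>y\<in>A. rep A k (h \<otimes> x \<ominus> h \<otimes> y))"
    proof (rule sum.reindex_bij_witness[where i = "\<lambda>y. h \<otimes> y" and j = "\<lambda>y. inv h \<otimes> y"])
      fix y assume y: "y \<in> A"
      then have yc: "y \<in> carrier R" using A by auto
      show "h \<otimes> (inv h \<otimes> y) = y" "inv h \<otimes> (h \<otimes> y) = y" using HU[OF h] yc by (auto simp flip: m_assoc)
      then show "rep A k (h \<otimes> x \<ominus> h \<otimes> (inv h \<otimes> y)) = rep A k (h \<otimes> x \<ominus> y)" by simp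
      show "h \<otimes> y \<in> A" "inv h \<otimes> y \<in> A" using HA[OF h y] HA[OF Hinv[OF h] y] by auto
    qed
    also have "\<dots> = (\<Sum>y\<in>A. rep A k (x \<ominus> y))"
    proof (rule sum.cong[OF refl])
      fix y assume y: "y \<in> A"
      then have "h \<otimes> x \<ominus> h \<otimes> y = h \<otimes> (x \<ominus> y)"
        using HU[OF h] Suc.prems A by (auto simp: minus_eq r_distr r_minus)
      then show "rep A k (h \<otimes> x \<ominus> h \<otimes> y) = rep A k (x \<ominus> y)" using Suc.IH[of "x \<ominus> y"] Suc.prems y A by auto
    qed
    finally show ?case by (simp add: smear_def)
  qed
  have \<rho>_inv: "\<rho> k (h \<otimes> x) = \<rho> k x" if "h \<in> H" "x \<in> carrier R" for k h x
    unfolding \<rho>_def using rep_inv[OF that] by simp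
  have \<rho>_mean: "(\<Sum>x\<in>carrier R. \<rho> k x) = 0" for k
  proof (induction k)
    case 0
    have "(\<Sum>x\<in>carrier R. of_bool (x \<in> A)) = a"
      using A finite_carrier by (simp add: a_def of_bool_def sum.If_cases inf.absorb2)
    then show ?case using q0 by (simp add: \<rho>_def sum_subtractf flip: q_def)
  next
    case (Suc k)
    have "(\<Sum>x\<in>carrier R. \<rho> (Suc k) x) = (\<Sum>y\<in>A. \<Sum>x\<in>carrier R. \<rho> k (x \<ominus> y))"
      unfolding \<rho>_Suc smear_def by (rule sum.swap)
    also have "\<dots> = (\<Sum>y\<in>A. \<Sum>x\<in>carrier R. \<rho> k x)"
    proof (rule sum.cong[OF refl])
      fix y assume "y \<in> A"
      then have "\<ominus> y \<in> carrier R" using A by auto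
      then show "(\<Sum>x\<in>carrier R. \<rho> k (x \<ominus> y)) = (\<Sum>x\<in>carrier R. \<rho> k x)"
        unfolding minus_eq by (rule sum_translate)
    qed
    finally show ?case using Suc by simp
  qed
  have norm: "t ^ k * (\<Sum>x\<in>carrier R. (\<rho> k x)\<^sup>2) \<le> (a * (q - a)) ^ Suc k / q" for k
  proof (induction k)
    case 0
    have "(\<Sum>x\<in>carrier R. (\<rho> 0 x)\<^sup>2) = (\<Sum>x\<in>carrier R. of_bool (x \<in> A) - 2 * (a / q) * of_bool (x \<in> A) + (a / q)\<^sup>2)"
      by (intro sum.cong) (auto simp: \<rho>_def of_bool_def power2_eq_square algebra_simps)
    also have "\<dots> = a - 2 * (a / q) * a + q * (a / q)\<^sup>2"
    proof -
      have "(\<Sum>x\<in>carrier R. of_bool (x \<in> A)) = a"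
        using A finite_carrier by (simp add: a_def of_bool_def sum.If_cases inf.absorb2)
      then show ?thesis by (simp only: sum.distrib sum_subtractf sum_distrib_left[symmetric] sum_constant q_def)
    qed
    also have "\<dots> = a * (q - a) / q" using q0 by (simp add: field_simps power2_eq_square)
    finally show ?case by simp
  next
    case (Suc k)
    have "t * (\<Sum>x\<in>carrier R. (\<rho> (Suc k) x)\<^sup>2) \<le> a * (q - a) * (\<Sum>x\<in>carrier R. (\<rho> k x)\<^sup>2)"
      unfolding \<rho>_Suc t_def a_def q_def using smear_bound[OF A \<rho>_mean H(1) \<rho>_inv] by simp
    then have "t ^ k * (t * (\<Sum>x\<in>carrier R. (\<rho> (Suc k) x)\<^sup>2)) \<le> t ^ k * (a * (q - a) * (\<Sum>x\<in>carrier R. (\<rho> k x)\<^sup>2))"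
      using t0 by (intro mult_left_mono) auto
    also have "\<dots> = a * (q - a) * (t ^ k * (\<Sum>x\<in>carrier R. (\<rho> k x)\<^sup>2))" by simp
    also have "\<dots> \<le> a * (q - a) * ((a * (q - a)) ^ Suc k / q)"
      using Suc aq by (intro mult_left_mono) (auto simp: a_def)
    finally show ?case by (simp add: algebra_simps)
  qed
  have "rep A m b = 0" using rep_nonzero_imp_nsum[OF A] b nb by blast
  then have \<rho>b: "(\<rho> m b)\<^sup>2 = (a ^ Suc m / q)\<^sup>2" by (simp add: \<rho>_def power2_eq_square)
  have inj: "inj_on (\<lambda>h. h \<otimes> b) H"
    using b HU by (intro inj_onI) (auto simp: m_rcancel)
  have "t * (\<rho> m b)\<^sup>2 = (\<Sum>h\<in>H. (\<rho> m (h \<otimes> b))\<^sup>2)" using \<rho>_inv b by (simp add: t_def)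
  also have "\<dots> = (\<Sum>x\<in>(\<lambda>h. h \<otimes> b) ` H. (\<rho> m x)\<^sup>2)" using inj by (simp add: sum.reindex)
  also have "\<dots> \<le> (\<Sum>x\<in>carrier R. (\<rho> m x)\<^sup>2)"
    using HU b finite_carrier by (intro sum_mono2) auto
  finally have "t ^ m * (t * (a ^ Suc m / q)\<^sup>2) \<le> t ^ m * (\<Sum>x\<in>carrier R. (\<rho> m x)\<^sup>2)"
    unfolding \<rho>b using t0 by (intro mult_left_mono) auto
  also have "\<dots> \<le> (a * (q - a)) ^ Suc m / q" by (rule norm)
  finally have "t ^ Suc m * (a ^ Suc m) ^ 2 / q\<^sup>2 \<le> (a * (q - a)) ^ Suc m / q"
    by (simp add: power_divide algebra_simps)
  then have "t ^ Suc m * (a ^ Suc m) ^ 2 / q \<le> (a * (q - a)) ^ Suc m"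
    using q0 by (simp add: divide_simps power2_eq_square split: if_splits)
  then have "t ^ Suc m * (a ^ Suc m) ^ 2 \<le> q * (a * (q - a)) ^ Suc m"
    using q0 by (simp add: divide_simps mult.commute)
  then have "a ^ Suc m * (a * t) ^ Suc m \<le> a ^ Suc m * (q * (q - a) ^ Suc m)"
    by (simp only: power_mult_distrib power2_eq_square mult_ac)
  \<comment> \<open>For a = 0 the larger side of \<open>big\<close> would be 0. Positivity allows
    the common factor a^(m+1) to be cancelled.\<close>
  moreover have "a > 0" using big unfolding a_def by (intro ccontr[of "real (card A) > 0"]) auto
  ultimately have "(a * t) ^ Suc m \<le> q * (q - a) ^ Suc m"
    by (simp only: mult_le_cancel_left_pos zero_less_power)
  moreover have "(a * t) ^ Suc m > q * (q - a) ^ Suc m"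
  proof -
    have "q - a = real (card (carrier R) - card A)"
      using card_mono[OF finite_carrier A] by (simp add: q_def a_def of_nat_diff)
    then show ?thesis
      using big unfolding q_def a_def t_def by (simp only: flip: of_nat_mult of_nat_power)
  qed
  ultimately show False by linarith
qed

end

section \<open>Groups of powers\<close>

context finite_field begin

abbreviation (input) Q :: nat where "Q \<equiv> card (carrier R)"

lemma Q_gt_1: "Q > 1"
proof -
  have "card {\<zero>, \<one>} \<le> Q" using finite_carrier by (intro card_mono) auto
  then show ?thesis by simp
qed

lemma pow_Q1: "x \<in> nonzero \<Longrightarrow> x [^] (Q - 1) = \<one>"
  using group.pow_order_eq_1[OF field_mult_group, of x] order_mult_of[OF finite_carrier]
  by (simp add: order_def Multiplicative_Group.nat_pow_mult_of)

lemma nat_pow_nonzero [simp]: "x \<in> nonzero \<Longrightarrow> x [^] (n::nat) \<in> nonzero"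
  by (induction n) (auto simp: integral_iff)

lemma nat_pow_nonzero' [simp]: "x \<in> carrier R \<Longrightarrow> x \<noteq> \<zero> \<Longrightarrow> x [^] (n::nat) \<noteq> \<zero>"
  using nat_pow_nonzero by blast

lemma nat_pow_zero_pos: "n > 0 \<Longrightarrow> \<zero> [^] (n::nat) = \<zero>"
  by (cases n) auto

definition pows :: "nat \<Rightarrow> 'a set" where "pows d = (\<lambda>x. x [^] d) ` carrier R"

lemma pows_closed: "pows d \<subseteq> carrier R" by (auto simp: pows_def)
lemma zero_in_pows: "d > 0 \<Longrightarrow> \<zero> \<in> pows d" by (force simp: pows_def nat_pow_zero_pos)
lemma one_in_pows: "\<one> \<in> pows d" by (force simp: pows_def)
lemma pows_mult: "x \<in> pows d \<Longrightarrow> y \<in> pows d \<Longrightarrow> x \<otimes> y \<in> pows d"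
  by (auto simp: pows_def simp flip: nat_pow_distrib)
lemma pows_pow: "x \<in> pows d \<Longrightarrow> x [^] (n::nat) \<in> pows d"
  by (induction n) (auto simp: one_in_pows pows_mult)

text \<open>Bezout gives k u = (q - 1) v + gcd k (q - 1), and x^(q-1) = 1 for nonzero x, so the
  power of x with exponent gcd k (q - 1) is (x^u)^k. The other inclusion is divisibility.\<close>

lemma pows_gcd:
  assumes "k > 0"
  shows "pows k = pows (gcd k (Q - 1))"
proof
  let ?d = "gcd k (Q - 1)"
  obtain j where j: "k = ?d * j" using dvdE gcd_dvd1 by blast
  have "x [^] k = (x [^] j) [^] ?d" if "x \<in> carrier R" for x
    using that by (subst j) (simp add: nat_pow_pow mult.commute)
  then show "pows k \<subseteq> pows ?d" by (auto simp: pows_def)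
  obtain u v where uv: "k * u = (Q - 1) * v + ?d" using bezout_nat[of k "Q - 1"] assms by auto
  show "pows ?d \<subseteq> pows k"
  proof
    fix y assume "y \<in> pows ?d"
    then obtain x where x: "x \<in> carrier R" "y = x [^] ?d" by (auto simp: pows_def)
    show "y \<in> pows k"
    proof (cases "x = \<zero>")
      case True
      then show ?thesis using x assms zero_in_pows[of k] by (simp add: nat_pow_zero_pos)
    next
      case False
      have "(x [^] u) [^] k = x [^] ((Q - 1) * v) \<otimes> x [^] ?d"
        using x by (simp only: nat_pow_pow nat_pow_mult mult.commute[of u] uv)
      also have "x [^] ((Q - 1) * v) = \<one>" using x False pow_Q1[of x] by (simp flip: nat_pow_pow)
      finally have "y = (x [^] u) [^] k" using x by simp
      then show ?thesis using x(1) unfolding pows_def by blast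
    qed
  qed
qed

definition units_ord :: "nat \<Rightarrow> 'a set" where "units_ord t = {x \<in> carrier R. x [^] t = \<one>}"

lemma pow_mod_Q1: "x \<in> nonzero \<Longrightarrow> x [^] n = x [^] (n mod (Q - 1))"
proof -
  assume x: "x \<in> nonzero"
  have "x [^] n = x [^] ((Q - 1) * (n div (Q - 1)) + n mod (Q - 1))" by simp
  also have "\<dots> = x [^] ((Q - 1) * (n div (Q - 1))) \<otimes> x [^] (n mod (Q - 1))" using x
    by (simp only: nat_pow_mult[symmetric] Diff_iff)
  also have "x [^] ((Q - 1) * (n div (Q - 1))) = \<one>" using x pow_Q1[OF x] by (simp flip: nat_pow_pow)
  finally show ?thesis using x by simp
qed

lemma generator:
  obtains g where "g \<in> nonzero" "inj_on (\<lambda>i::nat. g [^] i) {..<Q - 1}" "nonzero = (\<lambda>i::nat. g [^] i) ` {..<Q - 1}"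
proof -
  obtain g where g: "g \<in> nonzero" "nonzero = {g [^] i | i::nat. i \<in> UNIV}"
    using finite_field_mult_group_has_gen[OF finite_carrier] by (auto simp: Multiplicative_Group.nat_pow_mult_of)
  have "nonzero \<subseteq> (\<lambda>i::nat. g [^] i) ` {..<Q - 1}"
  proof
    fix x assume "x \<in> nonzero"
    then obtain i :: nat where "x = g [^] i" using g(2) by blast
    then have "x = g [^] (i mod (Q - 1))" using pow_mod_Q1[OF g(1)] by simp
    moreover have "i mod (Q - 1) < Q - 1" using Q_gt_1 by simp
    ultimately show "x \<in> (\<lambda>i::nat. g [^] i) ` {..<Q - 1}" by blast
  qed
  then have eq: "nonzero = (\<lambda>i::nat. g [^] i) ` {..<Q - 1}" using g by auto
  have "card nonzero = Q - 1" using finite_carrier by simp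
  then have "inj_on (\<lambda>i::nat. g [^] i) {..<Q - 1}" using eq by (intro eq_card_imp_inj_on) auto
  then show ?thesis using that g(1) eq by blast
qed

text \<open>For a generator g, the g^(d j) with j < t are t distinct nonzero d-th powers. Nonzero
  d-th powers are roots of X^t - 1, which has at most t roots, so all these sets coincide.\<close>

lemma units_ord_eq:
  assumes "Q - 1 = d * t"
  shows "pows d = insert \<zero> (units_ord t)" "card (units_ord t) = t"
proof -
  have dt: "d > 0" "t > 0" using assms Q_gt_1 by (auto intro: Nat.gr0I)
  obtain g where g: "g \<in> nonzero" "inj_on (\<lambda>i::nat. g [^] i) {..<Q - 1}" by (rule generator)
  have sub: "pows d \<subseteq> insert \<zero> (units_ord t)"
  proof
    fix y assume "y \<in> pows d"
    then obtain x where x: "x \<in> carrier R" "y = x [^] d" by (auto simp: pows_def)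
    show "y \<in> insert \<zero> (units_ord t)"
    proof (cases "x = \<zero>")
      case False
      then have "x [^] (d * t) = \<one>" using x(1) pow_Q1[of x] unfolding assms by blast
      then show ?thesis using x by (simp add: units_ord_def nat_pow_pow)
    qed (use x dt in \<open>auto simp: nat_pow_zero_pos\<close>)
  qed
  have inj: "inj_on (\<lambda>j. g [^] (d * j)) {..<t}"
  proof (rule inj_onI)
    fix i j assume "i \<in> {..<t}" "j \<in> {..<t}" and eq: "g [^] (d * i) = g [^] (d * j)"
    then have "d * i \<in> {..<Q - 1}" "d * j \<in> {..<Q - 1}" using dt assms by auto
    then have "d * i = d * j" using inj_onD[OF g(2) eq] by blast
    then show "i = j" using dt by simp
  qed
  have im: "(\<lambda>j. g [^] (d * j)) ` {..<t} \<subseteq> pows d - {\<zero>}"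
  proof
    fix y assume "y \<in> (\<lambda>j. g [^] (d * j)) ` {..<t}"
    then obtain j where "y = g [^] (d * j)" by auto
    then have "y = (g [^] j) [^] d" "y \<in> nonzero" using g(1) by (auto simp: nat_pow_pow mult.commute)
    then show "y \<in> pows d - {\<zero>}" using g(1) by (auto simp: pows_def)
  qed
  have fin: "finite (units_ord t)" using finite_carrier by (simp add: units_ord_def)
  have "t = card ((\<lambda>j. g [^] (d * j)) ` {..<t})" using inj by (simp add: card_image)
  also have "\<dots> \<le> card (pows d - {\<zero>})"
    using im finite_subset[OF pows_closed finite_carrier] by (intro card_mono) auto
  finally have 1: "t \<le> card (pows d - {\<zero>})" .
  have 2: "card (units_ord t) \<le> t" unfolding units_ord_def using num_roots_le_deg[OF finite_carrier] dt by simp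
  have 3: "pows d - {\<zero>} \<subseteq> units_ord t" using sub by auto
  have "pows d - {\<zero>} = units_ord t"
    using 1 2 card_mono[OF fin 3] card_subset_eq[OF fin 3] by linarith
  then show "pows d = insert \<zero> (units_ord t)" using zero_in_pows[OF dt(1)] by auto
  show "card (units_ord t) = t" using 1 2 card_mono[OF fin 3] by linarith
qed

lemma units_ord_nonzero: "t > 0 \<Longrightarrow> units_ord t \<subseteq> nonzero"
  by (auto simp: units_ord_def nat_pow_zero_pos)

lemma units_ord_inv: "x \<in> units_ord t \<Longrightarrow> t > 0 \<Longrightarrow> inv x \<in> units_ord t"
proof -
  assume x: "x \<in> units_ord t" and t: "t > 0"
  then have u: "x \<in> Units R" "x \<in> carrier R" "x [^] t = \<one>" using units_ord_nonzero
    by (auto simp: units_ord_def field_Units)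
  have "(x \<otimes> inv x) [^] t = \<one>" using u by simp
  then have "x [^] t \<otimes> (inv x) [^] t = \<one>" using u by (subst (asm) nat_pow_distrib) auto
  then show "inv x \<in> units_ord t" using u by (simp add: units_ord_def)
qed

lemma sums_of_powers_eq: "sums_of_powers R k m = nsum m (pows k)"
proof (induction m)
  case 0
  then show ?case by (auto simp: sums_of_powers_def)
next
  case (Suc m)
  have step: "(\<Oplus>i\<in>{..<Suc m}. x i [^] k) = (\<Oplus>i\<in>{..<m}. x i [^] k) \<oplus> x m [^] k"
    if "x \<in> {..<Suc m} \<rightarrow> carrier R" for x :: "nat \<Rightarrow> 'a"
    using that by (subst lessThan_Suc, subst finsum_insert) (auto simp: Pi_def a_comm)
  show ?case
  proof (intro equalityI subsetI)
    fix z assume "z \<in> sums_of_powers R k (Suc m)"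
    then obtain x :: "nat \<Rightarrow> 'a" where x: "x \<in> {..<Suc m} \<rightarrow> carrier R" "z = (\<Oplus>i\<in>{..<Suc m}. x i [^] k)"
      by (auto simp: sums_of_powers_def)
    then have "x \<in> {..<m} \<rightarrow> carrier R" "x m \<in> carrier R" by auto
    then have "(\<Oplus>i\<in>{..<m}. x i [^] k) \<in> nsum m (pows k)" "x m [^] k \<in> pows k"
      using Suc by (auto simp: sums_of_powers_def pows_def)
    then show "z \<in> nsum (Suc m) (pows k)" using step[OF x(1)] x(2) by auto
  next
    fix z assume "z \<in> nsum (Suc m) (pows k)"
    then obtain u v where uv: "z = u \<oplus> v [^] k" "u \<in> nsum m (pows k)" "v \<in> carrier R" by (auto simp: pows_def)
    then obtain x :: "nat \<Rightarrow> 'a" where x: "x \<in> {..<m} \<rightarrow> carrier R" "u = (\<Oplus>i\<in>{..<m}. x i [^] k)"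
      using Suc by (auto simp: sums_of_powers_def)
    define y where "y = x(m := v)"
    have y: "y \<in> {..<Suc m} \<rightarrow> carrier R" using x uv by (auto simp: y_def less_Suc_eq)
    have "(\<Oplus>i\<in>{..<m}. y i [^] k) = (\<Oplus>i\<in>{..<m}. x i [^] k)"
      using x by (intro finsum_cong') (auto simp: y_def)
    then have "z = (\<Oplus>i\<in>{..<Suc m}. y i [^] k)" using step[OF y] x uv by (simp add: y_def)
    then show "z \<in> sums_of_powers R k (Suc m)" using y by (auto simp: sums_of_powers_def)
  qed
qed

definition covers :: "nat \<Rightarrow> nat \<Rightarrow> bool" where "covers d m \<longleftrightarrow> carrier R \<subseteq> nsum m (pows d)"

lemma covers_mono: "covers d m \<Longrightarrow> m \<le> n \<Longrightarrow> d > 0 \<Longrightarrow> covers d n"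
  unfolding covers_def using nsum_step_mono[OF pows_closed zero_in_pows] by blast

text \<open>The set of \<open>d\<close>-th powers as \<open>A\<close> in \<open>covers_by_counting\<close>.\<close>
lemma covers_large:
  assumes Q: "Q = d * t + 1" and big: "(t + 1) ^ 5 \<ge> d * (d - 1) ^ 6"
  shows "covers d 6"
  unfolding covers_def
proof
  fix b assume b: "b \<in> carrier R"
  have dt: "d > 0" "t > 0" using Q Q_gt_1 by (auto intro: Nat.gr0I)
  note H = units_ord_eq[of d t]
  have fin: "finite (units_ord t)" using finite_carrier by (simp add: units_ord_def)
  have "\<zero> \<notin> units_ord t" using units_ord_nonzero[OF dt(2)] by auto
  then have cA: "card (pows d) = t + 1" using H Q fin by simp
  show "b \<in> nsum 6 (pows d)"
  proof (cases "b = \<zero>")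
    case True
    then show ?thesis using nsum_step_mono[OF pows_closed zero_in_pows[OF dt(1)], of 0 6] by auto
  next
    case False
    have "b \<in> nsum (Suc 5) (pows d)"
    proof (rule covers_by_counting[OF pows_closed units_ord_nonzero[OF dt(2)]])
      show "units_ord t \<noteq> {}" by (auto simp: units_ord_def)
      show "h \<otimes> y \<in> pows d" if "h \<in> units_ord t" "y \<in> pows d" for h y
        using that H(1) Q by (auto intro: pows_mult)
      have s: "Suc 5 = (6::nat)" and cH: "card (units_ord t) = t" using H(2) Q by auto
      have "Q - card (pows d) = (d - 1) * t" using dt unfolding cA Q
        by (simp add: algebra_simps diff_mult_distrib)
      \<comment> \<open>Since q - a = (d - 1) t, the factor t^6 cancels and this inequality remains.
        Enlarging d t + 1 to d (t + 1) splits off one factor t + 1, which leaves the exponent 5 of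
        \<open>big\<close>; the enlargement is strict only for d > 1.\<close>
      moreover have "(d * t + 1) * (d - 1) ^ 6 < (t + 1) ^ 6"
      proof (cases "d = 1")
        case False
        have "(d * t + 1) * (d - 1) ^ 6 < (d * (t + 1)) * (d - 1) ^ 6"
        proof (intro mult_strict_right_mono)
          show "d * t + 1 < d * (t + 1)" using False dt by simp
        qed (use False dt in simp)
        also have "\<dots> = (t + 1) * (d * (d - 1) ^ 6)" by (simp only: mult_ac)
        also have "\<dots> \<le> (t + 1) * (t + 1) ^ 5" using big by (intro mult_left_mono) auto
        finally show ?thesis by (simp add: eval_nat_numeral)
      qed simp
      then have "(d * t + 1) * (d - 1) ^ 6 * t ^ 6 < (t + 1) ^ 6 * t ^ 6"
        using dt by (intro mult_strict_right_mono) auto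
      then have "Q * ((d - 1) * t) ^ 6 < ((t + 1) * t) ^ 6"
        unfolding Q power_mult_distrib by (simp only: mult.assoc)
      ultimately show "Q * (Q - card (pows d)) ^ Suc 5 < (card (pows d) * card (units_ord t)) ^ Suc 5"
        unfolding s cH by (simp only: cA)
    qed (use b False dt units_ord_inv in auto)
    then show ?thesis by (simp add: numeral_eq_Suc)
  qed
qed

text \<open>Three summands from the set of sums of two \<open>d\<close>-th powers, which meets at least \<open>n\<close> cosets of the group
  of nonzero \<open>d\<close>-th powers; \<open>x \<mapsto> x ^ t\<close> separates these cosets.\<close>
lemma covers_classes:
  assumes Q: "Q = d * t + 1" and C: "C \<subseteq> nonzero" "card C = n"
    and CA: "\<And>c. c \<in> C \<Longrightarrow> \<exists>x\<in>nsum 2 (pows d). x [^] t = c"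
    and big: "(n * t + 1) ^ 3 > Q * (d - n) ^ 3"
  shows "covers d 6"
  unfolding covers_def
proof
  fix b assume b: "b \<in> carrier R"
  have dt: "d > 0" "t > 0" using Q Q_gt_1 by (auto intro: Nat.gr0I)
  note H = units_ord_eq[of d t]
  define A where "A = nsum 2 (pows d)"
  have A: "A \<subseteq> carrier R" unfolding A_def by (intro nsum_closed pows_closed)
  have A0: "\<zero> \<in> A" unfolding A_def using nsum_step_mono[OF pows_closed zero_in_pows[OF dt(1)], of 0 2] by auto
  have fin: "finite (units_ord t)" "finite A" "finite C"
    using finite_carrier finite_subset[OF A] finite_subset[OF C(1)] by (auto simp: units_ord_def)
  have HA: "h \<otimes> y \<in> A" if "h \<in> units_ord t" "y \<in> A" for h y
  proof -
    have "h \<in> pows d" "h \<in> carrier R" using that H(1) Q by (auto simp: units_ord_def)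
    then show ?thesis using that(2) pows_mult unfolding A_def by (intro nsum_dilate pows_closed) auto
  qed
  obtain \<xi> where \<xi>: "\<And>c. c \<in> C \<Longrightarrow> \<xi> c \<in> A" "\<And>c. c \<in> C \<Longrightarrow> \<xi> c [^] t = c"
    using CA unfolding A_def by metis
  have \<xi>0: "\<xi> c \<in> nonzero" if "c \<in> C" for c
    using \<xi>[OF that] C that A dt by (auto simp: nat_pow_zero_pos)
  have Hc: "h \<in> carrier R" "h [^] t = \<one>" if "h \<in> units_ord t" for h using that by (auto simp: units_ord_def)
  \<comment> \<open>A contains 0 and, with a representative of a class, its whole coset. The t-th
    power recovers the class, so the n t + 1 elements obtained are distinct.\<close>
  have "card (insert \<zero> ((\<lambda>(c, h). h \<otimes> \<xi> c) ` (C \<times> units_ord t))) \<le> card A"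
    using HA \<xi> A0 fin by (intro card_mono) auto
  moreover have "inj_on (\<lambda>(c, h). h \<otimes> \<xi> c) (C \<times> units_ord t)"
  proof (rule inj_onI, clarify)
    fix c h c' h' assume *: "c \<in> C" "h \<in> units_ord t" "c' \<in> C" "h' \<in> units_ord t" "h \<otimes> \<xi> c = h' \<otimes> \<xi> c'"
    have "(h \<otimes> \<xi> c) [^] t = c" "(h' \<otimes> \<xi> c') [^] t = c'"
      using *(1-4) \<xi> \<xi>0 Hc C by (auto simp: nat_pow_distrib)
    then have "c = c'" using * by simp
    then show "c = c' \<and> h = h'" using * \<xi>0 Hc by (auto simp: m_rcancel)
  qed
  moreover have "\<zero> \<notin> (\<lambda>(c, h). h \<otimes> \<xi> c) ` (C \<times> units_ord t)"
    using \<xi>0 units_ord_nonzero[OF dt(2)] by (auto simp: integral_iff dest!: sym[of \<zero>])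
  ultimately have cA: "n * t + 1 \<le> card A"
    using fin C H(2) Q by (simp add: card_image)
  show "b \<in> nsum 6 (pows d)"
  proof (cases "b = \<zero>")
    case True
    then show ?thesis using nsum_step_mono[OF pows_closed zero_in_pows[OF dt(1)], of 0 6] by auto
  next
    case False
    have "b \<in> nsum (Suc 2) A"
    proof (rule covers_by_counting[OF A units_ord_nonzero[OF dt(2)]])
      show "units_ord t \<noteq> {}" by (auto simp: units_ord_def)
      have "Q - card A \<le> (d - n) * t" using cA unfolding Q by (simp add: algebra_simps diff_mult_distrib)
      then have "Q * (Q - card A) ^ Suc 2 \<le> Q * ((d - n) * t) ^ 3"
        by (intro mult_left_mono) (auto simp: numeral_eq_Suc intro!: mult_mono)
      also have "\<dots> = Q * (d - n) ^ 3 * t ^ 3" by (simp add: power_mult_distrib)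
      also have "\<dots> < (n * t + 1) ^ 3 * t ^ 3" using big dt by (intro mult_strict_right_mono) auto
      also have "\<dots> = ((n * t + 1) * t) ^ 3" by (simp only: power_mult_distrib)
      also have "\<dots> \<le> (card A * t) ^ 3" using cA by (intro power_mono mult_right_mono) auto
      finally show "Q * (Q - card A) ^ Suc 2 < (card A * card (units_ord t)) ^ Suc 2"
        using H(2) Q by (simp add: numeral_eq_Suc)
    qed (use b False dt units_ord_inv HA in auto)
    then have "b \<in> nsum 3 (nsum 2 (pows d))" by (simp add: A_def numeral_eq_Suc)
    then show ?thesis using nsum_mult[OF pows_closed, of 3 2 d] by auto
  qed
qed

end

section \<open>Binary arithmetic and trees of vectors\<close>

text \<open>Little-endian binary numbers, evaluated by the simplifier. Leading zeros are allowed, so equality of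
  values is \<open>eqv\<close>, not \<open>=\<close>. Counters are unary lists. Throughout, a test is passed as a Boolean argument
  to an auxiliary function (\<open>csub'\<close>, \<open>ins'\<close>, \<dots>) so that rewriting evaluates the test before either
  branch.\<close>
datatype bin = BE | B0 bin | B1 bin

fun val :: "bin \<Rightarrow> nat" where
  "val BE = 0" | "val (B0 x) = 2 * val x" | "val (B1 x) = 2 * val x + 1"

fun inc :: "bin \<Rightarrow> bin" where "inc BE = B1 BE" | "inc (B0 x) = B1 x" | "inc (B1 x) = B0 (inc x)"

fun add :: "bin \<Rightarrow> bin \<Rightarrow> bin" and addc :: "bin \<Rightarrow> bin \<Rightarrow> bin" where
  "add BE y = y"
| "add (B0 x) BE = B0 x"
| "add (B0 x) (B0 y) = B0 (add x y)"
| "add (B0 x) (B1 y) = B1 (add x y)"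
| "add (B1 x) BE = B1 x"
| "add (B1 x) (B0 y) = B1 (add x y)"
| "add (B1 x) (B1 y) = B0 (addc x y)"
| "addc BE y = inc y"
| "addc (B0 x) BE = B1 x"
| "addc (B0 x) (B0 y) = B1 (add x y)"
| "addc (B0 x) (B1 y) = B0 (addc x y)"
| "addc (B1 x) BE = B0 (inc x)"
| "addc (B1 x) (B0 y) = B0 (addc x y)"
| "addc (B1 x) (B1 y) = B1 (addc x y)"

text \<open>The flag is the answer in case of equality.\<close>
fun lt :: "bin \<Rightarrow> bin \<Rightarrow> bool \<Rightarrow> bool" where
  "lt BE BE c = c"
| "lt BE (B0 y) c = lt BE y c"
| "lt BE (B1 y) c = True"
| "lt (B0 x) BE c = lt x BE c"
| "lt (B1 x) BE c = False"
| "lt (B0 x) (B0 y) c = lt x y c"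
| "lt (B0 x) (B1 y) c = lt x y True"
| "lt (B1 x) (B0 y) c = lt x y False"
| "lt (B1 x) (B1 y) c = lt x y c"

text \<open>Unlike \<open>B0\<close>, this keeps zero as \<open>BE\<close>, which limits the growth
  of leading zeros.\<close>

fun dbl :: "bin \<Rightarrow> bin" where "dbl BE = BE" | "dbl (B0 x) = B0 (B0 x)" | "dbl (B1 x) = B0 (B1 x)"

fun dec :: "bin \<Rightarrow> bin" where "dec BE = BE" | "dec (B0 x) = B1 (dec x)" | "dec (B1 x) = dbl x"

text \<open>\<open>sub\<close> and \<open>dec\<close> are meaningful only without underflow.\<close>
fun sub :: "bin \<Rightarrow> bin \<Rightarrow> bin" and subc :: "bin \<Rightarrow> bin \<Rightarrow> bin" where
  "sub x BE = x"
| "sub BE (B0 y) = BE"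
| "sub BE (B1 y) = BE"
| "sub (B0 x) (B0 y) = dbl (sub x y)"
| "sub (B0 x) (B1 y) = B1 (subc x y)"
| "sub (B1 x) (B0 y) = B1 (sub x y)"
| "sub (B1 x) (B1 y) = dbl (sub x y)"
| "subc x BE = dec x"
| "subc BE (B0 y) = BE"
| "subc BE (B1 y) = BE"
| "subc (B0 x) (B0 y) = B1 (subc x y)"
| "subc (B0 x) (B1 y) = dbl (subc x y)"
| "subc (B1 x) (B0 y) = dbl (sub x y)"
| "subc (B1 x) (B1 y) = B1 (subc x y)"

fun csub' :: "bool \<Rightarrow> bin \<Rightarrow> bin \<Rightarrow> bin" where
  "csub' True q x = x" | "csub' False q x = sub x q"
definition csub :: "bin \<Rightarrow> bin \<Rightarrow> bin" where "csub q x = csub' (lt x q False) q x"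

text \<open>Horner's scheme on the digits of the first factor, with a reduction after each doubling
  and each addition: for b < q all intermediate values stay below 2 q, so one conditional
  subtraction suffices.\<close>

fun modmul :: "bin \<Rightarrow> bin \<Rightarrow> bin \<Rightarrow> bin" where
  "modmul q BE b = BE"
| "modmul q (B0 a) b = csub q (dbl (modmul q a b))"
| "modmul q (B1 a) b = csub q (add (csub q (dbl (modmul q a b))) b)"

text \<open>A constant of its own, so that the argument is evaluated before it is
  duplicated.\<close>

definition modsq where "modsq q x = modmul q x x"

fun modpow :: "bin \<Rightarrow> bin \<Rightarrow> bin \<Rightarrow> bin" where
  "modpow q x BE = B1 BE"
| "modpow q x (B0 n) = modsq q (modpow q x n)"
| "modpow q x (B1 n) = modmul q x (modsq q (modpow q x n))"

fun eqv :: "bin \<Rightarrow> bin \<Rightarrow> bool" where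
  "eqv BE BE = True" | "eqv BE (B0 y) = eqv BE y" | "eqv BE (B1 y) = False"
| "eqv (B0 x) BE = eqv x BE" | "eqv (B1 x) BE = False"
| "eqv (B0 x) (B0 y) = eqv x y" | "eqv (B1 x) (B1 y) = eqv x y"
| "eqv (B0 x) (B1 y) = False" | "eqv (B1 x) (B0 y) = False"

fun mul :: "bin \<Rightarrow> bin \<Rightarrow> bin" where
  "mul BE b = BE" | "mul (B0 a) b = dbl (mul a b)" | "mul (B1 a) b = add b (dbl (mul a b))"

fun memb :: "bin \<Rightarrow> bin list \<Rightarrow> bool" and memb' where
  "memb x [] = False" | "memb x (y # ys) = memb' (eqv x y) x ys"
| "memb' True x ys = True" | "memb' False x ys = memb x ys"

fun ins' :: "bool \<Rightarrow> bin \<Rightarrow> bin list \<Rightarrow> bin list" where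
  "ins' True x ys = ys" | "ins' False x ys = x # ys"
definition ins where "ins x ys = ins' (memb x ys) x ys"

fun unary :: "bin \<Rightarrow> unit list" where
  "unary BE = []" | "unary (B0 x) = unary x @ unary x" | "unary (B1 x) = () # unary x @ unary x"

text \<open>The classes \<open>(1 + h) ^ t\<close> of sums of two \<open>d\<close>-th powers, \<open>h\<close> running through powers of \<open>\<gamma>\<close>.\<close>
fun class_list :: "unit list \<Rightarrow> bin \<Rightarrow> bin \<Rightarrow> bin \<Rightarrow> bin \<Rightarrow> bin list \<Rightarrow> bin list" where
  "class_list [] q t \<gamma> h cs = cs"
| "class_list (u # us) q t \<gamma> h cs = class_list us q t \<gamma> (modmul q \<gamma> h) (ins (modpow q (csub q (inc h)) t) cs)"

fun len :: "'a list \<Rightarrow> bin" where "len [] = BE" | "len (x # xs) = inc (len xs)"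

definition cube :: "bin \<Rightarrow> bin" where "cube x = mul x (mul x x)"

text \<open>The initial list accounts for the class \<open>1\<close> and blocks the entry \<open>0\<close>.\<close>
definition check_classes' :: "bin \<Rightarrow> bin \<Rightarrow> bin \<Rightarrow> bin \<Rightarrow> bool" where
  "check_classes' d t q m \<longleftrightarrow> lt m d True \<and> lt (mul q (cube (sub d m))) (cube (inc (mul m t))) False"
definition check_classes :: "bin \<Rightarrow> bin \<Rightarrow> bin \<Rightarrow> bin \<Rightarrow> bin \<Rightarrow> bool" where
  "check_classes d t q g n = check_classes' d t q (dec (len (class_list (unary n) q t (modpow q g d) (B1 BE)
    [B1 BE, BE])))"

fun bin_of_num :: "num \<Rightarrow> bin" where
  "bin_of_num num.One = B1 BE" | "bin_of_num (num.Bit0 n) = B0 (bin_of_num n)"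
    | "bin_of_num (num.Bit1 n) = B1 (bin_of_num n)"
definition bin_of_int :: "int \<Rightarrow> bin" where
  "bin_of_int i = (if i \<le> 0 then BE else bin_of_num (num_of_nat (nat i)))"
lemma bin_of_int_code [code]:
  "bin_of_int (Int.Pos n) = bin_of_num n" "bin_of_int 0 = BE" "bin_of_int (Int.Neg n) = BE"
  by (simp_all add: bin_of_int_def nat_of_num_numeral[symmetric] nat_of_num_inverse Int.Pos_def Int.Neg_def)

text \<open>A tree of depth \<open>e\<close> denotes a set of vectors in \<open>\<int>\<^sub>p ^ e\<close>: \<open>Branch xs\<close> consists of the vectors with
  first coordinate \<open>i\<close> and the rest in \<open>xs ! i\<close>. Children beyond index \<open>p - 1\<close> arise in sums and are
  folded back by \<open>wrap\<close>; the union \<open>Join\<close> never occurs for trees of equal depth and only makes the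
  functions total.\<close>
datatype ptree = Empty_set | Zero_set | Branch "ptree list" | Join ptree ptree

fun merge :: "ptree \<Rightarrow> ptree \<Rightarrow> ptree" and merges :: "ptree list \<Rightarrow> ptree list \<Rightarrow> ptree list" where
  "merge Empty_set y = y"
| "merge Zero_set Empty_set = Zero_set"
| "merge Zero_set Zero_set = Zero_set"
| "merge Zero_set (Branch ys) = Join Zero_set (Branch ys)"
| "merge Zero_set (Join a b) = Join Zero_set (Join a b)"
| "merge (Branch xs) Empty_set = Branch xs"
| "merge (Branch xs) Zero_set = Join (Branch xs) Zero_set"
| "merge (Branch xs) (Branch ys) = Branch (merges xs ys)"
| "merge (Branch xs) (Join a b) = Join (Branch xs) (Join a b)"
| "merge (Join a b) y = Join (Join a b) y"
| "merges [] ys = ys"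
| "merges (x # xs) [] = x # xs"
| "merges (x # xs) (y # ys) = merge x y # merges xs ys"

fun utake :: "unit list \<Rightarrow> ptree list \<Rightarrow> ptree list" where
  "utake [] xs = []" | "utake (u # us) [] = []" | "utake (u # us) (x # xs) = x # utake us xs"
fun udrop :: "unit list \<Rightarrow> ptree list \<Rightarrow> ptree list" where
  "udrop [] xs = xs" | "udrop (u # us) [] = []" | "udrop (u # us) (x # xs) = udrop us xs"
definition wrap :: "unit list \<Rightarrow> ptree list \<Rightarrow> ptree list" where "wrap U xs = merges (utake U xs) (udrop U xs)"

text \<open>Schoolbook multiplication of polynomials in the first coordinate, with union as addition
  and the sumset of the remaining coordinates as multiplication. Prepending \<open>Empty_set\<close>
  raises the first coordinate by one; \<open>wrap\<close> reduces it modulo p.\<close>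

fun sum_tree :: "unit list \<Rightarrow> ptree \<Rightarrow> ptree \<Rightarrow> ptree" and sum_forest :: "unit list \<Rightarrow> ptree list \<Rightarrow> ptree list \<Rightarrow> ptree
  list"
  and sum_shifted :: "unit list \<Rightarrow> ptree \<Rightarrow> ptree list \<Rightarrow> ptree list" where
  "sum_tree U Empty_set y = Empty_set"
| "sum_tree U Zero_set y = y"
| "sum_tree U (Branch ks) Empty_set = Empty_set"
| "sum_tree U (Branch ks) Zero_set = Branch ks"
| "sum_tree U (Branch ks) (Branch ts) = Branch (wrap U (sum_forest U ks ts))"
| "sum_tree U (Branch ks) (Join a b) = Join (sum_tree U (Branch ks) a) (sum_tree U (Branch ks) b)"
| "sum_tree U (Join a b) y = Join (sum_tree U a y) (sum_tree U b y)"
| "sum_forest U [] ts = []"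
| "sum_forest U (Empty_set # ks) ts = Empty_set # sum_forest U ks ts"
| "sum_forest U (Zero_set # ks) ts = merges ts (Empty_set # sum_forest U ks ts)"
| "sum_forest U (Branch xs # ks) ts = merges (sum_shifted U (Branch xs) ts) (Empty_set # sum_forest U ks ts)"
| "sum_forest U (Join a b # ks) ts = merges (sum_shifted U (Join a b) ts) (Empty_set # sum_forest U ks ts)"
| "sum_shifted U k [] = []"
| "sum_shifted U k (t # ts) = sum_tree U k t # sum_shifted U k ts"

fun point :: "bin list \<Rightarrow> ptree" and pad :: "unit list \<Rightarrow> ptree \<Rightarrow> ptree list" where
  "point [] = Zero_set"
| "point (c # cs) = Branch (pad (unary c) (point cs))"
| "pad [] s = [s]"
| "pad (u # us) s = Empty_set # pad us s"

text \<open>Multiplication by \<open>\<theta>\<close> on coefficient vectors over the powers of \<open>\<theta>\<close>, where \<open>\<theta> ^ e = \<Sum>i<e. r\<^sub>i \<theta> ^ i\<close>;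
  the least significant coefficient comes first.\<close>
fun axpy :: "bin \<Rightarrow> bin \<Rightarrow> bin \<Rightarrow> bin list \<Rightarrow> bin list \<Rightarrow> bin list" where
  "axpy p c z [] vs = []"
| "axpy p c z (r # rs) [] = []"
| "axpy p c z (r # rs) (v # vs) = csub p (add z (modmul p r c)) # axpy p c v rs vs"
definition step :: "bin \<Rightarrow> bin list \<Rightarrow> bin list \<Rightarrow> bin list" where
  "step p r v = axpy p (last v) BE r v"

fun eqvl :: "bin list \<Rightarrow> bin list \<Rightarrow> bool" and eqvl' where
  "eqvl [] [] = True" | "eqvl [] (y # ys) = False" | "eqvl (x # xs) [] = False"
| "eqvl (x # xs) (y # ys) = eqvl' (eqv x y) xs ys"
| "eqvl' True xs ys = eqvl xs ys" | "eqvl' False xs ys = False"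

fun orbit_list :: "unit list \<Rightarrow> bin \<Rightarrow> bin list \<Rightarrow> bin list \<Rightarrow> bin list list" where
  "orbit_list [] p r v = []" | "orbit_list (u # us) p r v = v # orbit_list us p r (step p r v)"

fun add_points :: "ptree \<Rightarrow> bin list list \<Rightarrow> ptree" where
  "add_points s [] = s" | "add_points s (v # vs) = add_points (merge (point v) s) vs"

fun is_full :: "unit list \<Rightarrow> bin list \<Rightarrow> ptree \<Rightarrow> bool" and all_full :: "unit list \<Rightarrow> unit list \<Rightarrow> bin list \<Rightarrow> ptree
  list \<Rightarrow> bool"
  and all_full' where
  "is_full U [] Zero_set = True"
| "is_full U [] Empty_set = False" | "is_full U [] (Branch a) = False" | "is_full U [] (Join a b) = False"
| "is_full U (r # rs) (Branch xs) = all_full U U rs xs"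
| "is_full U (r # rs) Empty_set = False" | "is_full U (r # rs) Zero_set = False"
    | "is_full U (r # rs) (Join a b) = False"
| "all_full U [] rs xs = True"
| "all_full U (v # V) rs [] = False"
| "all_full U (v # V) rs (x # xs) = all_full' (is_full U rs x) U V rs xs"
| "all_full' True U V rs xs = all_full U V rs xs"
| "all_full' False U V rs xs = False"

fun zeros :: "bin list \<Rightarrow> bin list" where "zeros [] = []" | "zeros (r # rs) = BE # zeros rs"
fun sum_iter :: "unit list \<Rightarrow> unit list \<Rightarrow> ptree \<Rightarrow> ptree" where
  "sum_iter [] U K = K" | "sum_iter (u # us) U K = sum_tree U K (sum_iter us U K)"

fun count_tree :: "ptree \<Rightarrow> bin" and count_forest :: "ptree list \<Rightarrow> bin" where
  "count_tree Empty_set = BE" | "count_tree Zero_set = B1 BE" | "count_tree (Branch xs) = count_forest xs"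
    | "count_tree (Join a b) = add (count_tree a) (count_tree b)"
| "count_forest [] = BE" | "count_forest (x # xs) = add (count_tree x) (count_forest xs)"

definition power_tree :: "bin \<Rightarrow> bin list \<Rightarrow> bin \<Rightarrow> ptree" where
  "power_tree p r t = add_points (point (zeros r)) (orbit_list (unary t) p r (B1 BE # tl (zeros r)))"

section \<open>Correctness of the binary arithmetic\<close>

lemma val_inc [simp]: "val (inc x) = val x + 1" by (induction x) auto
lemma val_add [simp]: "val (add x y) = val x + val y" and val_addc [simp]: "val (addc x y) = val x + val y + 1"
  by (induction x y and x y rule: add_addc.induct) auto
lemma lt_iff: "lt x y c \<longleftrightarrow> val x < val y \<or> (c \<and> val x = val y)"
  by (induction x y c rule: lt.induct) (auto; presburger)+
lemma val_dbl [simp]: "val (dbl x) = 2 * val x" by (cases x) auto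
lemma val_dec [simp]: "val (dec x) = val x - 1" if "val x > 0" using that by (induction x) auto
lemma val_sub: "val y \<le> val x \<Longrightarrow> val (sub x y) = val x - val y"
  and val_subc: "val y < val x \<Longrightarrow> val (subc x y) = val x - val y - 1"
  by (induction x y and x y rule: sub_subc.induct) auto
lemma val_csub: "val x < 2 * val q \<Longrightarrow> val (csub q x) = val x mod val q"
  by (cases "val x < val q") (auto simp: csub_def lt_iff val_sub not_less le_mod_geq)
lemma val_modmul: "val b < val q \<Longrightarrow> val (modmul q a b) = val a * val b mod val q"
proof (induction a)
  case (B0 a)
  then have "val (modmul q a b) < val q" by simp
  then have "val (modmul q (B0 a) b) = (2 * (val a * val b mod val q)) mod val q" using B0 by (simp add: val_csub)
  then show ?case by (simp add: mod_mult_right_eq mult.assoc)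
next
  case (B1 a)
  then have l: "val (modmul q a b) < val q" by simp
  then have "val (csub q (dbl (modmul q a b))) = (2 * (val a * val b mod val q)) mod val q" using B1
    by (simp add: val_csub)
  then have "val (csub q (dbl (modmul q a b))) = 2 * (val a * val b) mod val q" by (simp add: mod_mult_right_eq)
  moreover have "2 * (val a * val b) mod val q < val q" using B1.prems by simp
  ultimately have "val (add (csub q (dbl (modmul q a b))) b) < 2 * val q"
    using B1.prems unfolding val_add by linarith
  then have "val (modmul q (B1 a) b) = (val (csub q (dbl (modmul q a b))) + val b) mod val q"
    by (simp add: val_csub)
  then have "val (modmul q (B1 a) b) = (2 * (val a * val b) mod val q + val b) mod val q"
    using \<open>val (csub q (dbl (modmul q a b))) = 2 * (val a * val b) mod val q\<close> by simp
  also have "\<dots> = (2 * (val a * val b) + val b) mod val q" by (rule mod_add_left_eq)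
  finally show ?case by (simp add: algebra_simps)
qed auto
lemma val_modpow: "val x < val q \<Longrightarrow> val q > 1 \<Longrightarrow> val (modpow q x n) = val x ^ val n mod val q"
proof (induction n)
  case (B0 n)
  then show ?case by (simp add: modsq_def val_modmul power_mult_distrib power_add mult_2 mod_mult_eq)
next
  case (B1 n)
  then have "val (modsq q (modpow q x n)) = val x ^ (2 * val n) mod val q"
    by (simp add: modsq_def val_modmul power_add mult_2 mod_mult_eq)
  then show ?case using B1 by (simp add: val_modmul mod_mult_right_eq)
qed auto
lemma eqv_iff: "eqv x y \<longleftrightarrow> val x = val y"
  by (induction x y rule: eqv.induct) (auto; presburger)+
lemma val_mul [simp]: "val (mul x y) = val x * val y"
  by (induction x) (auto simp: algebra_simps)
lemma val_cube [simp]: "val (cube x) = val x ^ 3" by (simp add: cube_def power3_eq_cube)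
lemma memb_iff: "memb x ys \<longleftrightarrow> val x \<in> val ` set ys"
  and memb'_iff: "memb' b x ys \<longleftrightarrow> b \<or> val x \<in> val ` set ys"
  by (induction x ys and b x ys rule: memb_memb'.induct) (auto simp: eqv_iff)
lemma ins_eq: "ins x ys = (if val x \<in> val ` set ys then ys else x # ys)"
  by (auto simp: ins_def memb_iff)
lemma length_unary [simp]: "length (unary x) = val x" by (induction x) auto
lemma val_len [simp]: "val (len xs) = length xs" by (induction xs) auto

text \<open>A loop invariant: I for the running power h, Q for the collected classes. Both become
  statements about the field later, of which the induction is free.\<close>

lemma class_list_inv:
  assumes "I h" "\<And>h. I h \<Longrightarrow> I (modmul q \<gamma> h)" "\<And>h. I h \<Longrightarrow> Q (modpow q (csub q (inc h)) t)"
    "\<And>c. c \<in> set cs \<Longrightarrow> Q c" "distinct (map val cs)"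
  shows "\<forall>c\<in>set (class_list us q t \<gamma> h cs). Q c" "distinct (map val (class_list us q t \<gamma> h cs))"
    "set cs \<subseteq> set (class_list us q t \<gamma> h cs)"
proof -
  have "(\<forall>c\<in>set (class_list us q t \<gamma> h cs). Q c) \<and> distinct (map val (class_list us q t \<gamma> h cs)) \<and>
    set cs \<subseteq> set (class_list us q t \<gamma> h cs)"
    using assms
  proof (induction us arbitrary: h cs)
    case (Cons u us)
    show ?case
      unfolding class_list.simps using Cons.prems
      by (intro conjI; (insert Cons.IH[of "modmul q \<gamma> h" "ins (modpow q (csub q (inc h)) t) cs"]; fastforce simp:
        ins_eq split: if_splits)?)
  qed auto
  then show "\<forall>c\<in>set (class_list us q t \<gamma> h cs). Q c" "distinct (map val (class_list us q t \<gamma> h cs))"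
    "set cs \<subseteq> set (class_list us q t \<gamma> h cs)" by auto
qed

section \<open>The Frobenius map\<close>

context cring begin

lemma binomial:
  assumes "x \<in> carrier R" "y \<in> carrier R"
  shows "(x \<oplus> y) [^] n = (\<Oplus>i\<in>{..n}. [(n choose i)] \<cdot> (x [^] i \<otimes> y [^] (n - i)))"
proof (induction n)
  case (Suc n)
  let ?b = "\<lambda>n i. [(n choose i)] \<cdot> (x [^] i \<otimes> y [^] (n - i))"
  let ?s = "\<lambda>i. [(n choose i)] \<cdot> (x [^] i \<otimes> y [^] (Suc n - i))"
  have X: "(\<Oplus>i\<in>{..n}. ?b n i) \<otimes> x = (\<Oplus>i\<in>{..n}. [(n choose i)] \<cdot> (x [^] Suc i \<otimes> y [^] (n - i)))"
    using assms by (subst finsum_ldistr) (auto intro!: finsum_cong' simp: add_pow_ldistr add_pow_rdistr m_ac)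
  have Y: "(\<Oplus>i\<in>{..n}. ?b n i) \<otimes> y = (\<Oplus>i\<in>{..n}. ?s i)"
    using assms by (subst finsum_ldistr) (auto intro!: finsum_cong' simp: add_pow_ldistr add_pow_rdistr m_ac
      Suc_diff_le)
  have "(\<Oplus>i\<in>{..Suc n}. ?s i) = ?s (Suc n) \<oplus> (\<Oplus>i\<in>{..n}. ?s i)"
    using assms by (subst finsum_Suc) auto
  then have Y': "(\<Oplus>i\<in>{..n}. ?s i) = (\<Oplus>i\<in>{..Suc n}. ?s i)" using assms by (simp add: binomial_eq_0)
  have "(\<Oplus>i\<in>{..Suc n}. ?s i) = (\<Oplus>i\<in>{..n}. ?s (Suc i)) \<oplus> ?s 0"
    using assms by (subst finsum_Suc2) auto
  then have Y'': "(\<Oplus>i\<in>{..n}. ?b n i) \<otimes> y = (\<Oplus>i\<in>{..n}. ?s (Suc i)) \<oplus> ?s 0" using Y Y' by simp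
  have "(\<Oplus>i\<in>{..Suc n}. ?b (Suc n) i) = (\<Oplus>i\<in>{..n}. ?b (Suc n) (Suc i)) \<oplus> ?b (Suc n) 0"
    using assms by (subst finsum_Suc2) auto
  also have "(\<Oplus>i\<in>{..n}. ?b (Suc n) (Suc i)) =
      (\<Oplus>i\<in>{..n}. [(n choose i)] \<cdot> (x [^] Suc i \<otimes> y [^] (n - i)) \<oplus> ?s (Suc i))"
    using assms by (intro finsum_cong') (auto simp: add.nat_pow_mult)
  also have "\<dots> = (\<Oplus>i\<in>{..n}. [(n choose i)] \<cdot> (x [^] Suc i \<otimes> y [^] (n - i))) \<oplus> (\<Oplus>i\<in>{..n}. ?s (Suc i))"
    using assms by (intro finsum_addf) auto
  finally have "(\<Oplus>i\<in>{..Suc n}. ?b (Suc n) i) =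
      (\<Oplus>i\<in>{..n}. ?b n i) \<otimes> x \<oplus> ((\<Oplus>i\<in>{..n}. ?s (Suc i)) \<oplus> ?s 0)"
    using X assms by (simp add: a_assoc)
  also have "\<dots> = (\<Oplus>i\<in>{..n}. ?b n i) \<otimes> (x \<oplus> y)" using Y'' assms by (subst r_distr) auto
  finally show ?case using Suc assms by simp
qed (use assms in simp)

text \<open>The inner binomial coefficients are divisible by p. The setting is a commutative ring
  because the identity is applied to polynomials as well as to field elements.\<close>

lemma frobenius:
  fixes p :: nat
  assumes p: "Factorial_Ring.prime p" and char: "[p] \<cdot> \<one> = \<zero>" and "x \<in> carrier R" "y \<in> carrier R"
  shows "(x \<oplus> y) [^] p = x [^] p \<oplus> y [^] p"
proof -
  have z: "[p] \<cdot> w = \<zero>" if "w \<in> carrier R" for w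
  proof -
    have "[p] \<cdot> w = ([p] \<cdot> \<one>) \<otimes> w" using that add_pow_ldistr[of \<one> w p] by simp
    then show ?thesis using char that by simp
  qed
  let ?b = "\<lambda>i. [(p choose i)] \<cdot> (x [^] i \<otimes> y [^] (p - i))"
  have b0: "?b i = \<zero>" if "i \<noteq> 0" "i < p" for i
  proof -
    have "p dvd (p choose i)" using that p by (intro dvd_choose_prime) auto
    then obtain c where "p choose i = p * c" by blast
    then have "?b i = [c] \<cdot> ([p] \<cdot> (x [^] i \<otimes> y [^] (p - i)))"
      using assms by (simp add: add.nat_pow_pow)
    then show ?thesis using z assms by simp
  qed
  obtain r where r: "p = Suc (Suc r)" using prime_ge_2_nat[OF p] by (metis Suc_le_D numeral_2_eq_2 Suc_le_mono)
  have "(x \<oplus> y) [^] p = (\<Oplus>i\<in>{..Suc (Suc r)}. ?b i)" using binomial[of x y p] assms r by simp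
  also have "\<dots> = ?b (Suc (Suc r)) \<oplus> ((\<Oplus>i\<in>{..r}. ?b (Suc i)) \<oplus> ?b 0)"
    using assms by (subst finsum_Suc, force, subst finsum_Suc2, auto)
  also have "(\<Oplus>i\<in>{..r}. ?b (Suc i)) = (\<Oplus>i\<in>{..r}. \<zero>)"
    using b0[of "Suc _"] r by (intro finsum_cong') (auto simp del: binomial_Suc_Suc)
  also have "\<dots> = \<zero>" by simp
  finally show ?thesis using assms r by simp
qed

lemma frobenius_power:
  fixes p :: nat
  assumes "Factorial_Ring.prime p" "[p] \<cdot> \<one> = \<zero>" "x \<in> carrier R" "y \<in> carrier R"
  shows "(x \<oplus> y) [^] (p ^ j) = x [^] (p ^ j) \<oplus> y [^] (p ^ j)"
proof (induction j)
  case (Suc j)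
  have *: "z [^] (p ^ Suc j) = (z [^] (p ^ j)) [^] p" if "z \<in> carrier R" for z
    using nat_pow_pow[OF that, of "p ^ j" p] by (simp only: power_Suc2)
  show ?case using assms Suc by (simp add: frobenius * del: power_Suc)
qed (use assms in simp)

end

section \<open>The prime field, and powers confined to a subfield\<close>

context finite_field begin

primrec emb :: "nat \<Rightarrow> 'a" where "emb 0 = \<zero>" | "emb (Suc n) = emb n \<oplus> \<one>"

lemma emb_closed [simp]: "emb n \<in> carrier R" by (induction n) auto
lemma emb_eq: "emb n = [n] \<cdot> \<one>" by (induction n) auto
lemma emb_1 [simp]: "emb (Suc 0) = \<one>" by simp
lemma emb_add: "emb (m + n) = emb m \<oplus> emb n" by (induction n) (auto simp: a_assoc)
lemma emb_mult: "emb (m * n) = emb m \<otimes> emb n" by (induction n) (auto simp: emb_add r_distr a_comm)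
lemma emb_pow: "emb (m ^ n) = emb m [^] n" by (induction n) (auto simp: emb_mult m_comm)

text \<open>Lagrange in the additive group makes the image of q = p^e vanish; it is the e-th power
  of the image of p, and a field has no nonzero nilpotent elements.\<close>

lemma char_primepow:
  assumes "Q = p ^ e"
  shows "emb p = \<zero>"
proof -
  have "\<one> [^]\<^bsub>add_monoid R\<^esub> order (add_monoid R) = \<one>\<^bsub>add_monoid R\<^esub>"
    by (rule group.pow_order_eq_1[OF a_group]) simp
  then have "emb Q = \<zero>" by (simp add: order_def emb_eq add_pow_def)
  then have "emb p [^] e = \<zero>" using assms by (simp add: emb_pow)
  then show ?thesis using nat_pow_nonzero'[of "emb p" e] by auto
qed

end

locale char_field = finite_field +
  fixes p :: nat and e :: nat
  assumes prime_p: "Factorial_Ring.prime p" and card_eq: "card (carrier R) = p ^ e"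
begin

lemma emb_p: "emb p = \<zero>" by (rule char_primepow[OF card_eq])
lemma e_pos: "e > 0" using card_eq Q_gt_1 by (cases e) auto

lemma emb_mod: "emb (n mod p) = emb n"
proof -
  have "emb (p * (n div p) + n mod p) = emb (n mod p)"
    by (simp only: emb_add emb_mult emb_p) simp
  then show ?thesis by simp
qed

text \<open>If p does not divide n, Bezout makes n invertible modulo p, so its image is a
  unit.\<close>

lemma emb_eq_0_iff: "emb n = \<zero> \<longleftrightarrow> p dvd n"
proof
  assume n: "emb n = \<zero>"
  show "p dvd n"
  proof (rule ccontr)
    assume "\<not> p dvd n"
    then have "coprime n p" using prime_p prime_imp_coprime coprime_commute by blast
    moreover have "n \<noteq> 0" using \<open>\<not> p dvd n\<close> dvd_0_right by metis
    ultimately obtain u v where "n * u = p * v + 1" using bezout_nat[of n p] by (auto simp: coprime_iff_gcd_eq_1)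
    then have "emb (n * u) = emb (p * v + 1)" by simp
    then show False using n by (simp add: emb_mult emb_add emb_p)
  qed
qed (auto simp: emb_mult emb_p)

lemma emb_inj:
  assumes "i < p" "j < p" "emb i = emb j" shows "i = j"
proof -
  have *: "j - i = 0" if "i \<le> j" "j < p" "emb i = emb j" for i j
  proof -
    have "emb (i + (j - i)) = emb i" using that by simp
    then have "emb i = emb i \<oplus> emb (j - i)" by (simp only: emb_add)
    then have "emb (j - i) = \<zero>" by (metis add.l_cancel_one' emb_closed)
    then have "p dvd j - i" by (simp add: emb_eq_0_iff)
    then show ?thesis using that by (metis dvd_imp_le less_imp_diff_less not_le not_gr_zero)
  qed
  show ?thesis
  proof (cases "i \<le> j")
    case True
    then show ?thesis using *[OF True assms(2,3)] by linarith
  next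
    case False
    then have "j \<le> i" by linarith
    then show ?thesis using *[OF \<open>j \<le> i\<close> assms(1) assms(3)[symmetric]] by linarith
  qed
qed

text \<open>The solutions of x^(p^f) = x contain the d-th powers, as t divides p^f - 1, and are
  closed under addition by Frobenius; hence they contain all sums. If they were all elements, X^(p^f
  - 1) - 1 would have q - 1 > p^f - 1 roots.\<close>

lemma not_covers_subfield:
  assumes Q: "Q = d * t + 1" and f: "0 < f" "f < e" and t: "t dvd p ^ f - 1"
  shows "\<not> covers d m"
proof
  assume c: "covers d m"
  let ?S = "{x \<in> carrier R. x [^] (p ^ f) = x}"
  have pf: "p ^ f > 1" using prime_gt_1_nat[OF prime_p] f(1) by (rule one_less_power)
  have "x [^] (p ^ f) = x" if "x \<in> pows d" for x
  proof (cases "x = \<zero>")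
    case True
    have "p ^ f > 0" using pf by linarith
    then show ?thesis using True nat_pow_zero_pos by blast
  next
    case False
    have "x \<in> units_ord t" using that False units_ord_eq(1)[of d t] Q by auto
    then have x: "x \<in> carrier R" "x [^] t = \<one>" by (auto simp: units_ord_def)
    obtain j where j: "p ^ f = t * j + 1" using t pf
      by (metis Suc_diff_1 dvdE Suc_eq_plus1 less_trans zero_less_one)
    have "x [^] (t * j) = \<one>" using x by (simp flip: nat_pow_pow)
    then show ?thesis unfolding j using x by simp
  qed
  then have "pows d \<subseteq> ?S" using pows_closed by auto
  have "nsum m (pows d) \<subseteq> ?S"
  proof (induction m)
    case 0
    have "p ^ f > 0" using pf by linarith
    then have "\<zero> [^] (p ^ f) = \<zero>" by (rule nat_pow_zero_pos)
    then show ?case by simp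
  next
    case (Suc m)
    have "x \<oplus> y \<in> ?S" if "x \<in> ?S" "y \<in> ?S" for x y
      using that frobenius_power[OF prime_p, of x y f] emb_p by (simp add: emb_eq)
    then show ?case using Suc \<open>pows d \<subseteq> ?S\<close> unfolding nsum.simps by blast
  qed
  then have S: "carrier R \<subseteq> ?S" using c unfolding covers_def by blast
  have "nonzero \<subseteq> {x \<in> carrier R. x [^] (p ^ f - 1) = \<one>}"
  proof
    fix x assume x: "x \<in> nonzero"
    have "Suc (p ^ f - 1) = p ^ f" using pf by linarith
    then have "x [^] (p ^ f - 1) \<otimes> x = x [^] (p ^ f)" using nat_pow_Suc[of x "p ^ f - 1"] by metis
    also have "\<dots> = \<one> \<otimes> x" using S x by auto
    finally have "x [^] (p ^ f - 1) = \<one>" using x by (subst (asm) m_rcancel) auto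
    then show "x \<in> {x \<in> carrier R. x [^] (p ^ f - 1) = \<one>}" using x by blast
  qed
  then have "Q - 1 \<le> p ^ f - 1"
    using num_roots_le_deg[OF finite_carrier, of "p ^ f - 1"] pf finite_carrier
      card_mono[of "{x \<in> carrier R. x [^] (p ^ f - 1) = \<one>}" nonzero] by simp
  moreover have "p ^ f < p ^ e" using f prime_gt_1_nat[OF prime_p] by simp
  ultimately show False using pf card_eq by linarith
qed

end

section \<open>Sets denoted by trees\<close>

context finite_field begin

definition sumset :: "'a set \<Rightarrow> 'a set \<Rightarrow> 'a set" where "sumset A B = {x \<oplus> y | x y. x \<in> A \<and> y \<in> B}"

lemma sumset_comm:
  assumes "A \<subseteq> carrier R" "B \<subseteq> carrier R"
  shows "sumset A B = sumset B A"
proof -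
  have "sumset A B \<subseteq> sumset B A" if "A \<subseteq> carrier R" "B \<subseteq> carrier R" for A B
  proof
    fix z assume "z \<in> sumset A B"
    then obtain x y where z: "z = x \<oplus> y" "x \<in> A" "y \<in> B" unfolding sumset_def by blast
    then have "z = y \<oplus> x" using that by (blast intro: a_comm)
    then show "z \<in> sumset B A" using z unfolding sumset_def by blast
  qed
  then show ?thesis using assms by blast
qed

lemma sumset_simps: "sumset {} B = {}" "sumset A {} = {}" "sumset (A \<union> A') B = sumset A B \<union> sumset A' B"
  "sumset A (B \<union> B') = sumset A B \<union> sumset A B'"
  by (auto simp: sumset_def)
lemma sumset_zero: "B \<subseteq> carrier R \<Longrightarrow> sumset {\<zero>} B = B" "B \<subseteq> carrier R \<Longrightarrow> sumset B {\<zero>} = B"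
  by (auto simp: sumset_def intro!: exI[of _ "_ :: 'a"])
lemma sumset_translate:
  assumes "a \<in> carrier R" "A \<subseteq> carrier R" "B \<subseteq> carrier R"
  shows "sumset ((\<lambda>s. a \<oplus> s) ` A) B = (\<lambda>s. a \<oplus> s) ` sumset A B" "sumset A ((\<lambda>s. a \<oplus> s) ` B) = (\<lambda>s. a \<oplus> s) ` sumset
    A B"
proof -
  have "a \<oplus> x \<oplus> y = a \<oplus> (x \<oplus> y)" "x \<oplus> (a \<oplus> y) = a \<oplus> (x \<oplus> y)" if "x \<in> A" "y \<in> B" for x y
    using assms that a_assoc a_lcomm by (simp_all add: subset_iff)
  then show "sumset ((\<lambda>s. a \<oplus> s) ` A) B = (\<lambda>s. a \<oplus> s) ` sumset A B" "sumset A ((\<lambda>s. a \<oplus> s) ` B) =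
    (\<lambda>s. a \<oplus> s) ` sumset A B"
    unfolding sumset_def by (auto 0 4 simp: image_iff; metis)+
qed
lemma sumset_scale:
  assumes "c \<in> carrier R" "A \<subseteq> carrier R" "B \<subseteq> carrier R"
  shows "sumset ((\<lambda>s. c \<otimes> s) ` A) ((\<lambda>s. c \<otimes> s) ` B) = (\<lambda>s. c \<otimes> s) ` sumset A B"
proof -
  have "c \<otimes> x \<oplus> c \<otimes> y = c \<otimes> (x \<oplus> y)" if "x \<in> A" "y \<in> B" for x y
    using assms that by (simp add: r_distr subset_iff)
  then show ?thesis unfolding sumset_def by (auto 0 4 simp: image_iff; metis)
qed

text \<open>Evaluation at \<theta> by Horner's scheme: an element s of the child with index i yields
  i + \<theta> s. Since 1 is added once for each place, indices beyond p - 1 make sense too.\<close>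

fun tree_set :: "'a \<Rightarrow> ptree \<Rightarrow> 'a set" and forest_set :: "'a \<Rightarrow> ptree list \<Rightarrow> 'a set" where
  "tree_set \<theta> Empty_set = {}"
| "tree_set \<theta> Zero_set = {\<zero>}"
| "tree_set \<theta> (Branch xs) = forest_set \<theta> xs"
| "tree_set \<theta> (Join a b) = tree_set \<theta> a \<union> tree_set \<theta> b"
| "forest_set \<theta> [] = {}"
| "forest_set \<theta> (x # xs) = (\<lambda>s. \<theta> \<otimes> s) ` tree_set \<theta> x \<union> (\<lambda>s. \<one> \<oplus> s) ` forest_set \<theta> xs"

lemma tree_set_closed: "\<theta> \<in> carrier R \<Longrightarrow> tree_set \<theta> x \<subseteq> carrier R"
  and forest_set_closed: "\<theta> \<in> carrier R \<Longrightarrow> forest_set \<theta> xs \<subseteq> carrier R"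
  by (induction \<theta> x and \<theta> xs rule: tree_set_forest_set.induct) auto

lemma tree_set_merge: "tree_set \<theta> (merge x y) = tree_set \<theta> x \<union> tree_set \<theta> y"
  and forest_set_merges: "forest_set \<theta> (merges xs ys) = forest_set \<theta> xs \<union> forest_set \<theta> ys"
  by (induction x y and xs ys rule: merge_merges.induct) (auto simp: image_Un)

lemma forest_set_split:
  assumes "\<theta> \<in> carrier R"
  shows "forest_set \<theta> xs = forest_set \<theta> (utake U xs) \<union> (\<lambda>s. emb (length U) \<oplus> s) ` forest_set \<theta> (udrop U xs)"
proof (induction U xs rule: utake.induct)
  case (1 xs)
  have "(\<lambda>s. \<zero> \<oplus> s) ` forest_set \<theta> xs = forest_set \<theta> xs" using forest_set_closed[OF assms, of xs]
    by (force simp: image_iff)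
  then show ?case by simp
next
  case (3 u us x xs)
  have "(\<lambda>s. \<one> \<oplus> (emb (length us) \<oplus> s)) ` forest_set \<theta> (udrop us xs) = (\<lambda>s. emb (length us) \<oplus> \<one> \<oplus> s) ` forest_set
    \<theta> (udrop us xs)"
    using forest_set_closed[OF assms, of "udrop us xs"] by (intro image_cong) (auto simp: a_ac subset_iff)
  then show ?case using 3 by (simp add: image_Un image_image Un_assoc)
qed auto

text \<open>Moving a child by \<open>length U\<close> places changes its elements by a multiple of 1
  that is zero in the field.\<close>

lemma forest_set_wrap:
  assumes "\<theta> \<in> carrier R" "emb (length U) = \<zero>"
  shows "forest_set \<theta> (wrap U xs) = forest_set \<theta> xs"
proof -
  have "(\<lambda>s. \<zero> \<oplus> s) ` forest_set \<theta> (udrop U xs) = forest_set \<theta> (udrop U xs)"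
    using forest_set_closed[OF assms(1), of "udrop U xs"] by (force simp: image_iff)
  then show ?thesis using forest_set_split[OF assms(1), of xs U] assms(2)
    by (simp add: wrap_def forest_set_merges)
qed

lemma tree_set_sum_tree: "\<theta> \<in> carrier R \<Longrightarrow> emb (length U) = \<zero> \<Longrightarrow> tree_set \<theta> (sum_tree U x y) = sumset (tree_set \<theta> x)
  (tree_set \<theta> y)"
  and forest_set_sum_forest: "\<theta> \<in> carrier R \<Longrightarrow> emb (length U) = \<zero> \<Longrightarrow> forest_set \<theta> (sum_forest U ks ts) =
    sumset (forest_set \<theta> ks) (forest_set \<theta> ts)"
  and forest_set_sum_shifted: "\<theta> \<in> carrier R \<Longrightarrow> emb (length U) = \<zero> \<Longrightarrow> forest_set \<theta> (sum_shifted U k ts) =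
    sumset ((\<lambda>s. \<theta> \<otimes> s) ` tree_set \<theta> k) (forest_set \<theta> ts)"
proof (induction U x y and U ks ts and U k ts rule: sum_tree_sum_forest_sum_shifted.induct)
  case (10 U ks ts)
  have "sumset ({\<zero>} \<union> (\<oplus>) \<one> ` forest_set \<theta> ks) (forest_set \<theta> ts) = forest_set \<theta> ts \<union> (\<oplus>) \<one> ` sumset (forest_set \<theta>
    ks) (forest_set \<theta> ts)"
    using 10 forest_set_closed[of \<theta>] by (simp only: sumset_simps sumset_translate sumset_zero one_closed)
  then show ?case using 10 by (simp add: forest_set_merges)
next
  case (11 U xs ks ts)
  have "(\<lambda>s. \<theta> \<otimes> s) ` forest_set \<theta> xs \<subseteq> carrier R" using 11 forest_set_closed[of \<theta> xs] by auto
  then show ?case using 11 forest_set_closed[of \<theta>] by (simp add: forest_set_merges sumset_simps sumset_translate)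
next
  case (12 U a b ks ts)
  have "(\<lambda>s. \<theta> \<otimes> s) ` (tree_set \<theta> a \<union> tree_set \<theta> b) \<subseteq> carrier R"
    using 12 tree_set_closed[of \<theta> a] tree_set_closed[of \<theta> b] by auto
  then show ?case using 12 forest_set_closed[of \<theta>] by (simp add: forest_set_merges sumset_simps sumset_translate)
next
  case (14 U k t ts)
  have "(\<lambda>s. \<theta> \<otimes> s) ` tree_set \<theta> k \<subseteq> carrier R" using 14 tree_set_closed[of \<theta> k] by auto
  then show ?case using 14 forest_set_closed[of \<theta>] tree_set_closed[of \<theta>]
    by (simp add: sumset_simps sumset_translate sumset_scale)
qed (use tree_set_closed forest_set_closed in \<open>auto simp: sumset_simps sumset_zero forest_set_wrap
  sumset_translate\<close>)

fun horner :: "'a \<Rightarrow> nat list \<Rightarrow> 'a" where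
  "horner \<theta> [] = \<zero>" | "horner \<theta> (c # cs) = emb c \<oplus> \<theta> \<otimes> horner \<theta> cs"

lemma horner_closed [simp]: "\<theta> \<in> carrier R \<Longrightarrow> horner \<theta> v \<in> carrier R"
  by (induction v) auto

lemma forest_set_pad: "\<theta> \<in> carrier R \<Longrightarrow> forest_set \<theta> (pad us s) = (\<lambda>x. emb (length us) \<oplus> \<theta> \<otimes> x) ` tree_set \<theta> s"
proof (induction us)
  case Nil
  then show ?case using tree_set_closed[of \<theta> s] by (auto simp: image_iff subset_iff)
next
  case (Cons u us)
  then show ?case using tree_set_closed[of \<theta> s]
    by (auto simp: image_image a_ac subset_iff intro!: image_cong)
qed

lemma tree_set_point: "\<theta> \<in> carrier R \<Longrightarrow> tree_set \<theta> (point v) = {horner \<theta> (map val v)}"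
  by (induction v) (auto simp: forest_set_pad)

lemma tree_set_add_points: "\<theta> \<in> carrier R \<Longrightarrow> tree_set \<theta> (add_points s vs) = (\<lambda>v. horner \<theta> (map val v)) ` set vs \<union>
  tree_set \<theta> s"
  by (induction s vs rule: add_points.induct) (auto simp: tree_set_merge tree_set_point)

text \<open>The coefficients are arbitrary natural numbers, yet the set is the span of 1, ...,
  \<theta>^(n-1) over the prime field.\<close>

definition pspan :: "'a \<Rightarrow> nat \<Rightarrow> 'a set" where "pspan \<theta> n = {horner \<theta> v | v. length v = n}"

lemma pspan_0: "pspan \<theta> 0 = {\<zero>}" by (auto simp: pspan_def)
lemma pspan_Suc: "pspan \<theta> (Suc n) = {emb c \<oplus> \<theta> \<otimes> s | c s. s \<in> pspan \<theta> n}"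
proof (intro equalityI subsetI)
  fix x assume "x \<in> pspan \<theta> (Suc n)"
  then obtain c v where "x = horner \<theta> (c # v)" "length v = n" by (auto simp: pspan_def length_Suc_conv)
  then show "x \<in> {emb c \<oplus> \<theta> \<otimes> s | c s. s \<in> pspan \<theta> n}" by (auto simp: pspan_def)
next
  fix x assume "x \<in> {emb c \<oplus> \<theta> \<otimes> s | c s. s \<in> pspan \<theta> n}"
  then obtain c v where "x = horner \<theta> (c # v)" "length v = n" by (auto simp: pspan_def)
  then show "x \<in> pspan \<theta> (Suc n)" unfolding pspan_def by (intro CollectI exI[of _ "c # v"]) auto
qed

lemma pspan_closed: "\<theta> \<in> carrier R \<Longrightarrow> pspan \<theta> n \<subseteq> carrier R" by (auto simp: pspan_def)

text \<open>Different leaves may denote the same element, hence an inequality. This is the direction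
  that shows a sumset to be smaller than the field.\<close>

lemma card_tree_set: "finite (tree_set \<theta> x) \<and> card (tree_set \<theta> x) \<le> val (count_tree x)"
  and card_forest_set: "finite (forest_set \<theta> xs) \<and> card (forest_set \<theta> xs) \<le> val (count_forest xs)"
proof (induction x and xs rule: count_tree_count_forest.induct)
  case (4 a b)
  then show ?case using card_Un_le[of "tree_set \<theta> a" "tree_set \<theta> b"] by auto
next
  case (6 x xs)
  have "card ((\<lambda>s. \<theta> \<otimes> s) ` tree_set \<theta> x) \<le> card (tree_set \<theta> x)" "card ((\<lambda>s. \<one> \<oplus> s) ` forest_set \<theta> xs) \<le>
    card (forest_set \<theta> xs)"
    using 6 by (auto intro: card_image_le)
  then show ?case using 6 card_Un_le[of "(\<lambda>s. \<theta> \<otimes> s) ` tree_set \<theta> x" "(\<lambda>s. \<one> \<oplus> s) ` forest_set \<theta> xs"] by auto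
qed auto

lemma tree_set_sum_iter:
  assumes "\<theta> \<in> carrier R" "emb (length U) = \<zero>"
  shows "tree_set \<theta> (sum_iter us U K) = nsum (Suc (length us)) (tree_set \<theta> K)"
proof (induction us)
  case Nil
  then show ?case using sumset_zero(1)[OF tree_set_closed[OF assms(1)], of K] by (simp add: sumset_def)
next
  case (Cons u us)
  have "sumset (tree_set \<theta> K) (nsum (Suc (length us)) (tree_set \<theta> K)) = sumset (nsum (Suc (length us))
    (tree_set \<theta> K)) (tree_set \<theta> K)"
    by (intro sumset_comm nsum_closed tree_set_closed assms(1))
  moreover have "tree_set \<theta> (sum_iter (u # us) U K) = sumset (tree_set \<theta> K) (nsum (Suc (length us))
    (tree_set \<theta> K))"
    using Cons assms by (simp only: sum_iter.simps tree_set_sum_tree)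
  ultimately show ?case by (simp add: sumset_def)
qed

end

context char_field begin

lemma all_full_sound:
  assumes \<theta>: "\<theta> \<in> carrier R" and x: "\<And>x. is_full U rs x \<Longrightarrow> pspan \<theta> (length rs) \<subseteq> tree_set \<theta> x"
  shows "all_full U V rs xs \<Longrightarrow> i < length V \<Longrightarrow> s \<in> pspan \<theta> (length rs) \<Longrightarrow> emb i \<oplus> \<theta> \<otimes> s \<in> forest_set \<theta> xs"
proof (induction V arbitrary: xs i)
  case (Cons v V)
  obtain y ys where xs: "xs = y # ys" using Cons.prems(1) by (cases xs) auto
  have f: "is_full U rs y" "all_full U V rs ys"
    using Cons.prems(1) unfolding xs by (cases "is_full U rs y", simp, simp)+
  have sc: "s \<in> carrier R" using Cons.prems(3) pspan_closed[OF \<theta>] by blast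
  show ?case
  proof (cases i)
    case 0
    then have "emb i \<oplus> \<theta> \<otimes> s = \<theta> \<otimes> s" using sc \<theta> by simp
    moreover have "s \<in> tree_set \<theta> y" using x[OF f(1)] Cons.prems(3) by blast
    ultimately show ?thesis unfolding xs forest_set.simps by blast
  next
    case (Suc j)
    then have "j < length V" using Cons.prems(2) by simp
    then have "emb j \<oplus> \<theta> \<otimes> s \<in> forest_set \<theta> ys" by (rule Cons.IH[OF f(2) _ Cons.prems(3)])
    moreover have "emb i = \<one> \<oplus> emb j" unfolding Suc emb.simps by (rule a_comm) simp_all
    then have "emb i \<oplus> \<theta> \<otimes> s = \<one> \<oplus> (emb j \<oplus> \<theta> \<otimes> s)" using sc \<theta> by (simp add: a_assoc)
    ultimately show ?thesis unfolding xs forest_set.simps by blast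
  qed
qed simp

lemma is_full_sound:
  assumes \<theta>: "\<theta> \<in> carrier R" and U: "length U = p"
  shows "is_full U r x \<Longrightarrow> pspan \<theta> (length r) \<subseteq> tree_set \<theta> x"
proof (induction r arbitrary: x)
  case Nil
  then have "x = Zero_set" by (cases x) auto
  then show ?case by (simp add: pspan_0)
next
  case (Cons a r)
  then obtain xs where xs: "x = Branch xs" "all_full U U r xs" by (cases x) auto
  show ?case
  proof
    fix y assume "y \<in> pspan \<theta> (length (a # r))"
    then obtain c s where y: "y = emb c \<oplus> \<theta> \<otimes> s" "s \<in> pspan \<theta> (length r)" by (auto simp: pspan_Suc)
    have "c mod p < length U" using U prime_gt_0_nat[OF prime_p] by simp
    then have "emb (c mod p) \<oplus> \<theta> \<otimes> s \<in> forest_set \<theta> xs"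
      using all_full_sound[OF \<theta> Cons.IH xs(2)] y(2) by blast
    then show "y \<in> tree_set \<theta> x" unfolding y xs emb_mod tree_set.simps .
  qed
qed

end

section \<open>Powers of a root as coefficient vectors\<close>

lemma card_set_mset_le: "card (set_mset M) \<le> size M"
  by (induction M) (auto simp: card_insert_if)

context finite_field begin

text \<open>\<open>normalize\<close> strips leading zeros of \<open>ws\<close>; a nonzero
  coefficient survives, and the degree is then less than the length.\<close>

lemma root_bound:
  assumes ws: "set ws \<subseteq> carrier R" and nz: "\<exists>w\<in>set ws. w \<noteq> \<zero>"
  shows "card {x \<in> carrier R. eval ws x = \<zero>} < length ws"
proof -
  let ?P = "normalize ws"
  have P: "?P \<in> carrier (poly_ring R)"
    using normalize_gives_polynomial[OF ws] unfolding univ_poly_carrier .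
  have "?P \<noteq> []"
  proof
    assume "?P = []"
    then have "ws = replicate (length ws) \<zero> @ drop (length ws) ws" using normalize_def'(1)[of ws] by simp
    then have "ws = replicate (length ws) \<zero>" by simp
    then have "\<forall>w\<in>set ws. w = \<zero>" by (metis in_set_replicate)
    then show False using nz by blast
  qed
  then have "{x \<in> carrier R. eval ws x = \<zero>} = set_mset (roots ?P)"
    using roots_mem_iff_is_root[OF P] eval_normalize[OF ws] by (auto simp: is_root_def)
  then have "card {x \<in> carrier R. eval ws x = \<zero>} \<le> size (roots ?P)"
    using card_set_mset_le[of "roots ?P"] by simp
  also have "\<dots> \<le> degree ?P" by (rule size_roots_le_degree[OF P])
  also have "\<dots> < length ?P" using \<open>?P \<noteq> []\<close> by (cases ?P) auto
  also have "\<dots> \<le> length ws" by (rule normalize_length_le)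
  finally show ?thesis .
qed

text \<open>The order is reversed: polynomials of the library start with the leading coefficient,
  coefficient vectors with the constant one.\<close>

fun dcoef :: "nat list \<Rightarrow> nat list \<Rightarrow> 'a list" where
  "dcoef (a # as) (b # bs) = dcoef as bs @ [emb a \<ominus> emb b]"
| "dcoef _ _ = []"

lemma dcoef_closed: "set (dcoef v w) \<subseteq> carrier R"
  by (induction v w rule: dcoef.induct) auto

lemma length_dcoef: "length v = length w \<Longrightarrow> length (dcoef v w) = length v"
  by (induction v w rule: list_induct2) auto

lemma eval_dcoef:
  "length v = length w \<Longrightarrow> x \<in> carrier R \<Longrightarrow> eval (dcoef v w) x = horner x v \<ominus> horner x w"
proof (induction v w rule: list_induct2)
  case (Cons a as b bs)
  have "eval (dcoef (a # as) (b # bs)) x = (horner x as \<ominus> horner x bs) \<otimes> x \<oplus> (emb a \<ominus> emb b)"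
    using Cons eval_append_aux[OF dcoef_closed _ Cons.prems, of "emb a \<ominus> emb b" as bs] by simp
  also have "\<dots> = horner x (a # as) \<ominus> horner x (b # bs)"
  proof -
    have "(A \<ominus> B) \<otimes> x \<oplus> (a' \<ominus> b') = (a' \<oplus> x \<otimes> A) \<ominus> (b' \<oplus> x \<otimes> B)"
      if "A \<in> carrier R" "B \<in> carrier R" "a' \<in> carrier R" "b' \<in> carrier R" for A B a' b'
      using that Cons.prems by algebra
    then show ?thesis using Cons.prems by simp
  qed
  finally show ?case .
qed (simp add: minus_eq)

end

text \<open>\<open>naxpy\<close>, \<open>nstep\<close> and \<open>norbit\<close> are the counterparts of \<open>axpy\<close>, \<open>step\<close> and \<open>orbit_list\<close> over \<open>nat\<close>.\<close>
fun naxpy :: "nat \<Rightarrow> nat \<Rightarrow> nat \<Rightarrow> nat list \<Rightarrow> nat list \<Rightarrow> nat list" where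
  "naxpy p c z [] vs = []"
| "naxpy p c z (r # rs) [] = []"
| "naxpy p c z (r # rs) (v # vs) = (z + r * c) mod p # naxpy p c v rs vs"

definition nstep :: "nat \<Rightarrow> nat list \<Rightarrow> nat list \<Rightarrow> nat list" where
  "nstep p r v = naxpy p (last v) 0 r v"

definition norbit :: "nat \<Rightarrow> nat list \<Rightarrow> nat \<Rightarrow> nat list" where
  "norbit p r i = (nstep p r ^^ i) (1 # replicate (length r - 1) 0)"

lemma length_naxpy: "length rs = length vs \<Longrightarrow> length (naxpy p c z rs vs) = length vs"
  by (induction p c z rs vs rule: naxpy.induct) auto

lemma naxpy_less: "p > 0 \<Longrightarrow> x \<in> set (naxpy p c z rs vs) \<Longrightarrow> x < p"
  by (induction p c z rs vs rule: naxpy.induct) auto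

lemma norbit_Suc: "norbit p r (Suc i) = nstep p r (norbit p r i)" by (simp add: norbit_def)

lemma length_norbit: "r \<noteq> [] \<Longrightarrow> length (norbit p r i) = length r"
  by (induction i) (auto simp: norbit_Suc nstep_def length_naxpy, simp add: norbit_def)

lemma norbit_less: "p > 1 \<Longrightarrow> x \<in> set (norbit p r i) \<Longrightarrow> x < p"
  by (induction i) (auto simp: norbit_Suc nstep_def dest: naxpy_less[rotated], auto simp: norbit_def)

lemma naxpy_0: "length rs = length vs \<Longrightarrow> naxpy p 0 z rs vs = map (\<lambda>x. x mod p) (butlast (z # vs))"
  by (induction rs vs arbitrary: z rule: list_induct2) auto

text \<open>While the top coefficient is 0, a step is a mere shift: for i < e the power X^i is its
  own remainder.\<close>

lemma norbit_unit:
  assumes "p > 1" "i < length r"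
  shows "norbit p r i = replicate i 0 @ 1 # replicate (length r - 1 - i) 0"
  using assms(2)
proof (induction i)
  case (Suc i)
  then have eq: "norbit p r i = replicate i 0 @ 1 # replicate (length r - 1 - i) 0" by simp
  obtain k where k: "length r - 1 - i = Suc k" using Suc.prems
    by (metis Suc_diff_Suc Suc_lessE diff_Suc_1 zero_less_diff less_diff_conv add.commute plus_1_eq_Suc)
  have eq': "norbit p r i = (replicate i 0 @ 1 # replicate k 0) @ [0]"
    unfolding eq k by (simp add: replicate_append_same)
  have "r \<noteq> []" using Suc.prems by auto
  have "nstep p r (norbit p r i) = naxpy p 0 0 r (norbit p r i)" unfolding nstep_def eq' by simp
  also have "\<dots> = map (\<lambda>x. x mod p) (butlast (0 # norbit p r i))"
    using length_norbit[OF \<open>r \<noteq> []\<close>] by (intro naxpy_0) simp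
  also have "\<dots> = 0 # replicate i 0 @ 1 # replicate k 0" using assms(1) unfolding eq' by (simp add: butlast_append)
  finally show ?case using k Suc.prems by (simp add: norbit_Suc)
qed (simp add: norbit_def)

lemma val_axpy:
  assumes "val c < val P" "val z < val P" "\<forall>v\<in>set vs. val v < val P"
  shows "map val (axpy P c z rs vs) = naxpy (val P) (val c) (val z) (map val rs) (map val vs)"
  using assms
proof (induction P c z rs vs rule: axpy.induct)
  case (3 P c z r rs v vs)
  have m: "val (modmul P r c) = val r * val c mod val P" using 3 by (simp add: val_modmul)
  moreover have "val r * val c mod val P < val P" using 3 by simp
  ultimately have "val (add z (modmul P r c)) < 2 * val P" using 3 unfolding val_add by linarith
  then have "val (csub P (add z (modmul P r c))) = (val z + val r * val c) mod val P"
    by (simp add: val_csub m mod_add_right_eq)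
  then show ?case using 3 by simp
qed auto

lemma val_step:
  assumes "v \<noteq> []" "\<forall>x\<in>set v. val x < val P"
  shows "map val (step P r v) = nstep (val P) (map val r) (map val v)"
proof -
  have "val (last v) < val P" using assms by simp
  moreover have "0 < val P" using calculation by linarith
  ultimately show ?thesis using assms by (simp add: step_def nstep_def val_axpy last_map)
qed

definition unit_vec :: "bin list \<Rightarrow> bin list" where "unit_vec r = B1 BE # tl (zeros r)"

lemma map_val_zeros: "map val (zeros r) = replicate (length r) 0" by (induction r) auto
lemma map_val_unit_vec: "map val (unit_vec r) = norbit (val P) (map val r) 0"
  using map_val_zeros[of r] by (simp add: unit_vec_def norbit_def map_tl)

lemma val_steps:
  assumes "val P > 1" "r \<noteq> []" "map val v = norbit (val P) (map val r) i"
  shows "map val (step P r v) = norbit (val P) (map val r) (Suc i)"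
proof -
  have "length v = length r" using assms length_norbit[of "map val r"] by (metis length_map list.map_disc_iff)
  moreover have "\<forall>x\<in>set (map val v). x < val P" unfolding assms(3) using norbit_less[OF assms(1)] by blast
  then have "\<forall>x\<in>set v. val x < val P" by simp
  moreover have "v \<noteq> []" using calculation(1) assms(2) by auto
  ultimately show ?thesis using val_step[of v P r] assms(3) by (simp add: norbit_Suc)
qed

fun iter :: "unit list \<Rightarrow> bin \<Rightarrow> bin list \<Rightarrow> bin list \<Rightarrow> bin list" where
  "iter [] P r v = v" | "iter (u # us) P r v = iter us P r (step P r v)"

lemma val_iter:
  assumes "val P > 1" "r \<noteq> []" "map val v = norbit (val P) (map val r) i"
  shows "map val (iter us P r v) = norbit (val P) (map val r) (i + length us)"
  using assms(3)
proof (induction us arbitrary: v i)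
  case (Cons u us)
  show ?case using Cons.IH[OF val_steps[OF assms(1,2) Cons.prems]] by simp
qed simp

lemma val_orbit_list:
  assumes "val P > 1" "r \<noteq> []" "map val v = norbit (val P) (map val r) i"
  shows "map (map val) (orbit_list us P r v) = map (norbit (val P) (map val r)) [i..<i + length us]"
  using assms(3)
proof (induction us arbitrary: v i)
  case (Cons u us)
  have "[i..<i + length (u # us)] = i # [Suc i..<Suc i + length us]" by (simp add: upt_conv_Cons del: upt_Suc)
  then show ?case using Cons.IH[OF val_steps[OF assms(1,2) Cons.prems]] Cons.prems by (simp del: upt_Suc)
qed simp

lemma eqvl_iff: "eqvl xs ys \<longleftrightarrow> map val xs = map val ys"
  and eqvl'_iff: "eqvl' b xs ys \<longleftrightarrow> b \<and> map val xs = map val ys"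
  by (induction xs ys and b xs ys rule: eqvl_eqvl'.induct) (auto simp: eqv_iff)

context char_field begin

text \<open>Valid for every \<theta>, root or not: the extra summand on the left is the top term
  dropped by the shift. So the identity serves both the powers of a root and division with
  remainder.\<close>

lemma horner_naxpy:
  assumes "\<theta> \<in> carrier R" "length rs = length vs"
  shows "horner \<theta> (naxpy p c z rs vs) \<oplus> \<theta> [^] length rs \<otimes> emb (last (z # vs)) =
         emb z \<oplus> emb c \<otimes> horner \<theta> rs \<oplus> \<theta> \<otimes> horner \<theta> vs"
  using assms(2)
proof (induction rs vs arbitrary: z rule: list_induct2)
  case Nil
  then show ?case using assms by simp
next
  case (Cons r rs v vs)
  let ?E = "horner \<theta> (naxpy p c v rs vs)" and ?l = "emb (last (v # vs))"
  have "horner \<theta> (naxpy p c z (r # rs) (v # vs)) \<oplus> \<theta> [^] length (r # rs) \<otimes> emb (last (z # v # vs)) =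
        (emb z \<oplus> emb r \<otimes> emb c \<oplus> \<theta> \<otimes> ?E) \<oplus> (\<theta> [^] length rs \<otimes> \<theta>) \<otimes> ?l"
    by (simp add: emb_mod emb_add emb_mult)
  also have "\<dots> = emb z \<oplus> emb r \<otimes> emb c \<oplus> \<theta> \<otimes> (?E \<oplus> \<theta> [^] length rs \<otimes> ?l)"
  proof -
    have "A \<oplus> \<theta> \<otimes> B \<oplus> (C \<otimes> \<theta>) \<otimes> D = A \<oplus> \<theta> \<otimes> (B \<oplus> C \<otimes> D)"
      if "A \<in> carrier R" "B \<in> carrier R" "C \<in> carrier R" "D \<in> carrier R" for A B C D
      using that assms(1) by algebra
    then show ?thesis using assms(1) by simp
  qed
  also have "?E \<oplus> \<theta> [^] length rs \<otimes> ?l = emb v \<oplus> emb c \<otimes> horner \<theta> rs \<oplus> \<theta> \<otimes> horner \<theta> vs"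
    by (rule Cons.IH)
  also have "emb z \<oplus> emb r \<otimes> emb c \<oplus> \<theta> \<otimes> (emb v \<oplus> emb c \<otimes> horner \<theta> rs \<oplus> \<theta> \<otimes> horner \<theta> vs) =
      emb z \<oplus> emb c \<otimes> horner \<theta> (r # rs) \<oplus> \<theta> \<otimes> horner \<theta> (v # vs)"
  proof -
    have "A \<oplus> B \<otimes> C \<oplus> \<theta> \<otimes> (D \<oplus> C \<otimes> F \<oplus> \<theta> \<otimes> G) = A \<oplus> C \<otimes> (B \<oplus> \<theta> \<otimes> F) \<oplus> \<theta> \<otimes> (D \<oplus> \<theta> \<otimes> G)"
      if "A \<in> carrier R" "B \<in> carrier R" "C \<in> carrier R" "D \<in> carrier R" "F \<in> carrier R"
        "G \<in> carrier R" for A B C D F G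
      using that assms(1) by algebra
    then show ?thesis using assms(1) by simp
  qed
  finally show ?case .
qed

lemma horner_nstep:
  assumes "\<theta> \<in> carrier R" "length r = length v" "v \<noteq> []"
  shows "horner \<theta> (nstep p r v) \<oplus> \<theta> [^] length r \<otimes> emb (last v) = emb (last v) \<otimes> horner \<theta> r \<oplus> \<theta> \<otimes> horner \<theta> v"
  using horner_naxpy[OF assms(1,2), of "last v" 0] assms by (simp add: nstep_def)

lemma horner_norbit_root:
  assumes \<theta>: "\<theta> \<in> carrier R" "\<theta> [^] length r = horner \<theta> r" and r: "r \<noteq> []"
  shows "horner \<theta> (norbit p r i) = \<theta> [^] i"
proof (induction i)
  case 0
  have "horner \<theta> (replicate n 0) = \<zero>" for n using \<theta> by (induction n) auto
  then show ?case using \<theta> by (simp add: norbit_def)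
next
  case (Suc i)
  let ?v = "norbit p r i"
  have "horner \<theta> (nstep p r ?v) \<oplus> horner \<theta> r \<otimes> emb (last ?v) = emb (last ?v) \<otimes> horner \<theta> r \<oplus> \<theta> \<otimes> horner \<theta> ?v"
    using horner_nstep[OF \<theta>(1), of r ?v] length_norbit[OF r, of p i] r \<theta>(2) by (metis length_0_conv)
  then have "horner \<theta> (nstep p r ?v) \<oplus> horner \<theta> r \<otimes> emb (last ?v) = \<theta> \<otimes> horner \<theta> ?v \<oplus> horner \<theta> r \<otimes> emb (last ?v)"
    using \<theta>(1) by (simp add: m_comm a_comm)
  then have "horner \<theta> (nstep p r ?v) = \<theta> \<otimes> horner \<theta> ?v" using \<theta>(1) by simp
  then show ?case using Suc \<theta> by (simp add: norbit_Suc m_comm)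
qed

text \<open>Coefficients of the quotient of \<open>X ^ i\<close> by \<open>X ^ e - r(X)\<close>; the remainder is \<open>norbit p r i\<close>.\<close>
definition gcoef :: "nat list \<Rightarrow> nat \<Rightarrow> 'a list" where
  "gcoef r i = map (\<lambda>j. emb (last (norbit p r j))) [0..<i]"

lemma gcoef_closed: "set (gcoef r i) \<subseteq> carrier R" by (auto simp: gcoef_def)

text \<open>Multiplication by x shifts the quotient, and the top coefficient of the old remainder
  becomes the new constant term of the quotient.\<close>

lemma division:
  assumes x: "x \<in> carrier R" and r: "r \<noteq> []"
  shows "x [^] i = (x [^] length r \<ominus> horner x r) \<otimes> eval (gcoef r i) x \<oplus> horner x (norbit p r i)"
proof (induction i)
  case 0
  have "horner x (replicate n 0) = \<zero>" for n using x by (induction n) auto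
  then show ?case using x by (simp add: norbit_def gcoef_def)
next
  case (Suc i)
  let ?v = "norbit p r i"
  have g: "eval (gcoef r (Suc i)) x = eval (gcoef r i) x \<otimes> x \<oplus> emb (last ?v)"
    using eval_append_aux[OF gcoef_closed _ x, of "emb (last ?v)" r i] by (simp add: gcoef_def)
  have eq: "horner x (norbit p r (Suc i)) \<oplus> x [^] length r \<otimes> emb (last ?v) = emb (last ?v) \<otimes> horner x r \<oplus> x \<otimes>
    horner x ?v"
    unfolding norbit_Suc using horner_nstep[OF x, of r ?v] length_norbit[OF r, of p i] r by (metis length_0_conv)
  have gc: "eval (gcoef r i) x \<in> carrier R" using eval_in_carrier[OF gcoef_closed x] .
  have alg: "(A \<ominus> B) \<otimes> (C \<otimes> x \<oplus> D) \<oplus> F = ((A \<ominus> B) \<otimes> C \<oplus> G) \<otimes> x"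
    if "F \<oplus> A \<otimes> D = D \<otimes> B \<oplus> x \<otimes> G" "A \<in> carrier R" "B \<in> carrier R" "C \<in> carrier R" "D \<in> carrier R" "F \<in> carrier R"
      "G \<in> carrier R"
    for A B C D F G
  proof -
    have F: "F = D \<otimes> B \<oplus> x \<otimes> G \<ominus> A \<otimes> D"
      using that x by (metis add.inv_solve_right a_minus_def add.m_closed m_closed)
    show ?thesis unfolding F using that(2-) x by algebra
  qed
  show ?case unfolding nat_pow_Suc Suc g by (rule alg[symmetric, OF eq]) (use x gc in auto)
qed

text \<open>If \<open>X ^ e - r(X)\<close> divides \<open>X ^ t - 1\<close>, the quotient kills at most \<open>t - e\<close> of the \<open>t\<close>-th roots of
  unity, so the other \<open>e\<close> are roots of \<open>X ^ e - r(X)\<close>; a nonzero remainder of \<open>X ^ N - 1\<close> cannot vanish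
  on all of them.\<close>
lemma exists_root:
  assumes Q: "Q = d * t + 1" and r: "r \<noteq> []" and per: "norbit p r t = norbit p r 0" and et: "length r \<le> t"
  shows "\<exists>\<theta>\<in>units_ord t. \<theta> [^] length r = horner \<theta> r \<and> (norbit p r N \<noteq> norbit p r 0 \<longrightarrow> \<theta> [^] N \<noteq> \<one>)"
proof -
  let ?f = "\<lambda>x. x [^] length r \<ominus> horner x r"
  let ?e = "length r"
  define Z where "Z = {x \<in> units_ord t. ?f x = \<zero>}"
  have p1: "p > 1" using prime_gt_1_nat[OF prime_p] .
  have t0: "t > 0" using et r by (cases r) auto
  have fin: "finite (units_ord t)" using finite_carrier by (simp add: units_ord_def)
  have cH: "card (units_ord t) = t" using units_ord_eq(2)[of d t] Q by simp
  have ev0: "horner x (norbit p r 0) = \<one>" if "x \<in> carrier R" for x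
  proof -
    have "horner x (replicate n 0) = \<zero>" for n using that by (induction n) auto
    then show ?thesis using that by (simp add: norbit_def)
  qed
  have last_unit: "last (norbit p r j) = (if j = ?e - 1 then 1 else 0)" if "j < ?e" for j
  proof -
    have "last (norbit p r j) = last (1 # replicate (?e - 1 - j) 0)" using norbit_unit[OF p1 that] by simp
    also have "\<dots> = (if ?e - 1 - j = 0 then 1 else 0)" by (cases "?e - 1 - j") auto
    finally show ?thesis using that by auto
  qed
  \<comment> \<open>For j < e - 1 the remainder X^j has no term of degree e - 1, so the quotient
    begins with e - 1 zeros. The t - e + 1 entries behind them start with 1, which leaves at most t
    - e roots.\<close>
  define g' where "g' = map (\<lambda>j. emb (last (norbit p r j))) [?e - 1..<t]"
  have "gcoef r t = map (\<lambda>j. emb (last (norbit p r j))) [0..<?e - 1] @ g'"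
    unfolding gcoef_def g'_def map_append[symmetric]
    using upt_add_eq_append[of 0 "?e - 1" "t - (?e - 1)"] et by simp
  also have "map (\<lambda>j. emb (last (norbit p r j))) [0..<?e - 1] = replicate (?e - 1) \<zero>"
    using last_unit by (intro nth_equalityI) auto
  finally have g: "gcoef r t = replicate (?e - 1) \<zero> @ g'" .
  have g'c: "set g' \<subseteq> carrier R" by (auto simp: g'_def)
  have "?e - 1 \<in> set [?e - 1..<t]" using et r by (cases r) auto
  then have "emb (last (norbit p r (?e - 1))) \<in> set g'" unfolding g'_def by (simp only: set_map image_eqI)
  moreover have "last (norbit p r (?e - 1)) = 1" using last_unit[of "?e - 1"] r by (cases r) auto
  ultimately have "\<one> \<in> set g'" by simp
  then have "card {x \<in> carrier R. eval g' x = \<zero>} < length g'" using root_bound[OF g'c] one_not_zero by blast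
  moreover have "length g' = t - (?e - 1)" by (simp add: g'_def)
  ultimately have gb: "card {x \<in> carrier R. eval g' x = \<zero>} \<le> t - ?e" using et r by (cases r) auto
  have "units_ord t - Z \<subseteq> {x \<in> carrier R. eval g' x = \<zero>}"
  proof
    fix x assume x: "x \<in> units_ord t - Z"
    then have xc: "x \<in> carrier R" "x [^] t = \<one>" "?f x \<noteq> \<zero>" by (auto simp: units_ord_def Z_def)
    have gc: "eval (gcoef r t) x \<in> carrier R" using eval_in_carrier[OF gcoef_closed xc(1)] .
    have "\<one> = ?f x \<otimes> eval (gcoef r t) x \<oplus> \<one>" using division[OF xc(1) r, of t] xc per ev0 by simp
    then have "?f x \<otimes> eval (gcoef r t) x = \<zero>" using xc(1) gc
      by (metis add.l_cancel_one' horner_closed m_closed minus_closed nat_pow_closed one_closed a_comm)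
    then have "eval (gcoef r t) x = \<zero>" using xc gc by (metis horner_closed integral minus_closed nat_pow_closed)
    then have "eval g' x = \<zero>" using eval_replicate[OF g'c xc(1)] g by simp
    then show "x \<in> {x \<in> carrier R. eval g' x = \<zero>}" using xc by simp
  qed
  then have "card (units_ord t - Z) \<le> t - ?e"
    using gb finite_carrier card_mono[of "{x \<in> carrier R. eval g' x = \<zero>}" "units_ord t - Z"] by simp
  moreover have "card (units_ord t - Z) = t - card Z"
    using fin cH by (subst card_Diff_subset) (auto simp: Z_def)
  moreover have "card Z \<le> t" using card_mono[OF fin, of Z] cH by (auto simp: Z_def)
  ultimately have cZ: "?e \<le> card Z" using et by linarith
  have Zroot: "x \<in> units_ord t" "x \<in> carrier R" "x [^] ?e = horner x r" if "x \<in> Z" for x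
    using that by (auto simp: Z_def units_ord_def)
  show ?thesis
  proof (cases "norbit p r N = norbit p r 0")
    case True
    have "Z \<noteq> {}" using cZ r by (cases r) auto
    then show ?thesis using Zroot True by blast
  next
    case False
    let ?w = "dcoef (norbit p r N) (norbit p r 0)"
    have len: "length (norbit p r N) = length (norbit p r 0)" by (simp add: length_norbit r)
    \<comment> \<open>Residues below p are determined by their images in the field, so distinct
      vectors have a nonzero difference there.\<close>
    have nz: "\<exists>w\<in>set (dcoef v w). w \<noteq> \<zero>"
      if "length v = length w" "v \<noteq> w" "\<forall>x\<in>set v. x < p" "\<forall>x\<in>set w. x < p" for v w
      using that
    proof (induction v w rule: list_induct2)
      case (Cons a as b bs)
      show ?case
      proof (cases "a = b")
        case True
        then show ?thesis using Cons by auto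
      next
        case False
        then have "emb a \<noteq> emb b" using emb_inj[of a b] Cons.prems by auto
        then have "emb a \<ominus> emb b \<noteq> \<zero>" by simp
        then show ?thesis by auto
      qed
    qed simp
    have "card {x \<in> carrier R. eval ?w x = \<zero>} < ?e"
      using root_bound[OF dcoef_closed nz[OF len False]] norbit_less[OF p1] len
      by (simp add: length_dcoef length_norbit r)
    then have "\<not> Z \<subseteq> {x \<in> carrier R. eval ?w x = \<zero>}"
      using cZ finite_carrier card_mono[of "{x \<in> carrier R. eval ?w x = \<zero>}" Z] by auto
    then obtain x where x: "x \<in> Z" "eval ?w x \<noteq> \<zero>" using Zroot by blast
    have "x [^] N \<noteq> \<one>"
    proof
      assume "x [^] N = \<one>"
      then have "eval ?w x = \<zero>"
        using eval_dcoef[OF len] Zroot[OF x(1)] horner_norbit_root[OF Zroot(2,3)[OF x(1)] r, of N] ev0[of x]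
          by simp
      then show False using x by simp
    qed
    then show ?thesis using Zroot[OF x(1)] by blast
  qed
qed

end

section \<open>Sumset certificates\<close>

context char_field begin

lemma horner_snoc: "\<theta> \<in> carrier R \<Longrightarrow> horner \<theta> (v @ [c]) = horner \<theta> v \<oplus> emb c \<otimes> \<theta> [^] length v"
proof (induction v)
  case (Cons a v)
  have "emb a \<oplus> \<theta> \<otimes> (horner \<theta> v \<oplus> emb c \<otimes> \<theta> [^] length v) =
        emb a \<oplus> \<theta> \<otimes> horner \<theta> v \<oplus> emb c \<otimes> (\<theta> [^] length v \<otimes> \<theta>)"
  proof -
    have "A \<oplus> \<theta> \<otimes> (B \<oplus> C \<otimes> D) = A \<oplus> \<theta> \<otimes> B \<oplus> C \<otimes> (D \<otimes> \<theta>)"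
      if "A \<in> carrier R" "B \<in> carrier R" "C \<in> carrier R" "D \<in> carrier R" for A B C D
      using that Cons.prems by algebra
    then show ?thesis using Cons.prems by simp
  qed
  then show ?case using Cons by simp
qed simp

lemma pspan_zero: "\<theta> \<in> carrier R \<Longrightarrow> \<zero> \<in> pspan \<theta> n"
  by (induction n) (auto simp: pspan_0 pspan_Suc intro!: exI[of _ 0] exI[of _ \<zero>])

lemma pspan_one: "\<theta> \<in> carrier R \<Longrightarrow> n > 0 \<Longrightarrow> \<one> \<in> pspan \<theta> n"
  using pspan_zero[of \<theta> "n - 1"] by (cases n) (auto simp: pspan_Suc intro!: exI[of _ "Suc 0"] exI[of _ \<zero>])

lemma pspan_add: "\<theta> \<in> carrier R \<Longrightarrow> a \<in> pspan \<theta> n \<Longrightarrow> b \<in> pspan \<theta> n \<Longrightarrow> a \<oplus> b \<in> pspan \<theta> n"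
proof (induction n arbitrary: a b)
  case (Suc n)
  obtain c s c' s' where ab: "a = emb c \<oplus> \<theta> \<otimes> s" "s \<in> pspan \<theta> n" "b = emb c' \<oplus> \<theta> \<otimes> s'" "s' \<in> pspan \<theta> n"
    using Suc.prems by (auto simp: pspan_Suc)
  have sc: "s \<in> carrier R" "s' \<in> carrier R" using ab pspan_closed[OF Suc.prems(1)] by auto
  have "A \<oplus> \<theta> \<otimes> s \<oplus> (B \<oplus> \<theta> \<otimes> s') = A \<oplus> B \<oplus> \<theta> \<otimes> (s \<oplus> s')" if "A \<in> carrier R" "B \<in> carrier R" for A B
    using that sc Suc.prems(1) by algebra
  then have "a \<oplus> b = emb (c + c') \<oplus> \<theta> \<otimes> (s \<oplus> s')" unfolding ab by (simp add: emb_add)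
  then show ?case using Suc.IH[OF Suc.prems(1) ab(2,4)] unfolding pspan_Suc by blast
qed (auto simp: pspan_0)

lemma pspan_scale: "\<theta> \<in> carrier R \<Longrightarrow> s \<in> pspan \<theta> n \<Longrightarrow> emb c \<otimes> s \<in> pspan \<theta> n"
proof (induction c)
  case 0
  then show ?case using pspan_zero pspan_closed[of \<theta> n] by auto
next
  case (Suc c)
  have "s \<in> carrier R" using Suc pspan_closed by blast
  then have "emb (Suc c) \<otimes> s = emb c \<otimes> s \<oplus> s" by (simp add: l_distr)
  then show ?case using Suc pspan_add by simp
qed

lemma pspan_uminus: "\<theta> \<in> carrier R \<Longrightarrow> s \<in> pspan \<theta> n \<Longrightarrow> \<ominus> s \<in> pspan \<theta> n"
proof -
  assume s: "\<theta> \<in> carrier R" "s \<in> pspan \<theta> n"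
  then have sc: "s \<in> carrier R" using pspan_closed by blast
  have "p = Suc (p - 1)" using prime_gt_0_nat[OF prime_p] by simp
  then have "emb (p - 1) \<oplus> \<one> = \<zero>" using emb_p emb.simps(2)[of "p - 1"] by metis
  then have "(emb (p - 1) \<oplus> \<one>) \<otimes> s = \<zero>" using sc by simp
  then have "emb (p - 1) \<otimes> s \<oplus> s = \<zero>" using sc by (simp add: l_distr)
  then have "\<ominus> s = emb (p - 1) \<otimes> s" using sc by (intro minus_equality) auto
  then show "\<ominus> s \<in> pspan \<theta> n" using pspan_scale[OF s] by simp
qed

text \<open>All coefficients move up one place; the top one then belongs to \<theta>^e, which the
  relation expresses by lower powers.\<close>

lemma pspan_theta:
  assumes \<theta>: "\<theta> \<in> carrier R" "\<theta> [^] length r = horner \<theta> r" "s \<in> pspan \<theta> (length r)"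
  shows "\<theta> \<otimes> s \<in> pspan \<theta> (length r)"
proof (cases "r = []")
  case True
  then show ?thesis using assms by (simp add: pspan_0)
next
  case False
  obtain v where v: "s = horner \<theta> v" "length v = length r" using assms by (auto simp: pspan_def)
  then obtain w c where w: "v = w @ [c]" using False by (cases v rule: rev_cases) auto
  have "\<theta> \<otimes> s = (emb 0 \<oplus> \<theta> \<otimes> horner \<theta> w) \<oplus> emb c \<otimes> (\<theta> [^] length w \<otimes> \<theta>)"
  proof -
    have "\<theta> \<otimes> (B \<oplus> C \<otimes> D) = (\<zero> \<oplus> \<theta> \<otimes> B) \<oplus> C \<otimes> (D \<otimes> \<theta>)"
      if "B \<in> carrier R" "C \<in> carrier R" "D \<in> carrier R" for B C D
      using that \<theta>(1) by algebra
    then show ?thesis using \<theta> by (simp add: v w horner_snoc)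
  qed
  also have "\<theta> [^] length w \<otimes> \<theta> = horner \<theta> r" using v w \<theta>(2) by (metis length_append_singleton nat_pow_Suc)
  also have "emb 0 \<oplus> \<theta> \<otimes> horner \<theta> w = horner \<theta> (0 # w)" by simp
  finally have "\<theta> \<otimes> s = horner \<theta> (0 # w) \<oplus> emb c \<otimes> horner \<theta> r" .
  moreover have "horner \<theta> (0 # w) \<in> pspan \<theta> (length r)" "horner \<theta> r \<in> pspan \<theta> (length r)"
    using v w unfolding pspan_def by (auto intro: exI[of _ "0 # w"])
  ultimately show ?thesis using pspan_add pspan_scale \<theta>(1) by simp
qed

lemma pspan_mult:
  assumes \<theta>: "\<theta> \<in> carrier R" "\<theta> [^] length r = horner \<theta> r" "b \<in> pspan \<theta> (length r)"
  shows "a \<in> pspan \<theta> n \<Longrightarrow> a \<otimes> b \<in> pspan \<theta> (length r)"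
proof (induction n arbitrary: a)
  case 0
  then show ?case using pspan_zero[OF \<theta>(1)] pspan_closed[OF \<theta>(1), of "length r"] \<theta>(3) by (auto simp: pspan_0)
next
  case (Suc n)
  obtain c s where a: "a = emb c \<oplus> \<theta> \<otimes> s" "s \<in> pspan \<theta> n" using Suc.prems by (auto simp: pspan_Suc)
  have "s \<in> carrier R" "b \<in> carrier R" using a \<theta> pspan_closed[OF \<theta>(1)] by auto
  then have "a \<otimes> b = emb c \<otimes> b \<oplus> \<theta> \<otimes> (s \<otimes> b)" using \<theta>(1) by (simp add: a l_distr m_assoc)
  then show ?case using pspan_add[OF \<theta>(1)] pspan_scale[OF \<theta>(1,3)] pspan_theta[OF \<theta>(1,2) Suc.IH[OF a(2)]] by simp
qed

text \<open>The span of the powers of \<open>\<theta>\<close> is a subfield, so \<open>\<theta>\<close> has order dividing \<open>p ^ j - 1\<close> unless the span is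
  everything.\<close>
lemma pspan_eq_carrier:
  assumes \<theta>: "\<theta> \<in> nonzero" "\<theta> [^] length r = horner \<theta> r" and len: "length r = e"
    and N: "e = 1 \<or> (\<forall>f. 0 < f \<longrightarrow> f < e \<longrightarrow> (p ^ f - 1) dvd N) \<and> \<theta> [^] N \<noteq> \<one>"
  shows "pspan \<theta> e = carrier R"
proof -
  have \<theta>c: "\<theta> \<in> carrier R" using \<theta> by auto
  let ?S = "pspan \<theta> e"
  have S: "?S \<subseteq> carrier R" by (rule pspan_closed[OF \<theta>c])
  have fS: "finite ?S" using finite_subset[OF S finite_carrier] .
  have mult: "a \<otimes> b \<in> ?S" if "a \<in> ?S" "b \<in> ?S" for a b
    using pspan_mult[OF \<theta>c \<theta>(2)] that len by simp
  have zero: "\<zero> \<in> ?S" and one: "\<one> \<in> ?S" using pspan_zero[OF \<theta>c] pspan_one[OF \<theta>c e_pos] by auto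
  \<comment> \<open>Lagrange in the additive group makes the size of the span a power p^j.\<close>
  have "subgroup ?S (add_monoid R)"
    using S zero pspan_add[OF \<theta>c] pspan_uminus[OF \<theta>c] by (intro subgroup.intro) (auto simp flip: a_inv_def)
  from group.lagrange[OF a_group this] have "card ?S dvd p ^ e"
    using card_eq by (metis dvd_triv_right order_def partial_object.select_convs(1))
  then obtain j where j: "j \<le> e" "card ?S = p ^ j" using prime_p by (auto simp: divides_primepow_nat)
  show ?thesis
  proof (cases "j = e")
    case True
    then show ?thesis using card_subset_eq[OF finite_carrier S] j card_eq by simp
  next
    case False
    have "card {\<zero>, \<one>} \<le> card ?S" using zero one fS by (intro card_mono) auto
    then have "j > 0" using j by (cases j) auto
    let ?T = "?S - {\<zero>}"
    have powS: "x [^] (n::nat) \<in> ?S" if "x \<in> ?S" for x n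
      by (induction n) (auto simp: one mult that)
    \<comment> \<open>Closure under products gives closure under inverses, because the inverse of x
      is x^(q-2). The order of this group, p^j - 1, then annihilates \<theta>.\<close>
    have "subgroup ?T (Multiplicative_Group.mult_of R)"
    proof (rule subgroup.intro)
      show "?T \<subseteq> carrier (Multiplicative_Group.mult_of R)" using S by auto
      show "x \<otimes>\<^bsub>Multiplicative_Group.mult_of R\<^esub> y \<in> ?T" if "x \<in> ?T" "y \<in> ?T" for x y
        using that mult S by (auto simp: integral_iff subset_iff)
      show "\<one>\<^bsub>Multiplicative_Group.mult_of R\<^esub> \<in> ?T" using one by simp
      fix x assume x: "x \<in> ?T"
      then have xn: "x \<in> nonzero" using S by auto
      have "x [^] Suc (Q - 2) = \<one>" using pow_Q1[OF xn] Q_gt_1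
        by (simp add: Suc_diff_Suc numeral_2_eq_2 del: nat_pow_Suc)
      then have "x \<otimes> x [^] (Q - 2) = \<one>" using xn by (simp add: m_comm)
      then have "inv x = x [^] (Q - 2)" using xn by (intro comm_inv_char) auto
      then have "inv x \<in> ?T" using powS[of x "Q - 2"] nat_pow_nonzero[OF xn, of "Q - 2"] x by auto
      then show "inv\<^bsub>Multiplicative_Group.mult_of R\<^esub> x \<in> ?T" using m_inv_mult_of[of x] xn by simp
    qed
    then have "group (Multiplicative_Group.mult_of R \<lparr>carrier := ?T\<rparr>)"
      using subgroup.subgroup_is_group field_mult_group by blast
    moreover have "\<theta> \<in> ?T"
      using \<theta> pspan_theta[OF \<theta>c \<theta>(2)] one len by force
    ultimately have "\<theta> [^]\<^bsub>Multiplicative_Group.mult_of R \<lparr>carrier := ?T\<rparr>\<^esub> card ?T = \<one>"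
      using group.pow_order_eq_1[of "Multiplicative_Group.mult_of R \<lparr>carrier := ?T\<rparr>" \<theta>] by (simp add: order_def)
    moreover have "\<theta> [^]\<^bsub>Multiplicative_Group.mult_of R \<lparr>carrier := ?T\<rparr>\<^esub> n = \<theta> [^] n" for n :: nat
      by (induction n) (auto simp: nat_pow_def)
    ultimately have o: "\<theta> [^] (p ^ j - 1) = \<one>" using j fS zero by simp
    then have "e \<noteq> 1" using \<open>j > 0\<close> False j by auto
    then have "(p ^ j - 1) dvd N" "\<theta> [^] N \<noteq> \<one>" using N \<open>j > 0\<close> False j by auto
    then obtain i where "N = (p ^ j - 1) * i" by blast
    then have "\<theta> [^] N = \<one>" using o \<theta>c by (simp flip: nat_pow_pow)
    then show ?thesis using \<open>\<theta> [^] N \<noteq> \<one>\<close> by simp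
  qed
qed

text \<open>The map is a surjection between sets of the same size p^e.\<close>

lemma horner_inj:
  assumes \<theta>: "\<theta> \<in> carrier R" and S: "pspan \<theta> e = carrier R"
  shows "inj_on (horner \<theta>) {v. set v \<subseteq> {..<p} \<and> length v = e}"
proof (rule eq_card_imp_inj_on)
  let ?L = "{v. set v \<subseteq> {..<p} \<and> length v = e}"
  show "finite ?L" by (rule finite_lists_length_eq) simp
  have md: "horner \<theta> (map (\<lambda>x. x mod p) v) = horner \<theta> v" for v by (induction v) (auto simp: emb_mod)
  have "carrier R \<subseteq> horner \<theta> ` ?L"
  proof
    fix x assume "x \<in> carrier R"
    then obtain v where v: "x = horner \<theta> v" "length v = e" using S by (auto simp: pspan_def)
    then show "x \<in> horner \<theta> ` ?L"
      using prime_gt_0_nat[OF prime_p] md[of v] by (intro image_eqI[of _ _ "map (\<lambda>x. x mod p) v"]) auto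
  qed
  then have "horner \<theta> ` ?L = carrier R" using \<theta> by auto
  then show "card (horner \<theta> ` ?L) = card ?L" using card_eq card_lists_length_eq[of "{..<p}" e] by simp
qed

end

section \<open>Tests for roots, covering and exact values\<close>

fun power_len :: "'a list \<Rightarrow> bin \<Rightarrow> bin" where
  "power_len [] P = B1 BE" | "power_len (u # us) P = mul P (power_len us P)"
fun dvdb' :: "bool \<Rightarrow> bin \<Rightarrow> bin \<Rightarrow> bool" where
  "dvdb' True m n = True" | "dvdb' False m n = eqv (modmul m n (B1 BE)) BE"
text \<open>Multiplying n by 1 modulo m yields the remainder of n. This presupposes 1 < m, so m = 1
  is treated apart.\<close>

definition dvdb :: "bin \<Rightarrow> bin \<Rightarrow> bool" where "dvdb m n = dvdb' (eqv m (B1 BE)) m n"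
text \<open>With e - 1 list entries and f = P at the start, the divisors are p^1 - 1, ..., p^(e-1) -
  1.\<close>

fun dvdbs :: "'a list \<Rightarrow> bin \<Rightarrow> bin \<Rightarrow> bin \<Rightarrow> bool" where
  "dvdbs [] P f N = True" | "dvdbs (u # us) P f N = (dvdb (dec f) N \<and> dvdbs us P (mul P f) N)"
fun nonempty :: "'a list \<Rightarrow> bool" where "nonempty [] = False" | "nonempty (x # xs) = True"
fun isnil :: "'a list \<Rightarrow> bool" where "isnil [] = True" | "isnil (x # xs) = False"

text \<open>For \<open>q = p ^ e = d t + 1\<close>: \<open>X ^ e - r(X)\<close> divides \<open>X ^ t - 1\<close>, and \<open>X ^ N \<noteq> 1\<close> modulo it although \<open>N\<close>
  is a multiple of \<open>p ^ f - 1\<close> for all \<open>0 < f < e\<close>. This yields a \<open>t\<close>-th root of unity generating the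
  field.\<close>
definition check_root :: "bin \<Rightarrow> bin \<Rightarrow> bin \<Rightarrow> bin list \<Rightarrow> bin \<Rightarrow> bool" where
  "check_root d t P r N \<longleftrightarrow> nonempty r \<and> lt (len r) t True \<and> eqv (power_len r P) (inc (mul d t)) \<and>
     eqvl (iter (unary t) P r (unit_vec r)) (unit_vec r) \<and>
     (isnil (tl r) \<or> dvdbs (tl r) P P N \<and> lt (B1 BE) t False \<and> \<not> eqvl (iter (unary (modmul t N (B1 BE))) P r
       (unit_vec r)) (unit_vec r))"

definition check_cover :: "bin \<Rightarrow> bin \<Rightarrow> bin \<Rightarrow> bin list \<Rightarrow> bin \<Rightarrow> bin \<Rightarrow> bool" where
  "check_cover d t P r N m \<longleftrightarrow> check_root d t P r N \<and> is_full (unary P) r (sum_iter (tl (unary m)) (unary P)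
    (power_tree P r t))"

fun all_distinct :: "bin list list \<Rightarrow> bool" and not_in :: "bin list \<Rightarrow> bin list list \<Rightarrow> bool" where
  "all_distinct [] = True" | "all_distinct (v # vs) = (not_in v vs \<and> all_distinct vs)"
| "not_in v [] = True" | "not_in v (w # ws) = (\<not> eqvl v w \<and> not_in v ws)"

text \<open>The exact value \<open>m\<close>: the tree for \<open>m - 1\<close> summands has fewer than \<open>q\<close> leaves, the next one is
  complete.\<close>
definition check_exact' :: "bin \<Rightarrow> bin \<Rightarrow> bin \<Rightarrow> bin list \<Rightarrow> ptree \<Rightarrow> ptree \<Rightarrow> bool" where
  "check_exact' d t P r K S \<longleftrightarrow> lt (count_tree S) (inc (mul d t)) False \<and> is_full (unary P) r (sum_tree (unary P) K
    S)"

definition check_exact'' :: "bin \<Rightarrow> bin \<Rightarrow> bin \<Rightarrow> bin list \<Rightarrow> bin \<Rightarrow> ptree \<Rightarrow> bool" where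
  "check_exact'' d t P r m K = check_exact' d t P r K (sum_iter (tl (tl (unary m))) (unary P) K)"

text \<open>Distinctness of the t vectors ensures that \<theta> has order exactly t, so that the
  tree denotes all d-th powers. The lower bound depends on this, whereas for an upper bound a subset
  of the powers is enough.\<close>

definition check_exact :: "bin \<Rightarrow> bin \<Rightarrow> bin \<Rightarrow> bin list \<Rightarrow> bin \<Rightarrow> bin \<Rightarrow> bool" where
  "check_exact d t P r N m \<longleftrightarrow> check_root d t P r N \<and> lt (B1 BE) m False \<and> all_distinct (orbit_list (unary t) P r
    (unit_vec r)) \<and> check_exact'' d t P r m (power_tree P r t)"

lemma nonempty_iff: "nonempty xs \<longleftrightarrow> xs \<noteq> []" and isnil_iff: "isnil xs \<longleftrightarrow> xs = []" by (cases xs; simp)+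
lemma val_power_len: "val (power_len us P) = val P ^ length us" by (induction us) auto
lemma dvdb_iff: "val m > 0 \<Longrightarrow> dvdb m n \<longleftrightarrow> val m dvd val n"
proof -
  assume m: "val m > 0"
  show ?thesis
  proof (cases "eqv m (B1 BE)")
    case True
    then show ?thesis by (simp add: dvdb_def eqv_iff)
  next
    case False
    then have "val (B1 BE) < val m" using m by (simp add: eqv_iff)
    then show ?thesis using False val_modmul[of "B1 BE" m n] by (simp add: dvdb_def eqv_iff dvd_eq_mod_eq_0)
  qed
qed

lemma dvdbs_sound:
  "val P > 1 \<Longrightarrow> val f > 1 \<Longrightarrow> dvdbs us P f N \<Longrightarrow> i < length us \<Longrightarrow> (val f * val P ^ i - 1) dvd val N"
proof (induction us arbitrary: f i)
  case (Cons u us)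
  show ?case
  proof (cases i)
    case 0
    then show ?thesis using Cons.prems dvdb_iff[of "dec f" N] by simp
  next
    case (Suc j)
    have "val (mul P f) > 1" using Cons.prems less_1_mult[of "val P" "val f"] by simp
    then show ?thesis using Cons.IH[of "mul P f" j] Cons.prems Suc by (simp add: mult_ac)
  qed
qed simp

lemma not_in_iff: "not_in v vs \<longleftrightarrow> map val v \<notin> map val ` set vs" by (induction vs) (auto simp: eqvl_iff)
lemma all_distinct_iff: "all_distinct vs \<longleftrightarrow> distinct (map (map val) vs)" by (induction vs) (auto simp: not_in_iff)

context char_field begin

lemma check_root_sound:
  assumes check: "check_root d t P r N" and Q: "Q = val d * val t + 1" and P: "val P = p"
  shows "length r = e" "\<exists>\<theta>\<in>units_ord (val t). \<theta> [^] e = horner \<theta> (map val r) \<and> pspan \<theta> e = carrier R"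
proof -
  have r: "r \<noteq> []" and et: "length r \<le> val t" and q: "val P ^ length r = val d * val t + 1"
    and per: "eqvl (iter (unary t) P r (unit_vec r)) (unit_vec r)"
    and N: "tl r = [] \<or> dvdbs (tl r) P P N \<and> 1 < val t \<and> \<not> eqvl (iter (unary (modmul t N (B1 BE))) P r
      (unit_vec r)) (unit_vec r)"
    using check by (auto simp: check_root_def nonempty_iff isnil_iff lt_iff eqv_iff val_power_len)
  have p1: "p > 1" using prime_gt_1_nat[OF prime_p] .
  have "p ^ length r = p ^ e" using q P Q card_eq by simp
  then show len: "length r = e" using p1 by simp
  let ?r = "map val r"
  have it: "map val (iter us P r (unit_vec r)) = norbit p ?r (length us)" for us
    using val_iter[OF _ r map_val_unit_vec, of P us] p1 P by simp
  have per': "norbit p ?r (val t) = norbit p ?r 0" using per it[of "unary t"] it[of "[]"] by (simp add: eqvl_iff)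
  let ?N = "val N mod val t"
  obtain \<theta> where \<theta>: "\<theta> \<in> units_ord (val t)" "\<theta> [^] length ?r = horner \<theta> ?r"
    "norbit p ?r ?N \<noteq> norbit p ?r 0 \<Longrightarrow> \<theta> [^] ?N \<noteq> \<one>"
    using exists_root[OF Q, of ?r ?N] r et per' by auto
  have t0: "val t > 0" using et r by (cases r) auto
  have \<theta>n: "\<theta> \<in> nonzero" using \<theta> units_ord_nonzero[OF t0] by auto
  have "e = 1 \<or> (\<forall>f. 0 < f \<longrightarrow> f < e \<longrightarrow> (p ^ f - 1) dvd val N) \<and> \<theta> [^] val N \<noteq> \<one>"
  proof (cases "tl r = []")
    case True
    then show ?thesis using len r by (cases r) auto
  next
    case False
    then have N': "dvdbs (tl r) P P N" "1 < val t" "\<not> eqvl (iter (unary (modmul t N (B1 BE))) P r (unit_vec r))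
      (unit_vec r)"
      using N by auto
    have "val (modmul t N (B1 BE)) = ?N" using val_modmul[of "B1 BE" t N] N' by simp
    then have "norbit p ?r ?N \<noteq> norbit p ?r 0" using N'(3) it[of "unary (modmul t N (B1 BE))"] it[of "[]"]
      by (simp add: eqvl_iff)
    then have "\<theta> [^] ?N \<noteq> \<one>" using \<theta>(3) by simp
    moreover have "\<theta> [^] val N = \<theta> [^] ?N"
    proof -
      have \<theta>t: "\<theta> \<in> carrier R" "\<theta> [^] val t = \<one>" using \<theta>(1) by (auto simp: units_ord_def)
      have "\<theta> [^] val N = \<theta> [^] (val t * (val N div val t) + ?N)" by simp
      also have "\<dots> = (\<theta> [^] val t) [^] (val N div val t) \<otimes> \<theta> [^] ?N"
        by (simp only: nat_pow_mult[OF \<theta>t(1), symmetric] nat_pow_pow[OF \<theta>t(1)])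
      finally show ?thesis using \<theta>t by simp
    qed
    moreover have "(p ^ f - 1) dvd val N" if "0 < f" "f < e" for f
    proof -
      have "(val P * val P ^ (f - 1) - 1) dvd val N"
        using that N'(1) P p1 len by (intro dvdbs_sound[of P P "tl r"]) auto
      then show ?thesis using that P by (simp flip: power_Suc)
    qed
    ultimately show ?thesis by simp
  qed
  then have "pspan \<theta> e = carrier R" using pspan_eq_carrier[of \<theta> ?r "val N"] \<theta>n \<theta>(2) len by simp
  then show "\<exists>\<theta>\<in>units_ord (val t). \<theta> [^] e = horner \<theta> ?r \<and> pspan \<theta> e = carrier R" using \<theta> len by auto
qed

lemma tree_set_power_tree:
  assumes \<theta>: "\<theta> \<in> carrier R" "\<theta> [^] length r = horner \<theta> (map val r)" and P: "val P = p" and r: "r \<noteq> []"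
  shows "tree_set \<theta> (power_tree P r t) = insert \<zero> ((\<lambda>i. \<theta> [^] i) ` {..<val t})"
proof -
  have p1: "p > 1" using prime_gt_1_nat[OF prime_p] .
  have "horner \<theta> (replicate n 0) = \<zero>" for n using \<theta> by (induction n) auto
  then have z: "tree_set \<theta> (point (zeros r)) = {\<zero>}" using tree_set_point[OF \<theta>(1)] map_val_zeros[of r] by simp
  have "map val ` set (orbit_list (unary t) P r (unit_vec r)) = norbit p (map val r) ` {..<val t}"
  proof -
    have "set (map (map val) (orbit_list (unary t) P r (unit_vec r))) = set (map (norbit p (map val r))
      [0..<0 + val t])"
      using val_orbit_list[OF _ r map_val_unit_vec, of P "unary t"] p1 P by simp
    then show ?thesis by (simp add: atLeast0LessThan)
  qed
  then have "(\<lambda>v. horner \<theta> (map val v)) ` set (orbit_list (unary t) P r (unit_vec r)) = horner \<theta> ` norbit p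
    (map val r) ` {..<val t}"
    by (metis image_image)
  also have "\<dots> = (\<lambda>i. \<theta> [^] i) ` {..<val t}"
    using horner_norbit_root[OF \<theta>(1), of "map val r"] \<theta>(2) r by (simp add: image_image)
  finally show ?thesis unfolding power_tree_def unit_vec_def[symmetric] tree_set_add_points[OF \<theta>(1)] z by auto
qed

lemma tree_set_sum_iter_power_tree:
  assumes \<theta>: "\<theta> \<in> carrier R" and P: "val P = p"
  shows "tree_set \<theta> (sum_iter us (unary P) K) = nsum (Suc (length us)) (tree_set \<theta> K)"
  by (rule tree_set_sum_iter[OF \<theta>]) (simp add: P emb_p)

lemma power_tree_subset_pows:
  assumes Q: "Q = d * t + 1" and \<theta>: "\<theta> \<in> units_ord t"
  shows "insert \<zero> ((\<lambda>i. \<theta> [^] i) ` {..<n::nat}) \<subseteq> pows d"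
proof -
  have H: "pows d = insert \<zero> (units_ord t)" using units_ord_eq(1)[of d t] Q by simp
  then have "\<theta> \<in> pows d" using \<theta> by simp
  then show ?thesis using pows_pow[of \<theta> d] H by auto
qed

lemma check_cover_sound:
  assumes check: "check_cover d t P r N m" and Q: "Q = val d * val t + 1" and P: "val P = p" and m: "val m \<le> 6"
    "val m > 0"
  shows "covers (val d) 6"
proof -
  have R: "check_root d t P r N" and f: "is_full (unary P) r (sum_iter (tl (unary m)) (unary P) (power_tree P r
    t))" using check by (auto simp: check_cover_def)
  have d0: "val d > 0" using Q Q_gt_1 by (auto intro: Nat.gr0I)
  obtain \<theta> where \<theta>: "\<theta> \<in> units_ord (val t)" "\<theta> [^] e = horner \<theta> (map val r)" "pspan \<theta> e = carrier R"
    using check_root_sound(2)[OF R Q P] by auto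
  have len: "length r = e" by (rule check_root_sound(1)[OF R Q P])
  have \<theta>c: "\<theta> \<in> carrier R" using \<theta> by (auto simp: units_ord_def)
  have r: "r \<noteq> []" using len e_pos by auto
  have "tree_set \<theta> (power_tree P r t) \<subseteq> pows (val d)"
    using tree_set_power_tree[OF \<theta>c _ P r, of t] \<theta> len power_tree_subset_pows[OF Q \<theta>(1)] by simp
  then have "nsum (val m) (tree_set \<theta> (power_tree P r t)) \<subseteq> nsum (val m) (pows (val d))" by (rule nsum_mono)
  moreover have "tree_set \<theta> (sum_iter (tl (unary m)) (unary P) (power_tree P r t)) =
    nsum (val m) (tree_set \<theta> (power_tree P r t))"
    using tree_set_sum_iter_power_tree[OF \<theta>c P, of "tl (unary m)"] m by simp
  moreover have "pspan \<theta> e \<subseteq> tree_set \<theta> (sum_iter (tl (unary m)) (unary P) (power_tree P r t))"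
    using is_full_sound[OF \<theta>c _ f] P len by simp
  ultimately have "covers (val d) (val m)" using \<theta>(3) by (auto simp: covers_def)
  then show ?thesis using covers_mono m d0 by blast
qed

lemma check_exact_sound:
  assumes check: "check_exact d t P r N m" and Q: "Q = val d * val t + 1" and P: "val P = p"
  shows "covers (val d) (val m)" "\<not> covers (val d) (val m - 1)"
proof -
  have R: "check_root d t P r N" and m: "val m > 1" and all_distinct:
    "all_distinct (orbit_list (unary t) P r (unit_vec r))"
    and cnt: "val (count_tree (sum_iter (tl (tl (unary m))) (unary P) (power_tree P r t))) < Q"
    and f: "is_full (unary P) r (sum_tree (unary P) (power_tree P r t) (sum_iter (tl (tl (unary m))) (unary P)
      (power_tree P r t)))"
    using check Q by (auto simp: check_exact_def check_exact''_def check_exact'_def lt_iff)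
  obtain \<theta> where \<theta>: "\<theta> \<in> units_ord (val t)" "\<theta> [^] e = horner \<theta> (map val r)" "pspan \<theta> e = carrier R"
    using check_root_sound(2)[OF R Q P] by auto
  have len: "length r = e" by (rule check_root_sound(1)[OF R Q P])
  have \<theta>c: "\<theta> \<in> carrier R" using \<theta> by (auto simp: units_ord_def)
  have r: "r \<noteq> []" using len e_pos by auto
  have p1: "p > 1" using prime_gt_1_nat[OF prime_p] .
  let ?K = "power_tree P r t" and ?n = "norbit p (map val r)"
  have K: "tree_set \<theta> ?K = insert \<zero> ((\<lambda>i. \<theta> [^] i) ` {..<val t})" using tree_set_power_tree[OF \<theta>c _ P r] \<theta> len
    by simp
  have H: "pows (val d) = insert \<zero> (units_ord (val t))" "card (units_ord (val t)) = val t"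
    using units_ord_eq[of "val d" "val t"] Q by auto
  have "distinct (map ?n [0..<val t])"
    using all_distinct val_orbit_list[OF _ r map_val_unit_vec, of P "unary t"] p1 P
      by (simp add: all_distinct_iff)
  then have inj: "inj_on ?n {..<val t}" by (simp add: distinct_map atLeast0LessThan)
  \<comment> \<open>Vectors with entries below p represent field elements uniquely, so t distinct
    vectors give t distinct powers of \<theta>, which exhaust the group.\<close>
  have "inj_on (horner \<theta>) (?n ` {..<val t})"
    by (rule inj_on_subset[OF horner_inj[OF \<theta>c \<theta>(3)]])
      (use norbit_less[OF p1] length_norbit[of "map val r"] r len in auto)
  then have "inj_on (\<lambda>i. horner \<theta> (?n i)) {..<val t}" using comp_inj_on[OF inj] by (simp add: comp_def)
  moreover have "horner \<theta> (?n i) = \<theta> [^] i" for i using horner_norbit_root[OF \<theta>c] \<theta> len r by simp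
  ultimately have "inj_on (\<lambda>i. \<theta> [^] i) {..<val t}" by simp
  then have c: "card ((\<lambda>i. \<theta> [^] i) ` {..<val t}) = val t" by (simp add: card_image)
  have "(\<lambda>i. \<theta> [^] i) ` {..<val t} \<subseteq> units_ord (val t)"
    using \<theta>(1) by (auto simp: units_ord_def nat_pow_pow mult.commute[of _ "val t"] simp flip: nat_pow_pow[of _
      "val t"])
  then have "(\<lambda>i. \<theta> [^] i) ` {..<val t} = units_ord (val t)"
    using c H(2) finite_carrier by (intro card_subset_eq) (auto simp: units_ord_def)
  then have KH: "tree_set \<theta> ?K = pows (val d)" using K H(1) by simp
  let ?S = "sum_iter (tl (tl (unary m))) (unary P) ?K"
  have S: "tree_set \<theta> ?S = nsum (val m - 1) (pows (val d))"
    using tree_set_sum_iter_power_tree[OF \<theta>c P, of "tl (tl (unary m))"] m KH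
      by (simp add: Suc_diff_Suc numeral_2_eq_2)
  have "card (nsum (val m - 1) (pows (val d))) < Q" using card_tree_set[of \<theta> ?S] S cnt by simp
  then show "\<not> covers (val d) (val m - 1)"
    unfolding covers_def using card_mono[of "nsum (val m - 1) (pows (val d))" "carrier R"]
      finite_subset[OF nsum_closed[OF pows_closed] finite_carrier] by (meson not_le)
  have "tree_set \<theta> (sum_tree (unary P) ?K ?S) = sumset (pows (val d)) (nsum (val m - 1) (pows (val d)))"
    using tree_set_sum_tree[OF \<theta>c, of "unary P" ?K ?S] P emb_p KH S by simp
  also have "\<dots> = sumset (nsum (val m - 1) (pows (val d))) (pows (val d))"
    by (intro sumset_comm nsum_closed pows_closed)
  also have "\<dots> = nsum (Suc (val m - 1)) (pows (val d))" by (simp add: sumset_def)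
  also have "Suc (val m - 1) = val m" using m by simp
  finally show "covers (val d) (val m)"
    using is_full_sound[OF \<theta>c _ f] P len \<theta>(3) by (simp add: covers_def)
qed

end

section \<open>Lists of certificates\<close>

context char_field begin

text \<open>In a prime field the binary numbers below q stand for the elements, and (1 + h)^t with h
  a d-th power is the class of a sum of two d-th powers.\<close>

lemma check_classes_sound:
  assumes check: "check_classes d t q g n" and Q: "Q = val d * val t + 1" and q: "val q = p" and e: "e = 1" and g:
    "val g < val q"
  shows "covers (val d) 6"
proof -
  let ?\<gamma> = "modpow q g d"
  let ?L = "class_list (unary n) q t ?\<gamma> (B1 BE) [B1 BE, BE]"
  define I where "I h \<longleftrightarrow> val h < p \<and> emb (val h) \<in> pows (val d)" for h
  \<comment> \<open>Zero is excused because the list starts with an entry 0 that represents no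
    class.\<close>
  define W where "W c \<longleftrightarrow> val c = 0 \<or> val c < p \<and> (\<exists>x\<in>nsum 2 (pows (val d)). x [^] val t = emb (val c))" for c
  have p1: "p > 1" using prime_gt_1_nat[OF prime_p] .
  have d0: "val d > 0" using Q Q_gt_1 by (auto intro: Nat.gr0I)
  have Qp: "Q = p" using card_eq e by simp
  have "emb (val ?\<gamma>) = emb (val g) [^] val d" using g q p1 by (simp add: val_modpow emb_mod emb_pow)
  then have \<gamma>: "emb (val ?\<gamma>) \<in> pows (val d)" by (auto simp: pows_def)
  have two: "x \<oplus> y \<in> nsum 2 (pows (val d))" if "x \<in> pows (val d)" "y \<in> pows (val d)" for x y
  proof -
    have "z \<in> nsum 1 (pows (val d))" if "z \<in> pows (val d)" for z
      using that pows_closed[of "val d"] by (auto intro!: exI[of _ \<zero>] exI[of _ z])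
    then have "x \<in> nsum 1 (pows (val d))" "y \<in> nsum 1 (pows (val d))" using that by blast+
    then show ?thesis using nsum_add[OF pows_closed, of x 1 "val d" y 1] by (simp add: numeral_2_eq_2)
  qed
  have I1: "I (B1 BE)" using p1 one_in_pows by (simp add: I_def)
  have Im: "I (modmul q ?\<gamma> h)" if "I h" for h
    using that \<gamma> p1 q pows_mult by (simp add: I_def val_modmul emb_mod emb_mult)
  have WI: "W (modpow q (csub q (inc h)) t)" if "I h" for h
  proof -
    have h: "val h < p" "emb (val h) \<in> pows (val d)" using that by (auto simp: I_def)
    have "val (csub q (inc h)) = (val h + 1) mod p" using h q p1 by (subst val_csub) auto
    moreover have "(val h + 1) mod p < p" using p1 by simp
    ultimately have v: "val (modpow q (csub q (inc h)) t) = ((val h + 1) mod p) ^ val t mod p" using q p1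
      by (subst val_modpow) auto
    have "emb (val (modpow q (csub q (inc h)) t)) = (emb (val h) \<oplus> \<one>) [^] val t"
      unfolding v emb_mod emb_pow by simp
    moreover have "emb (val h) \<oplus> \<one> \<in> nsum 2 (pows (val d))" using two h one_in_pows by blast
    moreover have "val (modpow q (csub q (inc h)) t) < p" unfolding v using p1 by simp
    ultimately show ?thesis unfolding W_def by metis
  qed
  have W0: "W c" if "c \<in> set [B1 BE, BE]" for c
  proof -
    have "\<one> \<in> nsum 2 (pows (val d))" using two[OF one_in_pows zero_in_pows[OF d0]] by simp
    then show ?thesis using that p1 by (auto simp: W_def intro!: bexI[of _ \<one>])
  qed
  note sum_forest = class_list_inv[of I "B1 BE" q ?\<gamma> W t "[B1 BE, BE]" "unary n", OF I1 Im WI W0]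
  have L: "\<forall>c\<in>set ?L. W c" "distinct (map val ?L)" "BE \<in> set ?L" using sum_forest by auto
  let ?V = "val ` set ?L - {0}"
  have cV: "card ?V = length ?L - 1"
  proof -
    have "card (val ` set ?L) = length ?L" using distinct_card[OF L(2)] by simp
    moreover have "0 \<in> val ` set ?L" using L(3) by force
    ultimately show ?thesis by simp
  qed
  have V: "v < p" "v > 0" "\<exists>x\<in>nsum 2 (pows (val d)). x [^] val t = emb v" if "v \<in> ?V" for v
    using that L(1) by (auto simp: W_def)
  have "inj_on emb ?V" using V emb_inj by (intro inj_onI) blast
  then have cC: "card (emb ` ?V) = length ?L - 1" using cV by (simp add: card_image)
  have len0: "length ?L > 0" using L(3) by (cases ?L) auto
  have n: "length ?L - 1 \<le> val d" and big: "val q * (val d - (length ?L - 1)) ^ 3 < ((length ?L - 1) * val t + 1)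
    ^ 3"
    using check len0 by (auto simp: check_classes_def check_classes'_def lt_iff val_sub)
  show ?thesis
  proof (rule covers_classes[OF Q _ cC])
    show "emb ` ?V \<subseteq> nonzero"
    proof
      fix c assume "c \<in> emb ` ?V"
      then obtain v where v: "v \<in> ?V" "c = emb v" by blast
      have "\<not> p dvd v" using V(1,2)[OF v(1)] dvd_imp_le[of p v] by linarith
      then show "c \<in> nonzero" using v(2) emb_eq_0_iff by simp
    qed
    show "\<exists>x\<in>nsum 2 (pows (val d)). x [^] val t = c" if "c \<in> emb ` ?V" for c using that V(3) by blast
    show "Q * (val d - (length ?L - 1)) ^ 3 < ((length ?L - 1) * val t + 1) ^ 3" using big Qp q by simp
  qed
qed

end

text \<open>Enough for trial division below \<open>75\<^sup>2 = 5625\<close>.\<close>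
definition small_primes :: "int list" where
  "small_primes = [2,3,5,7,11,13,17,19,23,29,31,37,41,43,47,53,59,61,67,71,73]"

fun bins_of_ints :: "int list \<Rightarrow> bin list" where "bins_of_ints [] = []"
  | "bins_of_ints (i # is) = bin_of_int i # bins_of_ints is"

section \<open>Primality and prime powers by trial division\<close>

fun trial_division :: "bin list \<Rightarrow> bin \<Rightarrow> bool" and trial_division' where
  "trial_division [] q = True" | "trial_division (a # as) q = trial_division' (dvdb a q) a as q"
| "trial_division' False a as q = trial_division as q"
    | "trial_division' True a as q = (eqv a q \<and> trial_division as q)"

definition prime_check :: "bin \<Rightarrow> bool" where
  "prime_check q \<longleftrightarrow> lt (B1 BE) q False \<and> lt q (bin_of_int 5625) False \<and> trial_division (bins_of_ints small_primes)
    q"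

text \<open>The list bounds how many powers are compared with q. When it runs out the answer is
  \<open>False\<close>, so nothing wrong is accepted.\<close>

fun nonpower :: "unit list \<Rightarrow> bin \<Rightarrow> bin \<Rightarrow> bin \<Rightarrow> bool" and nonpower' where
  "nonpower [] a x q = False"
| "nonpower (u # us) a x q = nonpower' (lt x q False) us a x q"
| "nonpower' True us a x q = nonpower us a (mul a x) q"
| "nonpower' False us a x q = (\<not> eqv x q)"

text \<open>The first prime divisor found decides, as a prime power is a power of its only prime
  divisor. Sixteen powers suffice: already 2^13 exceeds 5625.\<close>

fun factor_nonpower :: "bin list \<Rightarrow> bin \<Rightarrow> bool" and factor_nonpower' where
  "factor_nonpower [] q = False" | "factor_nonpower (a # as) q = factor_nonpower' (dvdb a q) a as q"
| "factor_nonpower' False a as q = factor_nonpower as q"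
    | "factor_nonpower' True a as q = nonpower (unary (B0 (B0 (B0 (B0 (B1 BE)))))) a a q"

definition nonprimepow :: "bin \<Rightarrow> bool" where "nonprimepow q = factor_nonpower (bins_of_ints small_primes) q"

lemma val_bin_of_int [simp]: "val (bin_of_int i) = nat i"
proof (cases "i \<le> 0")
  case False
  have "val (bin_of_num n) = nat_of_num n" for n by (induction n) auto
  then show ?thesis using False by (simp add: bin_of_int_def num_of_nat_inverse)
qed (simp add: bin_of_int_def)

lemma bins_of_ints_eq: "bins_of_ints is = map bin_of_int is" by (induction "is") auto

lemma trial_division_iff: "(\<forall>a\<in>set as. val a > 0) \<Longrightarrow> trial_division as q \<longleftrightarrow> (\<forall>a\<in>set as. val a dvd val q \<longrightarrow> val a =
  val q)"
proof (induction as)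
  case (Cons a as)
  then show ?case using dvdb_iff[of a q] by (cases "dvdb a q") (auto simp: eqv_iff)
qed simp

text \<open>A composite number below 121 has a prime factor at most 7, so four trial divisors settle
  the numbers up to 74.\<close>

lemma small_primes_complete: "Factorial_Ring.prime (a::nat) \<Longrightarrow> a < 75 \<Longrightarrow> int a \<in> set small_primes"
proof -
  assume a: "Factorial_Ring.prime a" "a < 75"
  have *: "\<forall>a\<in>set [2..74::int]. a \<in> set small_primes \<or> (\<exists>b\<in>set [2,3,5,7::int]. a mod b = 0 \<and> b < a)" by code_simp
  have "int a \<in> set [2..74::int]" using a prime_ge_2_nat[OF a(1)] unfolding set_upto atLeastAtMost_iff by linarith
  from bspec[OF * this] show ?thesis
  proof
    assume "\<exists>b\<in>set [2,3,5,7::int]. int a mod b = 0 \<and> b < int a"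
    then obtain b where b: "b \<in> set [2,3,5,7::int]" "int a mod b = 0" "b < int a" by (elim bexE conjE)
    have b2: "b \<ge> 2" using b(1) by auto
    have "b dvd int a" using b(2) by (rule dvd_eq_mod_eq_0[THEN iffD2])
    then have "nat b dvd a" using b2 by (simp add: nat_dvd_iff)
    moreover have "nat b \<noteq> 1" "nat b \<noteq> a" using b(3) b2 by linarith+
    ultimately show ?thesis using a(1) by (metis prime_nat_iff)
  qed
qed

lemma small_primes_prime: "a \<in> set small_primes \<Longrightarrow> Factorial_Ring.prime (nat a)"
  by (auto simp: small_primes_def)

text \<open>The smaller of two nontrivial factors of q < 75^2 is below 75, and so is each of its
  prime factors.\<close>

lemma prime_check_sound: "prime_check q \<Longrightarrow> Factorial_Ring.prime (val q)"
proof -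
  assume b: "prime_check q"
  have pos: "\<forall>a\<in>set (bins_of_ints small_primes). val a > 0" by (auto simp: bins_of_ints_eq small_primes_def)
  have q: "val q > 1" "val q < 5625" "\<And>a. a \<in> set small_primes \<Longrightarrow> nat a dvd val q \<Longrightarrow> nat a = val q"
    using b trial_division_iff[OF pos, of q] by (auto simp: prime_check_def lt_iff bins_of_ints_eq)
  show ?thesis
  proof (rule ccontr)
    assume np: "\<not> ?thesis"
    then obtain a where a: "Factorial_Ring.prime a" "a dvd val q" "a * a \<le> val q"
    proof -
      obtain m where m: "m dvd val q" "m \<noteq> 1" "m \<noteq> val q" using np q(1) by (auto simp: prime_nat_iff)
      then obtain k where k: "val q = m * k" by blast
      have k1: "k \<noteq> 1" "m \<noteq> 0" "k \<noteq> 0" using k m q(1) by (auto, cases k, auto)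
      obtain x where x: "x dvd val q" "x \<noteq> 1" "x * x \<le> val q" "x > 0"
      proof (cases "m \<le> k")
        case True then show ?thesis using that[of m] k m k1 by auto
      next
        case False then show ?thesis using that[of k] k m k1 by auto
      qed
      obtain a where "Factorial_Ring.prime a" "a dvd x" using prime_factor_nat[OF x(2)] by blast
      moreover have "a * a \<le> x * x" using calculation x by (intro mult_mono) (auto dest: dvd_imp_le)
      ultimately show ?thesis using that[of a] x by (meson dvd_trans le_trans)
    qed
    have "a < 75"
    proof (rule ccontr)
      assume "\<not> a < 75"
      then have "75 * 75 \<le> a * a" by (intro mult_mono) auto
      then show False using a q by simp
    qed
    then have "a = val q" using q(3)[of "int a"] small_primes_complete a by simp
    then show False using a(1) np by simp
  qed
qed

lemma nonpower_sound:
  "nonpower us a x q \<Longrightarrow> val a > 1 \<Longrightarrow> val x = val a ^ i \<Longrightarrow> j \<ge> i \<Longrightarrow> val a ^ j \<noteq> val q"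
proof (induction us arbitrary: x i)
  case (Cons u us)
  show ?case
  proof (cases "lt x q False")
    case True
    show ?thesis
    proof (cases "j = i")
      case True
      then show ?thesis using \<open>lt x q False\<close> Cons.prems by (simp add: lt_iff)
    next
      case False
      then show ?thesis using True Cons.IH[of "mul a x" "Suc i"] Cons.prems by simp
    qed
  next
    case False
    then have "val q \<le> val x" "val x \<noteq> val q" using Cons.prems by (auto simp: lt_iff eqv_iff)
    moreover have "val x \<le> val a ^ j" using Cons.prems by (simp add: power_increasing)
    ultimately show ?thesis by linarith
  qed
qed simp

lemma nonprimepow_sound: "nonprimepow q \<Longrightarrow> \<not> primepow (val q)"
proof
  assume b: "nonprimepow q" and pp: "primepow (val q)"
  have *: "factor_nonpower as q \<Longrightarrow> (\<forall>a\<in>set as. Factorial_Ring.prime (val a)) \<Longrightarrow> False" for as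
  proof (induction as)
    case (Cons a as)
    have a: "Factorial_Ring.prime (val a)" using Cons.prems by auto
    then have "val a > 1" by (rule prime_gt_1_nat)
    show ?case
    proof (cases "dvdb a q")
      case True
      then have n: "nonpower (unary (B0 (B0 (B0 (B0 (B1 BE)))))) a a q" using Cons.prems by simp
      have "val a dvd val q" using True dvdb_iff[of a q] \<open>val a > 1\<close> by simp
      moreover obtain p k where pk: "Factorial_Ring.prime p" "k > 0" "val q = p ^ k" using pp
        by (auto simp: primepow_def)
      ultimately have "val a = p" using a prime_dvd_power primes_dvd_imp_eq by metis
      then show ?thesis using nonpower_sound[OF n \<open>val a > 1\<close>, of 1 k] pk by simp
    next
      case False
      then show ?thesis using Cons by simp
    qed
  qed simp
  show False using *[of "bins_of_ints small_primes"] b small_primes_prime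
    by (auto simp: nonprimepow_def bins_of_ints_eq)
qed

text \<open>\<open>L\<close> contains, in increasing order, all prime powers among the first \<open>length us\<close> terms of
  \<open>q, q + d, q + 2 d, \<dots>\<close>\<close>
fun walk :: "bin \<Rightarrow> unit list \<Rightarrow> bin \<Rightarrow> bin list \<Rightarrow> bool" and walk' and walk'' where
  "walk d [] q L = True"
| "walk d (u # us) q [] = walk' (nonprimepow q) d us q []"
| "walk d (u # us) q (x # xs) = walk'' (eqv x q) d us q x xs"
| "walk'' True d us q x xs = walk d us (add q d) xs"
| "walk'' False d us q x xs = walk' (nonprimepow q) d us q (x # xs)"
| "walk' True d us q L = walk d us (add q d) L"
| "walk' False d us q L = False"

lemma walk_sound: "walk d us q L \<Longrightarrow> i < length us \<Longrightarrow> primepow (val q + i * val d) \<Longrightarrow> val q + i * val d \<in> val ` set L"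
proof (induction us arbitrary: q L i)
  case (Cons u us)
  have step: "val q + i * val d \<in> val ` set L'" if w: "walk d us (add q d) L'" and i0: "i \<noteq> 0" for L'
  proof -
    obtain j where j: "i = Suc j" using not0_implies_Suc[OF i0] by blast
    then show ?thesis using Cons.IH[OF w, of j] Cons.prems by (simp add: add.assoc)
  qed
  show ?case
  proof (cases "L \<noteq> [] \<and> eqv (hd L) q")
    case True
    then obtain x xs where L: "L = x # xs" "eqv x q" by (cases L) auto
    then show ?thesis using Cons.prems step[of xs] by (cases "i = 0") (auto simp: eqv_iff)
  next
    case False
    then have w: "walk' (nonprimepow q) d us q L" using Cons.prems(1) by (cases L) auto
    then have n: "nonprimepow q" by (cases "nonprimepow q") auto
    then have "i \<noteq> 0" using nonprimepow_sound[OF n] Cons.prems by (cases i) auto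
    then show ?thesis using w n step[of L] by simp
  qed
qed simp

text \<open>Certificates for \<open>q = d t + 1\<close>: \<open>IN t g n\<close> treats a prime \<open>q\<close> by the classes of \<open>1 + \<gamma> ^ i\<close>, \<open>i < n\<close>,
  with \<open>\<gamma> = g ^ d\<close>; \<open>IC t p r N m\<close> shows that \<open>m \<le> 6\<close> summands suffice and \<open>IX t p r N m\<close> that \<open>m\<close> is
  exact, with \<open>r\<close>, \<open>N\<close> as in \<open>check_root\<close>; \<open>IO t p e f\<close> shows that the \<open>d\<close>-th powers of the field with
  \<open>p ^ e\<close> elements lie in its subfield with \<open>p ^ f\<close> elements, as \<open>t\<close> divides \<open>p ^ f - 1\<close>.\<close>
datatype item = IN int int int | IC int int "int list" int int | IX int int "int list" int int
  | IO int int int int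

fun item_t :: "item \<Rightarrow> int" where
  "item_t (IN t g n) = t" | "item_t (IC t p r N m) = t" | "item_t (IX t p r N m) = t" | "item_t (IO t p e f) = t"

definition item_q :: "bin \<Rightarrow> item \<Rightarrow> bin" where "item_q d x = inc (mul d (bin_of_int (item_t x)))"

fun check_IN :: "bin \<Rightarrow> bin \<Rightarrow> bin \<Rightarrow> bin \<Rightarrow> bin \<Rightarrow> bool" where
  "check_IN d t q g n = (prime_check q \<and> lt g q False \<and> check_classes d t q g n)"
fun check_subfield :: "bin \<Rightarrow> bin \<Rightarrow> bin \<Rightarrow> bin \<Rightarrow> bin \<Rightarrow> bool" where
  "check_subfield d t P e f = (prime_check P \<and> eqv (power_len (unary e) P) (inc (mul d t)) \<and> lt f e False \<and>
    lt BE f False \<and> lt BE t False \<and> dvdb t (dec (power_len (unary f) P)))"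

fun check :: "bin \<Rightarrow> item \<Rightarrow> bool" where
  "check d (IN t g n) = check_IN d (bin_of_int t) (inc (mul d (bin_of_int t))) (bin_of_int g) (bin_of_int n)"
| "check d (IC t p r N m) = (prime_check (bin_of_int p) \<and> lt (bin_of_int m) (bin_of_int 6) True \<and>
    lt BE (bin_of_int m) False \<and> check_cover d (bin_of_int t) (bin_of_int p) (bins_of_ints r) (bin_of_int N)
      (bin_of_int m))"
| "check d (IX t p r N m) = (prime_check (bin_of_int p) \<and> check_exact d (bin_of_int t) (bin_of_int p)
    (bins_of_ints r) (bin_of_int N) (bin_of_int m))"
| "check d (IO t p e f) = check_subfield d (bin_of_int t) (bin_of_int p) (bin_of_int e) (bin_of_int f)"

fun check_all :: "bin \<Rightarrow> item list \<Rightarrow> bool" where "check_all d [] = True"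
  | "check_all d (x # xs) = (check d x \<and> check_all d xs)"
fun item_qs :: "bin \<Rightarrow> item list \<Rightarrow> bin list" where "item_qs d [] = []"
  | "item_qs d (x # xs) = item_q d x # item_qs d xs"
fun exact_values :: "item list \<Rightarrow> (int \<times> int) list" where
  "exact_values [] = []" | "exact_values (IX t p r N m # xs) = (t, m) # exact_values xs"
| "exact_values (IN t g n # xs) = exact_values xs" | "exact_values (IC t p r N m # xs) = exact_values xs"
    | "exact_values (IO t p e f # xs) = exact_values xs"

definition complete :: "int \<Rightarrow> int \<Rightarrow> item list \<Rightarrow> bool" where
  "complete d b xs \<longleftrightarrow> check_all (bin_of_int d) xs \<and> walk (bin_of_int d) (unary (bin_of_int b)) (inc (bin_of_int d))
    (item_qs (bin_of_int d) xs)"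

lemma check_all_iff: "check_all d xs \<longleftrightarrow> (\<forall>x\<in>set xs. check d x)" by (induction xs) auto
lemma item_qs_eq: "item_qs d xs = map (item_q d) xs" by (induction xs) auto
lemma exact_values_mem: "IX t p r N m \<in> set xs \<Longrightarrow> (t, m) \<in> set (exact_values xs)"
  by (induction xs rule: exact_values.induct) auto

context finite_field begin

lemma check_sound:
  assumes c: "check (bin_of_int (int d)) x" and Q: "Q = val (item_q (bin_of_int (int d)) x)"
  shows "covers d 6 \<or> (\<forall>m. \<not> covers d m) \<or>
    (\<exists>t p r N m. x = IX t p r N m \<and> covers d (nat m) \<and> \<not> covers d (nat m - 1))"
proof (cases x)
  case (IN t g n)
  then have q: "val (inc (mul (bin_of_int (int d)) (bin_of_int t))) = Q" using Q by (simp add: item_q_def)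
  interpret char_field R Q 1
    using c prime_check_sound[of "inc (mul (bin_of_int (int d)) (bin_of_int t))"] q IN by unfold_locales auto
  show ?thesis using check_classes_sound[of "bin_of_int (int d)" "bin_of_int t"
    "inc (mul (bin_of_int (int d)) (bin_of_int t))" "bin_of_int g" "bin_of_int n"] c q IN
    by (simp add: lt_iff)
next
  case (IC t p r N m)
  have "check_root (bin_of_int (int d)) (bin_of_int t) (bin_of_int p) (bins_of_ints r) (bin_of_int N)" using c IC
    by (simp add: check_cover_def)
  then have "Q = nat p ^ length r" using Q IC
    by (simp add: check_root_def item_q_def eqv_iff val_power_len bins_of_ints_eq)
  then interpret char_field R "nat p" "length r"
    using c prime_check_sound[of "bin_of_int p"] IC by unfold_locales auto
  show ?thesis using check_cover_sound[of "bin_of_int (int d)" "bin_of_int t" "bin_of_int p" "bins_of_ints r"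
    "bin_of_int N" "bin_of_int m"] c Q IC
    by (auto simp: lt_iff item_q_def)
next
  case (IX t p r N m)
  have "check_root (bin_of_int (int d)) (bin_of_int t) (bin_of_int p) (bins_of_ints r) (bin_of_int N)" using c IX
    by (simp add: check_exact_def)
  then have "Q = nat p ^ length r" using Q IX
    by (simp add: check_root_def item_q_def eqv_iff val_power_len bins_of_ints_eq)
  then interpret char_field R "nat p" "length r"
    using c prime_check_sound[of "bin_of_int p"] IX by unfold_locales auto
  show ?thesis using check_exact_sound[of "bin_of_int (int d)" "bin_of_int t" "bin_of_int p" "bins_of_ints r"
    "bin_of_int N" "bin_of_int m"] c Q IX
    by (auto simp: item_q_def)
next
  case (IO t p e f)
  have "check_subfield (bin_of_int (int d)) (bin_of_int t) (bin_of_int p) (bin_of_int e) (bin_of_int f)"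
    using c IO by simp
  then have o: "Q = nat p ^ nat e" "nat f < nat e" "0 < nat f" "nat t > 0"
    "dvdb (bin_of_int t) (dec (power_len (unary (bin_of_int f)) (bin_of_int p)))" and pr:
      "Factorial_Ring.prime (nat p)"
    using Q IO prime_check_sound[of "bin_of_int p"] by (auto simp: item_q_def eqv_iff val_power_len lt_iff)
  interpret char_field R "nat p" "nat e" using o pr by unfold_locales auto
  have "nat p ^ nat f > 0" using prime_gt_0_nat[OF pr] by simp
  then have "nat t dvd nat p ^ nat f - 1" using o(4,5) by (subst (asm) dvdb_iff) (auto simp: val_power_len)
  then show ?thesis using not_covers_subfield[of d "nat t" "nat f"] o Q IO by (simp add: item_q_def)
qed

lemma complete_sound:
  assumes c: "complete (int d) (int b) xs" and Q: "Q = d * t + 1" "t \<le> b" "primepow Q"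
  shows "covers d 6 \<or> (\<forall>m. \<not> covers d m) \<or>
    (\<exists>m. (int t, m) \<in> set (exact_values xs) \<and> covers d (nat m) \<and> \<not> covers d (nat m - 1))"
proof -
  have dt: "d > 0" "t > 0" using Q Q_gt_1 by (auto intro: Nat.gr0I)
  \<comment> \<open>The walk starts at d + 1, that is at t = 1, so q stands at place t - 1.\<close>
  have "val (inc (bin_of_int (int d))) + (t - 1) * val (bin_of_int (int d)) = Q"
    using dt Q by (cases t) (auto simp: algebra_simps)
  then have "Q \<in> val ` set (item_qs (bin_of_int (int d)) xs)"
    using c walk_sound[of "bin_of_int (int d)" "unary (bin_of_int (int b))" "inc (bin_of_int (int d))"
      "item_qs (bin_of_int (int d)) xs" "t - 1"] dt Q
    by (auto simp: complete_def)
  then obtain x where x: "x \<in> set xs" "Q = val (item_q (bin_of_int (int d)) x)" by (auto simp: item_qs_eq)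
  have check: "check (bin_of_int (int d)) x" using c x by (auto simp: complete_def check_all_iff)
  have "nat (item_t x) = t" using x(2) Q dt by (simp add: item_q_def)
  then have "item_t x = int t" using dt by linarith
  then show ?thesis using check_sound[OF check x(2)] exact_values_mem x(1) by fastforce
qed

end

section \<open>Certificates for d = 1, ..., 37\<close>

definition items1 :: "item list" where "items1 =
  []"

definition items2 :: "item list" where "items2 =
  []"

definition items3 :: "item list" where "items3 =
  [IO 1 2 2 1]"

definition items4 :: "item list" where "items4 =
  [IC 1 5 [1] 1 4, IO 2 3 2 1, IN 3 2 1]"

definition items5 :: "item list" where "items5 =
  [IC 2 11 [10] 1 5, IO 3 2 4 2, IN 6 2 1]"

definition items6 :: "item list" where "items6 =
  [IC 1 7 [1] 1 6, IC 2 13 [12] 1 6, IN 3 2 2, IO 4 5 2 1, IN 5 2 3, IN 6 2 2, IN 7 2 1,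
   IC 8 7 [6,3] 6 3]"

text \<open>For q = 64 = 7 * 9 + 1 the polynomial X^6 - X^3 - 1 is the ninth cyclotomic polynomial
  modulo 2, and 3255 is the least common multiple of 1, 3, 7, 15, 31. In the other certificates with
  e > 1, too, N is the least common multiple of the p^f - 1 with 0 < f < e.\<close>

definition items7 :: "item list" where "items7 =
  [IO 1 2 3 1, IN 4 2 2, IN 6 3 2, IC 9 2 [1,0,0,1,0,0] 3255 3, IN 10 2 1]"

definition items8 :: "item list" where "items8 =
  [IO 1 3 2 1, IX 2 17 [16] 1 8, IC 3 5 [4,4] 4 4, IN 5 2 3, IO 6 7 2 1, IN 9 2 3,
   IC 10 3 [2,1,2,1] 104 3, IN 11 2 3, IN 12 2 2, IN 14 2 2]"

definition items9 :: "item list" where "items9 =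
  [IX 2 19 [18] 1 9, IC 4 37 [6] 1 5, IO 7 2 6 3, IN 8 5 3, IN 12 2 2, IN 14 2 3]"

definition items10 :: "item list" where "items10 =
  [IX 1 11 [1] 1 10, IC 3 31 [5] 1 5, IC 4 41 [9] 1 4, IC 6 61 [14] 1 4, IN 7 2 3, IO 8 3 4 2,
   IN 10 2 3, IC 12 11 [10,5] 10 3, IN 13 2 2, IN 15 3 3, IN 18 2 2, IN 19 2 2, IN 21 5 2]"

definition items11 :: "item list" where "items11 =
  [IX 2 23 [22] 1 11, IC 6 67 [30] 1 5, IN 8 3 3, IN 18 2 2, IC 22 3 [2,0,1,1,1] 1040 2]"

definition items12 :: "item list" where "items12 =
  [IX 1 13 [1] 1 12, IO 2 5 2 1, IC 3 37 [10] 1 6, IC 4 7 [6,0] 6 6, IC 5 61 [9] 1 4,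
   IC 6 73 [9] 1 5, IN 8 5 4, IN 9 3 4, IO 10 11 2 1, IN 13 2 3, IC 14 13 [12,3] 12 3, IN 15 2 3,
   IN 16 2 3, IN 19 2 2, IN 20 3 2, IN 23 2 2, IC 24 17 [4,8] 16 3, IN 26 2 2, IN 28 2 2]"

definition items13 :: "item list" where "items13 =
  [IO 2 3 3 1, IC 4 53 [23] 1 6, IC 6 79 [24] 1 5, IN 10 2 4, IN 12 5 3, IN 24 2 2]"

definition items14 :: "item list" where "items14 =
  [IX 2 29 [28] 1 14, IC 3 43 [6] 1 6, IC 5 71 [5] 1 4, IC 8 113 [18] 1 4, IN 9 11 4,
   IO 12 13 2 1, IN 14 2 4, IN 15 3 3, IN 17 2 3, IN 20 2 3, IN 24 5 3, IN 27 2 2, IN 30 2 2,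
   IN 32 3 2, IN 33 2 2, IN 35 2 2]"

definition items15 :: "item list" where "items15 =
  [IO 1 2 4 1, IX 2 31 [30] 1 15, IC 4 61 [11] 1 5, IC 8 11 [1,3] 10 4, IN 10 3 5, IN 12 2 4,
   IN 14 2 4, IN 16 2 4, IC 17 2 [1,0,0,1,1,1,0,0] 1240155 3, IN 18 2 3, IN 22 3 3,
   IC 24 19 [11,4] 18 3, IN 28 3 3, IN 36 2 2, IN 38 2 2]"

definition items16 :: "item list" where "items16 =
  [IX 1 17 [1] 1 16, IO 3 7 2 1, IC 5 3 [2,2,2,2] 104 4, IC 6 97 [36] 1 6, IC 7 113 [16] 1 4,
   IN 12 5 6, IN 15 3 4, IN 16 7 6, IC 18 17 [16,3] 16 3, IN 21 2 4, IN 22 2 3, IN 25 7 3,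
   IN 27 2 3, IN 28 2 3, IC 33 23 [5,15] 22 3, IN 36 2 2, IN 37 2 2, IC 39 5 [4,0,4,1] 744 3,
   IN 40 2 2, IN 42 3 2]"

definition items17 :: "item list" where "items17 =
  [IC 6 103 [47] 1 6, IC 8 137 [10] 1 4, IN 14 7 7, IO 15 2 8 4, IN 18 5 5, IN 24 2 3, IN 26 3 3,
   IN 36 2 3, IN 38 2 3]"

definition items18 :: "item list" where "items18 =
  [IX 1 19 [1] 1 18, IX 2 37 [36] 1 18, IX 4 73 [27] 1 7, IC 6 109 [46] 1 6, IC 7 127 [2] 1 6,
   IC 9 163 [38] 1 4, IC 10 181 [46] 1 4, IC 11 199 [18] 1 5, IN 15 2 6, IO 16 17 2 1, IN 17 3 5,
   IC 19 7 [1,0,2] 48 3, IC 20 19 [18,6] 18 3, IN 21 3 4, IN 22 6 4, IN 24 6 4, IN 27 2 4,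
   IN 29 2 3, IN 30 2 3, IN 32 2 3, IN 34 6 3, IN 35 2 3, IN 41 2 3, IN 42 2 3, IN 45 2 3,
   IN 46 6 3, IN 49 3 2, IN 51 3 2, IN 52 2 2]"

definition items19 :: "item list" where "items19 =
  [IC 10 191 [7] 1 4, IC 12 229 [18] 1 4, IC 18 7 [3,0,0] 48 3, IN 22 6 4, IN 24 3 4, IN 30 3 4,
   IN 34 3 3, IN 40 2 3]"

definition items20 :: "item list" where "items20 =
  [IX 2 41 [40] 1 20, IX 3 61 [13] 1 8, IO 4 3 4 2, IC 5 101 [36] 1 5, IX 6 11 [10,1] 10 7,
   IC 9 181 [39] 1 4, IC 12 241 [4] 1 4, IN 14 3 6, IO 18 19 2 1, IN 20 6 5, IN 21 3 5,
   IN 23 3 4, IN 26 3 5, IN 27 2 4, IN 30 6 4, IN 32 2 4, IN 33 3 4, IN 35 7 4, IN 38 5 3,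
   IN 41 2 3, IC 42 29 [9,7] 28 3, IN 44 2 3, IN 47 2 3, IC 48 31 [6,6] 30 3, IN 51 2 3,
   IN 53 2 3, IN 59 2 3, IN 60 2 2]"

definition items21 :: "item list" where "items21 =
  [IX 2 43 [42] 1 21, IO 3 2 6 2, IC 6 127 [20] 1 6, IC 8 13 [5,0] 12 4, IC 10 211 [23] 1 4,
   IN 16 5 7, IN 18 2 5, IN 20 2 5, IN 22 2 5, IN 26 2 4, IN 30 2 4, IN 32 3 4, IN 36 2 4,
   IC 40 29 [12,6] 28 3, IN 42 2 3, IN 46 2 3, IN 48 2 3, IN 50 3 3, IN 52 2 3, IN 62 2 3]"

definition items22 :: "item list" where "items22 =
  [IX 1 23 [1] 1 22, IX 3 67 [29] 1 8, IX 4 89 [34] 1 7, IC 9 199 [43] 1 4,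
   IC 11 3 [1,1,2,1,0] 1040 3, IN 15 5 7, IN 16 3 6, IN 18 5 6, IN 19 2 6, IN 21 2 5,
   IC 24 23 [22,3] 22 3, IN 28 3 5, IN 30 2 4, IN 31 3 4, IN 33 2 4, IN 39 2 4, IN 40 6 4,
   IN 43 2 4, IN 45 3 3, IN 46 3 3, IN 51 2 3, IN 58 2 3, IN 60 5 4, IN 64 2 3, IN 66 3 3]"

definition items23 :: "item list" where "items23 =
  [IX 2 47 [46] 1 23, IX 6 139 [43] 1 7, IC 12 277 [35] 1 4, IN 20 2 6, IN 26 2 5, IN 30 2 5,
   IN 36 2 4, IN 42 2 4, IN 44 3 4, IN 50 5 3, IN 56 5 3, IN 60 2 3, IN 62 3 3, IN 72 3 3]"

definition items24 :: "item list" where "items24 =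
  [IO 1 5 2 1, IO 2 7 2 1, IX 3 73 [8] 1 8, IX 4 97 [22] 1 8, IO 5 11 2 1, IC 7 13 [12,7] 12 4,
   IC 8 193 [9] 1 5, IC 10 241 [36] 1 4, IC 12 17 [1,4] 16 5, IC 13 313 [27] 1 4, IN 14 5 7,
   IC 15 19 [8,3] 18 4, IN 17 3 8, IN 18 5 8, IN 19 5 6, IO 22 23 2 1, IN 24 5 7, IN 25 3 7,
   IC 26 5 [4,3,0,3] 744 3, IN 28 5 5, IN 32 2 5, IC 35 29 [4,1] 28 3, IN 39 2 4,
   IC 40 31 [15,1] 30 3, IN 42 3 4, IN 43 2 4, IN 47 2 4, IN 48 2 4, IN 50 2 4, IN 52 2 4,
   IN 54 7 4, IN 55 2 3, IC 57 37 [11,1] 36 3, IN 62 2 3, IN 67 6 3, IN 69 2 3,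
   IC 70 41 [4,31] 40 3, IN 73 2 3, IN 74 2 4, IN 75 2 4, IC 77 43 [8,1] 42 3, IN 78 2 3]"

definition items25 :: "item list" where "items25 =
  [IX 4 101 [10] 1 9, IX 6 151 [33] 1 7, IC 10 251 [32] 1 4, IN 16 3 7, IN 24 7 6, IN 28 5 5,
   IN 30 3 5, IN 42 2 4, IN 46 2 4, IN 48 2 4, IN 52 2 4, IN 58 2 4, IN 64 2 3, IN 72 3 3,
   IN 76 2 3, IN 78 2 3]"

definition items26 :: "item list" where "items26 =
  [IO 1 3 3 1, IX 2 53 [52] 1 26, IX 3 79 [23] 1 9, IC 5 131 [53] 1 6, IX 6 157 [13] 1 8,
   IC 12 313 [29] 1 4, IC 17 443 [13] 1 4, IN 20 3 7, IN 21 2 8, IN 23 2 6, IO 24 5 4 2,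
   IN 26 2 6, IC 28 3 [2,1,0,1,0,1] 125840 3, IN 33 3 5, IN 35 5 6, IN 36 7 5, IN 42 6 5,
   IN 45 2 4, IN 47 2 4, IN 48 3 4, IN 50 2 4, IN 51 2 4, IN 57 3 4, IN 62 5 4, IN 71 2 3,
   IN 72 2 3, IN 75 2 3, IN 77 2 3, IN 78 2 3, IN 80 2 3, IN 86 3 3, IN 90 3 3]"

definition items27 :: "item list" where "items27 =
  [IX 4 109 [33] 1 9, IX 6 163 [59] 1 8, IC 10 271 [27] 1 4, IC 14 379 [184] 1 3, IN 16 5 8,
   IN 18 3 9, IN 20 2 9, IN 28 2 6, IN 30 3 6, IN 34 2 5, IN 48 2 4, IN 54 2 4, IN 58 2 4,
   IN 60 2 4, IN 66 2 4, IN 74 2 3, IN 76 2 3, IN 80 2 3, IN 84 2 3, IN 88 2 3, IN 94 2 3]"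

definition items28 :: "item list" where "items28 =
  [IX 1 29 [1] 1 28, IX 4 113 [15] 1 7, IO 6 13 2 1, IC 7 197 [36] 1 5, IC 10 281 [49] 1 5,
   IC 12 337 [72] 1 4, IC 15 421 [35] 1 4, IC 16 449 [35] 1 4, IN 22 5 8, IN 24 5 7, IN 25 7 7,
   IO 26 3 6 3, IN 27 2 8, IC 30 29 [28,8] 28 3, IN 34 3 6, IN 36 2 6, IN 39 2 5, IN 46 2 5,
   IN 49 2 5, IN 51 3 5, IN 57 3 4, IC 60 41 [16,5] 40 3, IN 61 2 4, IC 66 43 [7,2] 42 3,
   IN 67 3 4, IN 69 2 4, IN 72 2 4, IN 76 2 4, IN 79 2 3, IN 81 5 3, IN 82 2 3, IN 85 2 3,
   IN 87 2 3, IN 90 2 3, IN 91 3 3, IN 94 2 3, IN 96 2 3, IN 100 2 3]"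

definition items29 :: "item list" where "items29 =
  [IX 2 59 [58] 1 29, IC 8 233 [12] 1 5, IC 12 349 [24] 1 4, IN 18 2 9, IN 32 6 6, IN 38 5 6,
   IN 44 2 5, IN 50 2 5, IN 54 3 5, IN 60 2 4, IN 68 2 4, IN 72 3 4, IN 84 2 3, IN 98 2 3]"

text \<open>For 31 and 61 the nonzero powers are 1, respectively 1 and -1, whence the value 30. For
  121 they are 1, -1, i, -i with i^2 = -1; each of the two coordinates modulo 11 takes up to five of
  them, whence 10.\<close>

definition items30 :: "item list" where "items30 =
  [IX 1 31 [1] 1 30, IX 2 61 [60] 1 30, IX 4 11 [10,0] 10 10, IC 5 151 [8] 1 6,
   IX 6 181 [49] 1 8, IC 7 211 [58] 1 5, IC 8 241 [8] 1 5, IC 9 271 [106] 1 4,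
   IC 11 331 [74] 1 4, IC 12 19 [8,0] 18 4, IC 14 421 [36] 1 4, IC 18 541 [36] 1 4,
   IC 19 571 [31] 1 4, IN 20 7 8, IN 21 3 8, IN 22 2 8, IN 23 3 10, IN 25 2 7, IN 27 5 8,
   IO 28 29 2 1, IC 32 31 [30,4] 30 3, IN 33 2 6, IN 34 6 6, IN 35 5 6, IN 39 11 6, IN 40 5 6,
   IN 41 2 6, IN 43 2 6, IN 44 3 5, IN 46 2 5, IN 49 2 5, IN 51 2 5, IN 54 5 5,
   IC 56 41 [9,9] 40 3, IN 58 2 5, IN 60 3 5, IN 61 3 4, IN 62 2 4, IN 65 2 4, IN 67 3 4,
   IN 71 2 4, IN 72 2 4, IN 74 2 4, IN 75 2 4, IN 76 2 4, IN 77 2 4, IN 78 2 4, IN 79 6 4,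
   IC 80 7 [6,0,2,3] 2736 3, IN 84 6 4, IN 85 2 4, IN 89 3 4, IN 91 2 3, IN 93 2 3, IN 95 2 3,
   IN 99 2 3, IN 100 2 3, IN 102 3 3, IN 104 2 3, IN 106 2 3, IN 109 3 3, IN 110 3 3, IN 111 2 3]"

definition items31 :: "item list" where "items31 =
  [IO 1 2 5 1, IO 4 5 3 1, IC 10 311 [95] 1 4, IC 12 373 [69] 1 5, IN 22 2 11,
   IC 33 2 [1,0,0,1,0,1,0,1,0,0] 1539032355 3, IN 36 2 6, IN 42 2 6, IN 46 2 6, IN 48 2 5,
   IN 52 2 7, IN 60 2 5, IN 76 2 4, IN 82 2 4, IN 88 2 4, IN 90 2 4, IN 102 2 3]"

definition items32 :: "item list" where "items32 =
  [IX 3 97 [35] 1 10, IX 6 193 [85] 1 8, IC 8 257 [4] 1 6, IC 9 17 [16,7] 16 4,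
   IC 11 353 [22] 1 4, IC 14 449 [5] 1 4, IC 18 577 [31] 1 4, IN 20 3 9, IN 21 6 9, IN 24 11 11,
   IN 29 2 8, IO 30 31 2 1, IN 36 5 7, IN 38 2 6, IN 39 3 6, IN 44 2 6, IN 50 7 6, IN 53 2 5,
   IN 59 5 5, IN 63 2 5, IN 65 2 5, IN 66 2 5, IC 69 47 [10,15] 46 3, IN 71 2 4,
   IC 75 7 [3,3,0,5] 2736 3, IN 81 3 5, IN 83 2 4, IN 84 2 4, IN 86 2 4, IN 95 2 4, IN 98 2 4,
   IN 99 3 4, IN 104 2 4, IN 105 2 3, IN 108 2 3, IN 113 2 3]"

definition items33 :: "item list" where "items33 =
  [IX 2 67 [66] 1 33, IX 6 199 [93] 1 9, IC 10 331 [8] 1 5, IC 12 397 [157] 1 4,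
   IC 14 463 [51] 1 4, IC 16 23 [1,4] 22 4, IN 20 2 9, IN 22 3 9, IN 26 2 8, IN 30 6 8,
   IO 31 2 10 5, IN 34 2 7, IN 40 2 7, IN 44 2 6, IN 54 2 6, IC 56 43 [4,11] 42 3, IN 64 3 5,
   IN 66 2 5, IN 70 2 5, IN 72 5 5, IN 82 2 4, IN 90 2 4, IN 92 2 4, IN 96 2 4, IN 100 3 4,
   IN 104 2 4, IN 106 2 4, IN 110 2 4, IN 112 2 3, IN 122 3 3, IN 124 2 3, IN 126 2 3]"

definition items34 :: "item list" where "items34 =
  [IX 3 103 [46] 1 10, IX 4 137 [37] 1 10, IC 7 239 [10] 1 6, IC 9 307 [46] 1 5,
   IC 12 409 [49] 1 5, IC 13 443 [35] 1 4, IC 18 613 [21] 1 4, IC 19 647 [55] 1 4, IN 27 7 8,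
   IN 28 5 8, IN 30 10 9, IN 33 2 9, IN 37 3 7, IN 39 3 7, IN 40 3 7, IN 42 3 7, IN 45 2 6,
   IN 49 3 6, IN 55 2 6, IN 58 2 6, IN 63 3 5, IN 69 2 5, IN 70 3 6, IN 75 2 6, IN 79 2 6,
   IN 82 3 4, IN 84 3 4, IN 90 3 4, IN 93 2 4, IN 97 3 4, IN 102 5 4, IN 105 2 4, IN 108 2 4,
   IN 114 2 4, IN 115 2 4, IN 118 2 4, IN 124 2 3, IN 130 2 3, IC 132 67 [2,0] 66 2, IN 133 2 3]"

definition items35 :: "item list" where "items35 =
  [IX 2 71 [70] 1 35, IX 6 211 [15] 1 9, IC 8 281 [60] 1 5, IC 12 421 [159] 1 4,
   IC 14 491 [105] 1 4, IC 18 631 [138] 1 4, IN 20 2 10, IC 24 29 [17,6] 28 3, IN 26 11 9,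
   IN 30 7 8, IC 38 11 [10,2,3] 120 3, IN 42 3 7, IC 48 41 [3,14] 40 3, IN 66 2 5, IN 68 3 5,
   IN 72 2 5, IN 74 2 5, IN 78 2 6, IN 80 3 5, IN 86 2 5, IN 92 3 4, IN 96 2 4, IN 102 2 4,
   IN 110 2 4, IC 117 2 [1,0,1,1,1,0,0,0,0,1,0,1] 34654391537535 3, IN 120 2 4, IN 122 2 4,
   IN 128 2 3, IN 132 2 3, IN 134 2 3, IN 138 3 3]"

definition items36 :: "item list" where "items36 =
  [IX 1 37 [1] 1 36, IX 2 73 [72] 1 36, IX 3 109 [45] 1 11, IX 5 181 [42] 1 7, IO 8 17 2 1,
   IC 10 19 [18,5] 18 5, IC 11 397 [16] 1 5, IC 12 433 [64] 1 4, IC 15 541 [110] 1 4,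
   IC 16 577 [27] 1 4, IC 17 613 [37] 1 4, IN 21 2 10, IC 23 829 [11] 1 3, IN 26 5 9,
   IN 28 11 10, IN 31 2 10, IN 32 7 8, IN 36 10 8, IC 38 37 [36,3] 36 3, IN 43 6 7, IN 45 2 7,
   IN 46 2 7, IN 47 3 7, IN 50 2 8, IN 52 2 6, IN 56 2 6, IN 57 3 6, IN 58 2 7, IN 60 2 6,
   IC 61 13 [1,0,4] 168 3, IN 63 5 6, IN 65 3 6, IN 66 2 6, IN 70 2 5, IN 71 5 5, IN 72 7 5,
   IC 78 53 [6,10] 52 3, IN 81 3 5, IN 82 2 5, IN 85 2 5, IN 88 6 5, IN 92 2 5, IN 96 2 4,
   IN 98 2 4, IN 101 2 4, IN 102 2 4, IN 103 3 4, IN 107 3 4, IN 108 2 4, IN 116 2 4, IN 121 2 4,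
   IN 133 3 4, IN 135 2 4, IN 137 2 3, IN 138 2 3, IC 140 71 [7,0] 70 2, IN 141 2 3, IN 142 2 3]"

definition items37 :: "item list" where "items37 =
  [IX 4 149 [44] 1 9, IX 6 223 [40] 1 9, IC 16 593 [82] 1 4, IN 34 3 8, IN 40 3 8, IN 48 3 7,
   IN 54 3 6, IN 60 2 6, IN 70 2 6, IN 78 3 5, IN 84 3 5, IN 88 2 5, IN 90 3 5, IN 100 2 4,
   IN 106 2 4, IN 114 2 4, IN 120 3 4, IN 126 2 4, IN 138 3 4, IC 144 73 [5,0] 72 2, IN 148 2 3]"

text \<open>The second argument b satisfies d (d - 1)^6 \<le> (b + 2)^5, so that the fields with t >
  b fall under the counting bound.\<close>

lemma complete1: "complete 1 0 items1" by code_simp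
lemma complete2: "complete 2 0 items2" by code_simp
lemma complete3: "complete 3 1 items3" by code_simp
lemma complete4: "complete 4 3 items4" by code_simp
lemma complete5: "complete 5 6 items5" by code_simp
lemma complete6: "complete 6 8 items6" by code_simp
lemma complete7: "complete 7 11 items7" by code_simp
lemma complete8: "complete 8 14 items8" by code_simp
lemma complete9: "complete 9 17 items9" by code_simp
lemma complete10: "complete 10 21 items10" by code_simp
lemma complete11: "complete 11 24 items11" by code_simp
lemma complete12: "complete 12 28 items12" by code_simp
lemma complete13: "complete 13 31 items13" by code_simp
lemma complete14: "complete 14 35 items14" by code_simp
lemma complete15: "complete 15 39 items15" by code_simp
lemma complete16: "complete 16 43 items16" by code_simp
lemma complete17: "complete 17 48 items17" by code_simp
lemma complete18: "complete 18 52 items18" by code_simp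
lemma complete19: "complete 19 56 items19" by code_simp
lemma complete20: "complete 20 61 items20" by code_simp
lemma complete21: "complete 21 65 items21" by code_simp
lemma complete22: "complete 22 70 items22" by code_simp
lemma complete23: "complete 23 75 items23" by code_simp
lemma complete24: "complete 24 80 items24" by code_simp
lemma complete25: "complete 25 85 items25" by code_simp
lemma complete26: "complete 26 90 items26" by code_simp
lemma complete27: "complete 27 95 items27" by code_simp
lemma complete28: "complete 28 100 items28" by code_simp
lemma complete29: "complete 29 105 items29" by code_simp
lemma complete30: "complete 30 111 items30" by code_simp
lemma complete31: "complete 31 116 items31" by code_simp
lemma complete32: "complete 32 122 items32" by code_simp
lemma complete33: "complete 33 127 items33" by code_simp
lemma complete34: "complete 34 133 items34" by code_simp
lemma complete35: "complete 35 139 items35" by code_simp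
lemma complete36: "complete 36 144 items36" by code_simp
lemma complete37: "complete 37 150 items37" by code_simp

section \<open>Existence of finite fields\<close>

lemma (in cring) emb_hom:
  assumes "ring_hom_ring R S h"
  shows "h ([(n::nat)] \<cdot> \<one>) = [n] \<cdot>\<^bsub>S\<^esub> \<one>\<^bsub>S\<^esub>"
proof -
  interpret h: ring_hom_ring R S h by fact
  show ?thesis by (induction n) auto
qed

context algebraically_closed begin

text \<open>Over the algebraic closure \<open>X ^ q - X\<close> has \<open>q\<close> simple roots, since for every root \<open>a\<close>
  it equals \<open>(X - a) ^ q - (X - a)\<close>.\<close>
lemma card_frobenius_fixed:
  fixes p :: nat
  assumes p: "Factorial_Ring.prime p" and char: "[p] \<cdot> \<one> = \<zero>" and e: "e > 0"
  shows "card {x \<in> carrier L. x [^] (p ^ e) = x} = p ^ e"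
proof -
  define q where "q = p ^ e"
  have q1: "q > 1" unfolding q_def using prime_gt_1_nat[OF p] e by (rule one_less_power)
  note K = carrier_is_subring
  let ?U = "poly_ring L"
  interpret UP: domain ?U using univ_poly_is_domain[OF K] .
  have X: "X \<in> carrier ?U" "polynomial (carrier L) X" using var_closed[OF K] by auto
  define P where "P = X [^]\<^bsub>?U\<^esub> q \<ominus>\<^bsub>?U\<^esub> X"
  have Pc: "P \<in> carrier ?U" using X by (simp add: P_def)
  have Xq: "X [^]\<^bsub>?U\<^esub> q = monom \<one> q" using unitary_monom_eq_var_pow[OF K, of q] by simp
  have evhom: "ring_hom_ring ?U L (\<lambda>f. eval f a)" if "a \<in> carrier L" for a
    using eval_ring_hom[OF K that] .
  have evP: "eval P a = a [^] q \<ominus> a" if a: "a \<in> carrier L" for a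
  proof -
    interpret h: ring_hom_ring ?U L "\<lambda>f. eval f a" by (rule evhom[OF a])
    have "eval P a = eval (X [^]\<^bsub>?U\<^esub> q) a \<oplus> \<ominus> eval X a"
      unfolding P_def UP.minus_eq using X by simp
    also have "eval (X [^]\<^bsub>?U\<^esub> q) a = (eval X a) [^] q" using X by (simp add: h.hom_nat_pow)
    finally show ?thesis using a eval_var[OF a] by (simp add: minus_eq)
  qed
  have deg: "degree P = q"
  proof -
    have "degree (X [^]\<^bsub>?U\<^esub> q) = q" unfolding Xq monom_def by simp
    moreover have "degree (\<ominus>\<^bsub>?U\<^esub> X) = 1" using univ_poly_a_inv_degree[OF K X(1)] by (simp add: var_def)
    moreover have "polynomial (carrier L) (X [^]\<^bsub>?U\<^esub> q)" "polynomial (carrier L) (\<ominus>\<^bsub>?U\<^esub> X)"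
      using X UP.nat_pow_closed[OF X(1), of q] UP.a_inv_closed[OF X(1)] by (simp_all add: univ_poly_carrier)
    ultimately show ?thesis
      using poly_add_degree_eq[OF K, of "X [^]\<^bsub>?U\<^esub> q" "\<ominus>\<^bsub>?U\<^esub> X"] q1
      by (simp add: P_def UP.minus_eq univ_poly_add)
  qed
  have P0: "P \<noteq> []" using deg q1 by auto
  have rootsP: "set_mset (roots P) = {x \<in> carrier L. x [^] q = x}"
  proof -
    have "(a [^] q \<ominus> a = \<zero>) = (a [^] q = a)" if "a \<in> carrier L" for a using that by simp
    then show ?thesis using roots_mem_iff_is_root[OF Pc] evP P0 by (auto simp: is_root_def)
  qed
  \<comment> \<open>At a double root a, the square of X - a would divide (X - a)^q - (X - a).
    Cancelling one factor X - a and evaluating at a gives 0 = -1.\<close>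
  have simple: "count (roots P) a \<le> 1" for a
  proof (rule ccontr)
    assume "\<not> count (roots P) a \<le> 1"
    then have m: "2 \<le> alg_mult P a" and "a \<in># roots P" using alg_mult_eq_count_roots[OF Pc]
      by (auto simp: Suc_le_eq simp flip: count_greater_zero_iff)
    then have a: "a \<in> carrier L" "a [^] q = a" using rootsP by auto
    let ?Y = "[\<one>, \<ominus> a]" and ?c = "poly_of_const a"
    interpret h: ring_hom_ring ?U L "\<lambda>f. eval f a" by (rule evhom[OF a(1)])
    have Y: "?Y \<in> carrier ?U" using a by (auto simp: univ_poly_carrier[symmetric] polynomial_def)
    have evY: "eval ?Y a = \<zero>" using a by (simp add: r_neg)
    interpret c: ring_hom_ring L ?U poly_of_const using canonical_embedding_ring_hom[OF K] by simp
    have cc: "?c \<in> carrier ?U" using a c.hom_closed by simp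
    have cq: "?c [^]\<^bsub>?U\<^esub> q = ?c" using a c.hom_nat_pow[OF a(1), of q] by simp
    have charU: "[p] \<cdot>\<^bsub>?U\<^esub> \<one>\<^bsub>?U\<^esub> = \<zero>\<^bsub>?U\<^esub>"
      using emb_hom[OF c.ring_hom_ring_axioms, of p] char by simp
    have XY: "X = ?Y \<oplus>\<^bsub>?U\<^esub> ?c"
      using a by (auto simp: univ_poly_add var_def poly_of_const_def l_neg r_neg)
    have "P = (?Y \<oplus>\<^bsub>?U\<^esub> ?c) [^]\<^bsub>?U\<^esub> q \<ominus>\<^bsub>?U\<^esub> (?Y \<oplus>\<^bsub>?U\<^esub> ?c)" unfolding P_def XY ..
    also have "\<dots> = (?Y [^]\<^bsub>?U\<^esub> q \<oplus>\<^bsub>?U\<^esub> ?c) \<ominus>\<^bsub>?U\<^esub> (?Y \<oplus>\<^bsub>?U\<^esub> ?c)"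
      unfolding q_def UP.frobenius_power[OF p charU Y cc] using cq unfolding q_def by simp
    also have "\<dots> = ?Y [^]\<^bsub>?U\<^esub> q \<ominus>\<^bsub>?U\<^esub> ?Y"
    proof -
      have "(A \<oplus>\<^bsub>?U\<^esub> C) \<ominus>\<^bsub>?U\<^esub> (B \<oplus>\<^bsub>?U\<^esub> C) = A \<ominus>\<^bsub>?U\<^esub> B"
        if "A \<in> carrier ?U" "B \<in> carrier ?U" "C \<in> carrier ?U" for A B C
        using that by (simp add: UP.minus_eq UP.minus_add UP.a_assoc UP.a_lcomm[of C] UP.r_neg)
      then show ?thesis using Y cc by simp
    qed
    also have "?Y [^]\<^bsub>?U\<^esub> q = ?Y \<otimes>\<^bsub>?U\<^esub> ?Y [^]\<^bsub>?U\<^esub> (q - 1)"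
    proof -
      have "Suc (q - 1) = q" using q1 by simp
      then show ?thesis using UP.nat_pow_Suc2[OF Y, of "q - 1"] by simp
    qed
    finally have P: "P = ?Y \<otimes>\<^bsub>?U\<^esub> ?Y [^]\<^bsub>?U\<^esub> (q - 1) \<ominus>\<^bsub>?U\<^esub> ?Y" .
    have "(?Y [^]\<^bsub>?U\<^esub> (2::nat)) pdivides P" using le_alg_mult_imp_pdivides[OF a(1) Pc m] .
    then obtain Z where Z: "Z \<in> carrier ?U" "P = ?Y [^]\<^bsub>?U\<^esub> (2::nat) \<otimes>\<^bsub>?U\<^esub> Z"
      by (auto simp: pdivides_def factor_def)
    let ?W = "?Y [^]\<^bsub>?U\<^esub> (q - 1)"
    have W: "?W \<in> carrier ?U" using Y by simp
    have "?Y \<otimes>\<^bsub>?U\<^esub> (?Y \<otimes>\<^bsub>?U\<^esub> Z) = ?Y \<otimes>\<^bsub>?U\<^esub> (?W \<ominus>\<^bsub>?U\<^esub> \<one>\<^bsub>?U\<^esub>)"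
    proof -
      have 1: "?Y [^]\<^bsub>?U\<^esub> (2::nat) \<otimes>\<^bsub>?U\<^esub> Z = ?Y \<otimes>\<^bsub>?U\<^esub> (?Y \<otimes>\<^bsub>?U\<^esub> Z)"
        using Y Z(1) by (simp add: numeral_2_eq_2 UP.m_assoc)
      have 2: "y \<otimes>\<^bsub>?U\<^esub> w \<ominus>\<^bsub>?U\<^esub> y = y \<otimes>\<^bsub>?U\<^esub> (w \<ominus>\<^bsub>?U\<^esub> \<one>\<^bsub>?U\<^esub>)" if "y \<in> carrier ?U" "w \<in> carrier ?U" for y w
        using that by algebra
      show ?thesis using Z(2) P 1 2[OF Y W] by simp
    qed
    moreover have "?Y \<noteq> \<zero>\<^bsub>?U\<^esub>" by (simp add: univ_poly_zero)
    ultimately have "?Y \<otimes>\<^bsub>?U\<^esub> Z = ?W \<ominus>\<^bsub>?U\<^esub> \<one>\<^bsub>?U\<^esub>"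
      using Y Z(1) W by (subst (asm) UP.m_lcancel) auto
    then have e1: "eval (?Y \<otimes>\<^bsub>?U\<^esub> Z) a = eval (?W \<oplus>\<^bsub>?U\<^esub> \<ominus>\<^bsub>?U\<^esub> \<one>\<^bsub>?U\<^esub>) a" by (simp add: UP.minus_eq)
    have e2: "eval (?Y \<otimes>\<^bsub>?U\<^esub> Z) a = \<zero>"
      using h.hom_mult[OF Y Z(1)] h.hom_closed[OF Z(1)] evY by (simp del: eval.simps)
    have e3: "eval (?W \<oplus>\<^bsub>?U\<^esub> \<ominus>\<^bsub>?U\<^esub> \<one>\<^bsub>?U\<^esub>) a = eval ?W a \<oplus> \<ominus> \<one>"
      using h.hom_add[OF W UP.a_inv_closed[OF UP.one_closed]] h.hom_a_inv[OF UP.one_closed] h.hom_one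
        by (simp del: eval.simps)
    have e4: "eval ?W a = \<zero>"
    proof -
      have "eval ?W a = (eval ?Y a) [^] (q - 1)" using h.hom_nat_pow[OF Y, of "q - 1"] .
      moreover have "\<zero> [^] (q - 1) = \<zero>" using q1 by (cases "q - 1") auto
      ultimately show ?thesis unfolding evY by simp
    qed
    have "\<ominus> \<one> = \<zero>" using e1 unfolding e2 e3 e4 by simp
    then show False by (metis add.inv_eq_1_iff one_closed one_not_zero)
  qed
  have "q = size (roots P)" using roots_over_carrier[OF Pc] deg by (simp add: splitted_def)
  also have "\<dots> = (\<Sum>x\<in>set_mset (roots P). count (roots P) x)" by (simp add: size_multiset_overloaded_eq)
  also have "\<dots> = (\<Sum>x\<in>set_mset (roots P). 1)"
  proof (rule sum.cong[OF refl])
    fix x assume "x \<in># roots P"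
    then have "count (roots P) x > 0" by simp
    then show "count (roots P) x = 1" using simple[of x] by linarith
  qed
  also have "\<dots> = card {x \<in> carrier L. x [^] q = x}" using rootsP by simp
  finally show ?thesis by (simp add: q_def)
qed

lemma frobenius_fixed_subfield:
  fixes p :: nat
  assumes p: "Factorial_Ring.prime p" and char: "[p] \<cdot> \<one> = \<zero>" and e: "e > 0"
  shows "subfield {x \<in> carrier L. x [^] (p ^ e) = x} L"
proof -
  let ?S = "{x \<in> carrier L. x [^] (p ^ e) = x}"
  have q: "p ^ e > 1" using prime_gt_1_nat[OF p] e by (rule one_less_power)
  have z: "\<zero> [^] (p ^ e) = \<zero>"
  proof -
    obtain n where "p ^ e = Suc n" using q by (cases "p ^ e") auto
    then show ?thesis by simp
  qed
  \<comment> \<open>Additivity applied to x + (-x) gives this in every characteristic, without a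
    distinction for p = 2.\<close>
  have neg: "(\<ominus> x) [^] (p ^ e) = \<ominus> (x [^] (p ^ e))" if "x \<in> carrier L" for x
  proof -
    have "(x \<oplus> \<ominus> x) [^] (p ^ e) = x [^] (p ^ e) \<oplus> (\<ominus> x) [^] (p ^ e)"
      using that by (intro frobenius_power[OF p char]) auto
    then have "x [^] (p ^ e) \<oplus> (\<ominus> x) [^] (p ^ e) = \<zero>" using that z by (simp add: r_neg)
    then show ?thesis using that by (metis a_comm a_inv_closed minus_equality nat_pow_closed)
  qed
  have S: "subring ?S L"
  proof (rule subringI)
    show "?S \<subseteq> carrier L" "\<one> \<in> ?S" by auto
    show "\<ominus> h \<in> ?S" if "h \<in> ?S" for h using that neg by simp
    show "h1 \<otimes> h2 \<in> ?S" if "h1 \<in> ?S" "h2 \<in> ?S" for h1 h2 using that by (simp add: nat_pow_distrib)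
    show "h1 \<oplus> h2 \<in> ?S" if "h1 \<in> ?S" "h2 \<in> ?S" for h1 h2
      using that frobenius_power[OF p char, of h1 h2 e] by simp
  qed
  show ?thesis
  proof (rule subfieldI'[OF S])
    fix k assume k: "k \<in> ?S - {\<zero>}"
    then have u: "k \<in> carrier L" "inv k \<in> carrier L" "k \<otimes> inv k = \<one>" "k [^] (p ^ e) = k"
      by (auto simp: field_Units)
    have "(k \<otimes> inv k) [^] (p ^ e) = k \<otimes> (inv k) [^] (p ^ e)" using u by (subst nat_pow_distrib) auto
    then have "k \<otimes> (inv k) [^] (p ^ e) = \<one>" using u by simp
    then have "(inv k) [^] (p ^ e) = inv k" using u by (metis comm_inv_char nat_pow_closed)
    then show "inv k \<in> ?S" using u by simp
  qed
qed

end

text \<open>Transport of structure along a bijection with an initial segment, because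
  \<open>GF\<close> asks for a carrier of natural numbers.\<close>

lemma (in field) nat_field:
  assumes fin: "finite (carrier R)"
  shows "\<exists>F :: nat ring. field F \<and> finite (carrier F) \<and> order F = order R"
proof -
  obtain f where f: "bij_betw f (carrier R) {0..<card (carrier R)}" using ex_bij_betw_finite_nat[OF fin] by blast
  define g where "g = inv_into (carrier R) f"
  define F where "F = \<lparr>carrier = {0..<card (carrier R)}, monoid.mult = (\<lambda>x y. f (g x \<otimes> g y)), one = f \<one>,
    ring.zero = f \<zero>, ring.add = (\<lambda>x y. f (g x \<oplus> g y))\<rparr>"
  have gf: "g (f x) = x" if "x \<in> carrier R" for x
    using f that unfolding g_def bij_betw_def by (simp add: inv_into_f_f)
  have "f \<in> ring_iso R F"
    using f gf bij_betwE[OF f] unfolding ring_iso_def by (auto intro!: ring_hom_memI simp: F_def)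
  then have "field (F \<lparr>zero := f \<zero>\<rparr>)" by (rule ring_iso_imp_img_field)
  moreover have "F \<lparr>zero := f \<zero>\<rparr> = F" by (simp add: F_def)
  ultimately show ?thesis by (intro exI[of _ F]) (auto simp: F_def order_def)
qed

text \<open>The field consists of the fixed points of x -> x^q in an algebraic closure of the
  integers modulo p. It ensures that the choice made in \<open>GF\<close> has the required
  properties.\<close>

theorem exists_GF:
  assumes "primepow q"
  shows "\<exists>F :: nat ring. field F \<and> finite (carrier F) \<and> order F = q"
proof -
  obtain p e where pe: "Factorial_Ring.prime p" "e > 0" "q = p ^ e" using assms by (auto simp: primepow_def)
  interpret Zp: residues_prime p "residue_ring (int p)" using pe by unfold_locales auto
  interpret Zp: finite_field "residue_ring (int p)"
    by unfold_locales (simp add: residue_ring_def)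
  have "card (carrier (residue_ring (int p))) = p ^ 1"
    using prime_gt_0_nat[OF pe(1)] by (simp add: residue_ring_def of_nat_diff)
  then have "Zp.emb p = \<zero>\<^bsub>residue_ring (int p)\<^esub>" by (rule Zp.char_primepow)
  then have char: "[p] \<cdot>\<^bsub>residue_ring (int p)\<^esub> \<one>\<^bsub>residue_ring (int p)\<^esub> = \<zero>\<^bsub>residue_ring (int p)\<^esub>"
    by (simp add: Zp.emb_eq)
  interpret A: algebraic_closure Zp.alg_closure "Zp.indexed_const ` carrier (residue_ring (int p))"
    by (rule Zp.alg_closureE(1))
  have "ring_hom_ring (residue_ring (int p)) Zp.alg_closure Zp.indexed_const"
    using ring_hom_ringI2[OF Zp.ring_axioms A.ring_axioms Zp.alg_closureE(2)] .
  then interpret h: ring_hom_ring "residue_ring (int p)" Zp.alg_closure Zp.indexed_const .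
  have "[p] \<cdot>\<^bsub>Zp.alg_closure\<^esub> \<one>\<^bsub>Zp.alg_closure\<^esub> = \<zero>\<^bsub>Zp.alg_closure\<^esub>"
    using Zp.emb_hom[OF h.ring_hom_ring_axioms, of p] char h.hom_zero by simp
  then have *: "card {x \<in> carrier Zp.alg_closure. x [^]\<^bsub>Zp.alg_closure\<^esub> (p ^ e) = x} = p ^ e"
    "subfield {x \<in> carrier Zp.alg_closure. x [^]\<^bsub>Zp.alg_closure\<^esub> (p ^ e) = x} Zp.alg_closure"
    using A.card_frobenius_fixed[OF pe(1) _ pe(2)] A.frobenius_fixed_subfield[OF pe(1) _ pe(2)] by auto
  let ?S = "{x \<in> carrier Zp.alg_closure. x [^]\<^bsub>Zp.alg_closure\<^esub> (p ^ e) = x}"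
  have "field (Zp.alg_closure \<lparr>carrier := ?S\<rparr>)" using A.subfield_iff(2)[OF *(2)] .
  moreover have "finite ?S" using *(1) prime_gt_0_nat[OF pe(1)] by (intro card_ge_0_finite) simp
  ultimately show ?thesis
    using field.nat_field[of "Zp.alg_closure \<lparr>carrier := ?S\<rparr>"] *(1) pe by (simp add: order_def)
qed

section \<open>The exceptional pairs\<close>

lemma exact_values_item: "(t, m) \<in> set (exact_values xs) \<Longrightarrow> \<exists>p r N. IX t p r N m \<in> set xs"
  by (induction xs rule: exact_values.induct) auto

context finite_field begin

text \<open>For t > b one has t + 1 \<ge> b + 2, which is the hypothesis of
  \<open>covers_large\<close>; for smaller t the list decides.\<close>

lemma complete_trichotomy:
  assumes c: "complete (int d) (int b) xs" and big: "d * (d - 1) ^ 6 \<le> (b + 2) ^ 5"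
    and Q: "Q = d * t + 1" "primepow Q"
  shows "covers d 6 \<or> (\<forall>m. \<not> covers d m) \<or>
    (\<exists>m. (int t, m) \<in> set (exact_values xs) \<and> covers d (nat m) \<and> \<not> covers d (nat m - 1))"
proof (cases "t \<le> b")
  case False
  then have "(b + 2) ^ 5 \<le> (t + 1) ^ 5" by (intro power_mono) auto
  then show ?thesis using covers_large[OF Q(1) order_trans[OF big]] by blast
qed (use complete_sound[OF c Q(1) _ Q(2)] in blast)

lemma complete_exact_values:
  assumes c: "complete (int d) (int b) xs" and tm: "(t, m) \<in> set (exact_values xs)" and Q: "Q = d * nat t + 1"
  shows "covers d (nat m)" "\<not> covers d (nat m - 1)"
proof -
  obtain p r N where x: "IX t p r N m \<in> set xs" using exact_values_item[OF tm] by blast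
  then have check: "check (bin_of_int (int d)) (IX t p r N m)" using c by (auto simp: complete_def check_all_iff)
  then have "check_root (bin_of_int (int d)) (bin_of_int t) (bin_of_int p) (bins_of_ints r) (bin_of_int N)"
    by (simp add: check_exact_def)
  then have "Q = nat p ^ length r" using Q by (simp add: check_root_def eqv_iff val_power_len bins_of_ints_eq)
  then interpret char_field R "nat p" "length r"
    using check prime_check_sound[of "bin_of_int p"] by unfold_locales auto
  show "covers d (nat m)" "\<not> covers d (nat m - 1)"
    using check_exact_sound[of "bin_of_int (int d)" "bin_of_int t" "bin_of_int p" "bins_of_ints r" "bin_of_int N"
      "bin_of_int m"] check Q by auto
qed

end

lemma complete_exact_values_primepow:
  assumes c: "complete (int d) (int b) xs" and tm: "(t, m) \<in> set (exact_values xs)"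
  shows "primepow (d * nat t + 1)"
proof -
  obtain p r N where x: "IX t p r N m \<in> set xs" using exact_values_item[OF tm] by blast
  then have check: "check (bin_of_int (int d)) (IX t p r N m)" using c by (auto simp: complete_def check_all_iff)
  then have "check_root (bin_of_int (int d)) (bin_of_int t) (bin_of_int p) (bins_of_ints r) (bin_of_int N)"
    by (simp add: check_exact_def)
  then have "d * nat t + 1 = nat p ^ length r" "length r > 0"
    by (auto simp: check_root_def nonempty_iff eqv_iff val_power_len bins_of_ints_eq)
  moreover have "Factorial_Ring.prime (nat p)" using check prime_check_sound[of "bin_of_int p"] by auto
  ultimately show ?thesis unfolding primepow_def by blast
qed

definition table :: "(nat \<times> nat \<times> item list) list" where
  "table = [
    (1, 0, items1), (2, 0, items2), (3, 1, items3), (4, 3, items4), (5, 6, items5),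
    (6, 8, items6), (7, 11, items7), (8, 14, items8), (9, 17, items9), (10, 21, items10),
    (11, 24, items11), (12, 28, items12), (13, 31, items13), (14, 35, items14),
    (15, 39, items15), (16, 43, items16), (17, 48, items17), (18, 52, items18),
    (19, 56, items19), (20, 61, items20), (21, 65, items21), (22, 70, items22),
    (23, 75, items23), (24, 80, items24), (25, 85, items25), (26, 90, items26),
    (27, 95, items27), (28, 100, items28), (29, 105, items29), (30, 111, items30),
    (31, 116, items31), (32, 122, items32), (33, 127, items33), (34, 133, items34),
    (35, 139, items35), (36, 144, items36), (37, 150, items37)]"

lemma complete_table: "(d, b, xs) \<in> set table \<Longrightarrow> complete (int d) (int b) xs \<and> d * (d - 1) ^ 6 \<le> (b + 2) ^ 5"
  by (auto simp: table_def simp del: add_2_eq_Suc add_2_eq_Suc' simp: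
      complete1[simplified] complete2[simplified] complete3[simplified] complete4[simplified]
      complete5[simplified] complete6[simplified] complete7[simplified] complete8[simplified]
      complete9[simplified] complete10[simplified] complete11[simplified]
      complete12[simplified] complete13[simplified] complete14[simplified]
      complete15[simplified] complete16[simplified] complete17[simplified]
      complete18[simplified] complete19[simplified] complete20[simplified]
      complete21[simplified] complete22[simplified] complete23[simplified]
      complete24[simplified] complete25[simplified] complete26[simplified]
      complete27[simplified] complete28[simplified] complete29[simplified]
      complete30[simplified] complete31[simplified] complete32[simplified]
      complete33[simplified] complete34[simplified] complete35[simplified]
      complete36[simplified] complete37[simplified])

lemma table_total: "0 < d \<Longrightarrow> d \<le> 37 \<Longrightarrow> \<exists>b xs. (d, b, xs) \<in> set table"
proof -
  assume d: "0 < d" "d \<le> 37"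
  have "map fst table = 1 # [2..<38]" by (simp add: table_def upt_rec_numeral)
  then have "fst ` set table = insert 1 {2..<38}" by (metis list.set(2) list.set_map set_upt)
  moreover have "d \<in> insert 1 {2..<38}" using d by auto
  ultimately have "d \<in> fst ` set table" by simp
  then obtain y where y: "d = fst y" "y \<in> set table" by (rule imageE)
  moreover have "y = (d, fst (snd y), snd (snd y))" using y(1) by simp
  ultimately show ?thesis by metis
qed

fun exceptions :: "(nat \<times> nat \<times> item list) list \<Rightarrow> (int \<times> int \<times> int) list" where
  "exceptions [] = []"
| "exceptions ((d, b, xs) # tab) = map (\<lambda>(t, m). (int d, int d * t + 1, m)) (exact_values xs) @ exceptions tab"

text \<open>The first component is d = gcd k (q - 1), not k: one entry stands for every k with this
  gcd.\<close>

definition exceptional :: "(int \<times> int \<times> int) list" where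
  "exceptional = [
    (8, 17, 8), (9, 19, 9), (10, 11, 10), (11, 23, 11), (12, 13, 12), (14, 29, 14), (15, 31, 15),
    (16, 17, 16), (18, 19, 18), (18, 37, 18), (18, 73, 7), (20, 41, 20), (20, 61, 8),
    (20, 121, 7), (21, 43, 21), (22, 23, 22), (22, 67, 8), (22, 89, 7), (23, 47, 23),
    (23, 139, 7), (24, 73, 8), (24, 97, 8), (25, 101, 9), (25, 151, 7), (26, 53, 26),
    (26, 79, 9), (26, 157, 8), (27, 109, 9), (27, 163, 8), (28, 29, 28), (28, 113, 7),
    (29, 59, 29), (30, 31, 30), (30, 61, 30), (30, 121, 10), (30, 181, 8), (32, 97, 10),
    (32, 193, 8), (33, 67, 33), (33, 199, 9), (34, 103, 10), (34, 137, 10), (35, 71, 35),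
    (35, 211, 9), (36, 37, 36), (36, 73, 36), (36, 109, 11), (36, 181, 7), (37, 149, 9),
    (37, 223, 9)]"

lemma exceptions_table: "exceptions table = exceptional"
  by (simp add: table_def exceptional_def
      items1_def items2_def items3_def items4_def items5_def items6_def items7_def
      items8_def items9_def items10_def items11_def items12_def items13_def items14_def
      items15_def items16_def items17_def items18_def items19_def items20_def items21_def
      items22_def items23_def items24_def items25_def items26_def items27_def items28_def
      items29_def items30_def items31_def items32_def items33_def items34_def items35_def
      items36_def items37_def)

lemma exceptions_iff:
  "(d, q, m) \<in> set (exceptions tab) \<longleftrightarrow>
     (\<exists>d' b xs t. (d', b, xs) \<in> set tab \<and> (t, m) \<in> set (exact_values xs) \<and> d = int d' \<and> q = int d' * t + 1)"
  by (induction tab rule: exceptions.induct) (auto 0 4)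

lemma GF_finite_field:
  assumes "primepow q"
  shows "finite_field (GF q)" "card (carrier (GF q)) = q"
proof -
  have "field (GF q) \<and> finite (carrier (GF q)) \<and> order (GF q) = q"
    unfolding GF_def by (rule someI_ex[OF exists_GF[OF assms]])
  then show "finite_field (GF q)" "card (carrier (GF q)) = q"
    by (auto simp: finite_field_def finite_field_axioms_def order_def)
qed

lemma waring_bound_iff:
  assumes "primepow q" "k > 0"
  shows "waring_bound k q m \<longleftrightarrow> 0 < m \<and> finite_field.covers (GF q) (gcd k (q - 1)) m"
proof -
  interpret finite_field "GF q" by (rule GF_finite_field(1)[OF assms(1)])
  show ?thesis
    using pows_gcd[OF assms(2)] GF_finite_field(2)[OF assms(1)]
    by (auto simp: waring_bound_def sums_of_powers_eq covers_def)
qed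

text \<open>Covering is monotone in the number of summands because 0 is a power, so failure for m -
  1 excludes all smaller numbers.\<close>

lemma gamma_eqI:
  assumes "primepow q" "k > 0" "m > 0"
    and "finite_field.covers (GF q) (gcd k (q - 1)) m" "\<not> finite_field.covers (GF q) (gcd k (q - 1)) (m - 1)"
  shows "gamma_exists k q" "gamma k q = m"
proof -
  interpret finite_field "GF q" by (rule GF_finite_field(1)[OF assms(1)])
  have w: "waring_bound k q m" using waring_bound_iff assms by simp
  then show "gamma_exists k q" by (auto simp: gamma_exists_def)
  show "gamma k q = m" unfolding gamma_def
  proof (rule Least_equality)
    show "waring_bound k q m" by (rule w)
    fix n assume n: "waring_bound k q n"
    show "m \<le> n"
    proof (rule ccontr)
      assume "\<not> m \<le> n"
      then have le: "n \<le> m - 1" by linarith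
      have "covers (gcd k (q - 1)) n" using n unfolding waring_bound_iff[OF assms(1,2)] by (rule conjunct2)
      moreover have "gcd k (q - 1) > 0" using assms(2) by simp
      ultimately have "covers (gcd k (q - 1)) (m - 1)" by (rule covers_mono[OF _ le])
      then show False using assms(5) by simp
    qed
  qed
qed

lemma exceptional_ge_7: "(d, q, m) \<in> set exceptional \<Longrightarrow> 7 \<le> m"
  by (auto simp: exceptional_def)

lemma exceptional_primepow:
  assumes "(d, q, m) \<in> set exceptional"
  shows "primepow (nat q)"
proof -
  obtain d' b xs t where e: "(d', b, xs) \<in> set table" "(t, m) \<in> set (exact_values xs)" "q = int d' * t + 1"
    using assms unfolding exceptions_table[symmetric] exceptions_iff by blast
  have pp: "primepow (d' * nat t + 1)" using complete_exact_values_primepow[OF _ e(2)] complete_table[OF e(1)]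
    by blast
  then have "t > 0" by (cases "t > 0") (simp_all add: not_less)
  then have "nat q = d' * nat t + 1" using e(3) by (simp add: nat_add_distrib nat_mult_distrib)
  then show ?thesis using pp by simp
qed

text \<open>From left to right, a value of at least 7 rules out six summands and existence rules out
  the second alternative of the trichotomy, so an exact value from the list remains. From right to
  left, the certificate supplies both bounds.\<close>

lemma gamma_exceptional_iff:
  assumes k: "4 \<le> k" "k \<le> 37"
  shows "primepow q \<and> gamma_exists k q \<and> 7 \<le> gamma k q \<and> gamma k q = m \<longleftrightarrow>
    (int (gcd k (q - 1)), int q, int m) \<in> set exceptional"
proof
  assume l: "primepow q \<and> gamma_exists k q \<and> 7 \<le> gamma k q \<and> gamma k q = m"
  then have q: "primepow q" by blast
  interpret finite_field "GF q" by (rule GF_finite_field(1)[OF q])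
  define d where "d = gcd k (q - 1)"
  have d: "0 < d" "d \<le> 37" using k by (auto simp: d_def intro: order_trans[OF gcd_le1_nat])
  obtain t where t: "q - 1 = d * t" unfolding d_def by (meson dvdE gcd_dvd2)
  then have Q: "card (carrier (GF q)) = d * t + 1" "primepow (card (carrier (GF q)))"
    using GF_finite_field(2)[OF q] q Q_gt_1 by auto
  obtain b xs where tab: "(d, b, xs) \<in> set table" using table_total[OF d] by blast
  have w: "waring_bound k q n \<longleftrightarrow> 0 < n \<and> covers d n" for n
    using waring_bound_iff[OF q] k by (simp add: d_def)
  have "\<not> covers d 6"
  proof
    assume "covers d 6"
    then have "gamma k q \<le> 6" unfolding gamma_def using w by (intro Least_le) simp
    then show False using l by simp
  qed
  moreover have "\<exists>m. covers d m" using l w by (auto simp: gamma_exists_def)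
  ultimately obtain m' where m': "(int t, m') \<in> set (exact_values xs)" "covers d (nat m')"
    "\<not> covers d (nat m' - 1)"
    using complete_trichotomy[of d b xs t] complete_table[OF tab] Q by blast
  have "int q = int d * int t + 1" using Q(1) GF_finite_field(2)[OF q] by simp
  then have ex: "(int d, int q, m') \<in> set exceptional"
    using tab m'(1) unfolding exceptions_table[symmetric] exceptions_iff by blast
  have "gamma k q = nat m'"
    using gamma_eqI(2)[OF q, of k "nat m'"] m' k exceptional_ge_7[OF ex] by (simp add: d_def)
  then show "(int (gcd k (q - 1)), int q, int m) \<in> set exceptional"
    using ex l exceptional_ge_7[OF ex] by (simp add: d_def)
next
  assume r: "(int (gcd k (q - 1)), int q, int m) \<in> set exceptional"
  then have q: "primepow q" using exceptional_primepow by fastforce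
  interpret finite_field "GF q" by (rule GF_finite_field(1)[OF q])
  define d where "d = gcd k (q - 1)"
  have d: "d > 0" using k by (simp add: d_def)
  obtain b xs t where e: "(d, b, xs) \<in> set table" "(t, int m) \<in> set (exact_values xs)" "int q = int d * t + 1"
    using r unfolding exceptions_table[symmetric] exceptions_iff d_def by auto
  have "q > 1" using GF_finite_field(2)[OF q] Q_gt_1 by simp
  then have "0 < int d * t" using e(3) by linarith
  then have "t > 0" using d by (simp add: zero_less_mult_iff)
  then have "int q = int (d * nat t + 1)" using e(3) by simp
  then have "card (carrier (GF q)) = d * nat t + 1" using GF_finite_field(2)[OF q] by linarith
  then have "covers d m" "\<not> covers d (m - 1)"
    using complete_exact_values[OF _ e(2), of d b] complete_table[OF e(1)] by auto
  then have "gamma_exists k q" "gamma k q = m"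
    using gamma_eqI[OF q, of k m] k exceptional_ge_7[OF r] by (auto simp: d_def)
  then show "primepow q \<and> gamma_exists k q \<and> 7 \<le> gamma k q \<and> gamma k q = m"
    using q exceptional_ge_7[OF r] by simp
qed

section \<open>From d = gcd k (q - 1) back to k\<close>

fun triples :: "(int \<times> int \<times> int) list \<Rightarrow> int list \<Rightarrow> (int \<times> int \<times> int) list" where
  "triples [] ks = []"
| "triples ((d, q, m) # xs) ks = map (\<lambda>k. (k, q, m)) (filter (\<lambda>k. gcd k (q - 1) = d) ks) @ triples xs ks"

lemma triples_iff: "(k, q, m) \<in> set (triples xs ks) \<longleftrightarrow> k \<in> set ks \<and> (gcd k (q - 1), q, m) \<in> set xs"
  by (induction xs ks rule: triples.induct) auto

text \<open>Here the pairs with k \<noteq> d come in, such as (24, 17, 8) from d = 8.\<close>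

lemma triples_exceptional: "triples exceptional [4..37] = [
    (8, 17, 8), (24, 17, 8), (9, 19, 9), (27, 19, 9), (10, 11, 10), (20, 11, 10), (30, 11, 10),
    (11, 23, 11), (33, 23, 11), (12, 13, 12), (24, 13, 12), (36, 13, 12), (14, 29, 14),
    (15, 31, 15), (16, 17, 16), (32, 17, 16), (18, 19, 18), (36, 19, 18), (18, 37, 18),
    (18, 73, 7), (20, 41, 20), (20, 61, 8), (20, 121, 7), (21, 43, 21), (22, 23, 22),
    (22, 67, 8), (22, 89, 7), (23, 47, 23), (23, 139, 7), (24, 73, 8), (24, 97, 8), (25, 101, 9),
    (25, 151, 7), (26, 53, 26), (26, 79, 9), (26, 157, 8), (27, 109, 9), (27, 163, 8),
    (28, 29, 28), (28, 113, 7), (29, 59, 29), (30, 31, 30), (30, 61, 30), (30, 121, 10),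
    (30, 181, 8), (32, 97, 10), (32, 193, 8), (33, 67, 33), (33, 199, 9), (34, 103, 10),
    (34, 137, 10), (35, 71, 35), (35, 211, 9), (36, 37, 36), (36, 73, 36), (36, 109, 11),
    (36, 181, 7), (37, 149, 9), (37, 223, 9)]"
  by code_simp

lemma gamma_triples_iff:
  assumes "4 \<le> k" "k \<le> 37"
  shows "primepow q \<and> gamma_exists k q \<and> 7 \<le> gamma k q \<and> gamma k q = m \<longleftrightarrow>
    (int k, int q, int m) \<in> set (triples exceptional [4..37])"
\<comment> \<open>For q = 0 the truncated q - 1 differs from the integer one; since 0 is no prime
  power, both sides are false.\<close>
proof (cases "q = 0")
  case True
  then have "\<not> primepow q" by (simp add: primepow_gt_0_nat)
  moreover have "(gcd (int k) (int q - 1), int q, int m) \<notin> set exceptional"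
    using exceptional_primepow[of _ "int q"] calculation by auto
  ultimately show ?thesis by (simp add: triples_iff)
next
  case False
  then have "int (gcd k (q - 1)) = gcd (int k) (int q - 1)"
    by (simp add: of_nat_diff Suc_le_eq flip: gcd_int_int_eq)
  moreover have "int k \<in> set [4..37]" using assms unfolding set_upto atLeastAtMost_iff by linarith
  ultimately show ?thesis using gamma_exceptional_iff[OF assms, of q m] by (simp only: triples_iff simp_thms)
qed

theorem theorem3p8:
  shows "{(k, q, gamma k q) | k q :: nat.
            4 \<le> k \<and> k \<le> 37 \<and> primepow q \<and> gamma_exists k q \<and> 7 \<le> gamma k q} =
    {(8, 17, 8),
     (9, 19, 9),
     (10, 11, 10),
     (11, 23, 11),
     (12, 13, 12),
     (14, 29, 14),
     (15, 31, 15),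
     (16, 17, 16),
     (18, 73, 7), (18, 19, 18), (18, 37, 18),
     (20, 121, 7), (20, 61, 8), (20, 11, 10), (20, 41, 20),
     (21, 43, 21),
     (22, 89, 7), (22, 67, 8), (22, 23, 22),
     (23, 139, 7), (23, 47, 23),
     (24, 17, 8), (24, 73, 8), (24, 97, 8), (24, 13, 12),
     (25, 151, 7), (25, 101, 9),
     (26, 157, 8), (26, 79, 9), (26, 53, 26),
     (27, 163, 8), (27, 19, 9), (27, 109, 9),
     (28, 113, 7), (28, 29, 28),
     (29, 59, 29),
     (30, 181, 8), (30, 11, 10), (30, 121, 10), (30, 31, 30), (30, 61, 30),
     (32, 193, 8), (32, 97, 10), (32, 17, 16),
     (33, 199, 9), (33, 23, 11), (33, 67, 33),
     (34, 103, 10), (34, 137, 10),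
     (35, 211, 9), (35, 71, 35),
     (36, 181, 7), (36, 109, 11), (36, 13, 12), (36, 19, 18), (36, 37, 36), (36, 73, 36),
     (37, 149, 9), (37, 223, 9)}"
proof -
  let ?S = "{(k, q, gamma k q) | k q :: nat. 4 \<le> k \<and> k \<le> 37 \<and> primepow q \<and> gamma_exists k q \<and> 7 \<le> gamma k q}"
  have S: "?S = (\<lambda>(k, q, m). (nat k, nat q, nat m)) ` set (triples exceptional [4..37])"
  proof (intro equalityI subsetI)
    fix x assume "x \<in> ?S"
    then obtain k q where x: "x = (k, q, gamma k q)" "4 \<le> k" "k \<le> 37" "primepow q" "gamma_exists k q"
      "7 \<le> gamma k q"
      by blast
    then have "(int k, int q, int (gamma k q)) \<in> set (triples exceptional [4..37])"
      using gamma_triples_iff by blast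
    then show "x \<in> (\<lambda>(k, q, m). (nat k, nat q, nat m)) ` set (triples exceptional [4..37])"
      unfolding x(1) by (rule rev_image_eqI) simp
  next
    fix x assume "x \<in> (\<lambda>(k, q, m). (nat k, nat q, nat m)) ` set (triples exceptional [4..37])"
    then obtain k q m where x: "x = (nat k, nat q, nat m)" and t: "(k, q, m) \<in> set (triples exceptional [4..37])"
      by auto
    have "k \<in> set [4..37]" and e: "(gcd k (q - 1), q, m) \<in> set exceptional"
      using t unfolding triples_iff by blast+
    then have k: "4 \<le> nat k" "nat k \<le> 37" "int (nat k) = k"
      unfolding set_upto atLeastAtMost_iff by linarith+
    \<comment> \<open>Positivity makes the passage between integers and natural numbers
      reversible.\<close>
    have "nat q > 0" by (rule primepow_gt_0_nat[OF exceptional_primepow[OF e]])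
    then have "int (nat q) = q" "int (nat m) = m" using exceptional_ge_7[OF e] by linarith+
    then have "primepow (nat q) \<and> gamma_exists (nat k) (nat q) \<and> 7 \<le> gamma (nat k) (nat q) \<and> gamma (nat k) (nat q)
      = nat m"
      using gamma_triples_iff[OF k(1,2), of "nat q" "nat m"] t k(3) by simp
    moreover from this have "x = (nat k, nat q, gamma (nat k) (nat q))" using x by simp
    ultimately show "x \<in> ?S" using k(1,2) by blast
  qed
  show ?thesis unfolding S triples_exceptional by (rule equalityI; simp)
qed

end
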